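(* Let $(\mathcal{O},p,q)$ be an admissible triple and $n=q^2+q+1$. Then $L_q$ is a Hermitian $\mathcal{O}$-lattice of signature $(1,n)$, the group $\operatorname{PGL}(3,\mathbb{F}_q)$ acts naturally on $L_q$ by isometries (the action being induced by its permutation action on the points and lines of $\mathbb{P}^2(\mathbb{F}_q)$), and $L_q\subseteq pL_q'$.
   Context: Admissible triple: $q$ is a power of a rational prime; $\mathcal{O}$ is either $\mathbb{Z}$, or the ring of integers of an imaginary quadratic number field, or Hurwitz's ring of integral quaternions (in which case modules are right modules); $p\in\mathcal{O}$ is a prime element with $|p|^2=q$ and $\bar z\equiv z \bmod p\mathcal{O}$ for all $z\in\mathcal{O}$. Hermitian forms $\langle\cdot\vert\cdot\rangle$ are linear in the second variable and conjugate-linear in the first. An $\mathcal{O}$-lattice is a finitely generated projective $\mathcal{O}$-module $L$ with an $\mathcal{O}$-valued Hermitian form with $\operatorname{Rad}(L)=0$, where $\operatorname{Rad}(L)=\{x\in L: \langle y\vert x\rangle=0\ \forall y\in L\}$. The dual $L'$ is the module of $\mathcal{O}$-valued linear functionals on $L$, identified via the form with $\{x\in L\otimes\operatorname{Frac}(\mathcal{O}):\langle y\vert x\rangle\in\mathcal{O}\ \forall y\in L\}\supseteq L$. Signature $(m,k)$ means that the Gram matrix of a basis of $L\otimes\operatorname{Frac}(\mathcal{O})$ has $m$ positive and $k$ negative eigenvalues. The lattice $L_q$: let $\mathcal{P}$ and $\mathcal{L}$ be the sets of points and lines of $\mathbb{P}^2(\mathbb{F}_q)$ ($n$ elements each), and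 write $x\in l$ for incidence. Let $L_q^\circ$ be the free $\mathcal{O}$-module of rank $2n$ with basis $\mathcal{P}\cup\mathcal{L}$ and Hermitian form determined on basis vectors by: $\langle r\vert r\rangle=-q$ for all $r\in\mathcal{P}\cup\mathcal{L}$; $\langle r\vert s\rangle=p$ if $r\in\mathcal{P}$, $s\in\mathcal{L}$, $r\in s$; $\langle r\vert s\rangle=\bar p$ if $r\in\mathcal{L}$, $s\in\mathcal{P}$, $s\in r$; and $0$ otherwise. Then $L_q=L_q^\circ/\operatorname{Rad}(L_q^\circ)$ with the induced form. *)

theory Defs
  imports "HOL-Analysis.Analysis" "HOL-Algebra.Algebra" "HOL-Number_Theory.Number_Theory"
begin

section \<open>Quaternions\<close>

text \<open>
  All coefficient rings live inside the division ring of real quaternions; a complex number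
  \<open>a + b \<i>\<close> is identified with the quaternion \<open>a + b i\<close>.  Quaternion conjugation and absolute
  value then restrict to the usual ones on the rationals and on imaginary quadratic fields.
\<close>

datatype quat = Quat (q_re: real) (q_i: real) (q_j: real) (q_k: real)

instantiation quat :: real_div_algebra
begin

definition zero_quat :: quat where "0 = Quat 0 0 0 0"

definition one_quat :: quat where "1 = Quat 1 0 0 0"

definition plus_quat :: "quat \<Rightarrow> quat \<Rightarrow> quat" where
  "x + y = Quat (q_re x + q_re y) (q_i x + q_i y) (q_j x + q_j y) (q_k x + q_k y)"

definition uminus_quat :: "quat \<Rightarrow> quat" where
  "- x = Quat (- q_re x) (- q_i x) (- q_j x) (- q_k x)"

definition minus_quat :: "quat \<Rightarrow> quat \<Rightarrow> quat" where
  "x - y = Quat (q_re x - q_re y) (q_i x - q_i y) (q_j x - q_j y) (q_k x - q_k y)"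

definition times_quat :: "quat \<Rightarrow> quat \<Rightarrow> quat" where
  "x * y = Quat
     (q_re x * q_re y - q_i x * q_i y - q_j x * q_j y - q_k x * q_k y)
     (q_re x * q_i y + q_i x * q_re y + q_j x * q_k y - q_k x * q_j y)
     (q_re x * q_j y - q_i x * q_k y + q_j x * q_re y + q_k x * q_i y)
     (q_re x * q_k y + q_i x * q_j y - q_j x * q_i y + q_k x * q_re y)"

definition scaleR_quat :: "real \<Rightarrow> quat \<Rightarrow> quat" where
  "a *\<^sub>R x = Quat (a * q_re x) (a * q_i x) (a * q_j x) (a * q_k x)"

definition inverse_quat :: "quat \<Rightarrow> quat" where
  "inverse x = (let s = (q_re x)\<^sup>2 + (q_i x)\<^sup>2 + (q_j x)\<^sup>2 + (q_k x)\<^sup>2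
     in Quat (q_re x / s) (- q_i x / s) (- q_j x / s) (- q_k x / s))"

definition divide_quat :: "quat \<Rightarrow> quat \<Rightarrow> quat" where
  "x div y = x * inverse (y :: quat)"

instance
proof
  fix x y z :: quat and a b :: real
  show "x + y + z = x + (y + z)" "x + y = y + x" "0 + x = x" "- x + x = 0" "x - y = x + - y"
    by (simp_all add: plus_quat_def zero_quat_def uminus_quat_def minus_quat_def quat.expand)
  show "x * y * z = x * (y * z)" "(x + y) * z = x * z + y * z" "x * (y + z) = x * y + x * z"
    by (simp_all add: plus_quat_def times_quat_def algebra_simps)
  show "1 * x = x" "x * 1 = x" "(0::quat) \<noteq> 1"
    by (simp_all add: times_quat_def one_quat_def zero_quat_def quat.expand)
  show "a *\<^sub>R (x + y) = a *\<^sub>R x + a *\<^sub>R y" "(a + b) *\<^sub>R x = a *\<^sub>R x + b *\<^sub>R x"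
    "a *\<^sub>R b *\<^sub>R x = (a * b) *\<^sub>R x" "1 *\<^sub>R x = x"
    "a *\<^sub>R x * y = a *\<^sub>R (x * y)" "x * a *\<^sub>R y = a *\<^sub>R (x * y)"
    by (simp_all add: plus_quat_def times_quat_def scaleR_quat_def algebra_simps)
  show "x div y = x * inverse y"
    by (simp add: divide_quat_def)
  show "inverse (0::quat) = 0"
    by (simp add: inverse_quat_def zero_quat_def)
  define s where "s = (q_re x)\<^sup>2 + (q_i x)\<^sup>2 + (q_j x)\<^sup>2 + (q_k x)\<^sup>2"
  assume "x \<noteq> 0"
  then have "s \<noteq> 0"
    by (cases x) (auto simp: s_def zero_quat_def add_nonneg_eq_0_iff)
  then have 1: "q_re x * q_re x / s + q_i x * q_i x / s + q_j x * q_j x / s + q_k x * q_k x / s = 1"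
    by (simp add: s_def power2_eq_square flip: add_divide_distrib)
  then show "inverse x * x = 1" "x * inverse x = 1"
    by (simp_all add: inverse_quat_def times_quat_def one_quat_def mult.commute flip: s_def)
qed

end

definition qcnj :: "quat \<Rightarrow> quat" where
  "qcnj z = Quat (q_re z) (- q_i z) (- q_j z) (- q_k z)"

definition qabs :: "quat \<Rightarrow> real" where
  "qabs z = sqrt ((q_re z)\<^sup>2 + (q_i z)\<^sup>2 + (q_j z)\<^sup>2 + (q_k z)\<^sup>2)"

definition quat_of_complex :: "complex \<Rightarrow> quat" where
  "quat_of_complex z = Quat (Re z) (Im z) 0 0"

section \<open>Coefficient rings and admissible triples\<close>

definition qring :: "quat set \<Rightarrow> quat ring" where
  "qring R = \<lparr>carrier = R, monoid.mult = (*), monoid.one = 1, ring.zero = 0, ring.add = (+)\<rparr>"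

text \<open>Every imaginary quadratic number field is of this form for some \<open>d > 0\<close>.\<close>

definition imag_quadratic_field :: "nat \<Rightarrow> complex set" where
  "imag_quadratic_field d = {of_rat a + of_rat b * (\<i> * of_real (sqrt (real d))) | a b. True}"

definition ring_of_integers :: "complex set \<Rightarrow> complex set" where
  "ring_of_integers K = {z \<in> K. algebraic_int z}"

definition hurwitz_integers :: "quat set" where
  "hurwitz_integers = {z. (q_re z \<in> \<int> \<and> q_i z \<in> \<int> \<and> q_j z \<in> \<int> \<and> q_k z \<in> \<int>) \<or>
     (q_re z - 1/2 \<in> \<int> \<and> q_i z - 1/2 \<in> \<int> \<and> q_j z - 1/2 \<in> \<int> \<and> q_k z - 1/2 \<in> \<int>)}"

text \<open>
  In the commutative cases a prime element is a nonzero nonunit \<open>p\<close> such that \<open>p\<close> divides a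
  factor whenever it divides a product.  In the noncommutative ring of Hurwitz integers a prime is,
  as usual, a nonzero nonunit that is not a product of two nonunits.
\<close>

definition admissible_triple :: "quat set \<Rightarrow> quat \<Rightarrow> nat \<Rightarrow> bool" where
  "admissible_triple R p q \<longleftrightarrow>
     primepow q \<and>
     ((R = \<int> \<or> (\<exists>d>0. R = quat_of_complex ` ring_of_integers (imag_quadratic_field d))) \<and>
        ring_prime\<^bsub>qring R\<^esub> p \<or>
      R = hurwitz_integers \<and> ring_irreducible\<^bsub>qring R\<^esub> p) \<and>
     p \<in> R \<and> (qabs p)\<^sup>2 = real q \<and>
     (\<forall>z\<in>R. \<exists>w\<in>R. qcnj z - z = p * w)"

definition Frac :: "quat set \<Rightarrow> quat set" where
  "Frac R = {a * inverse s | a s. a \<in> R \<and> s \<in> R \<and> s \<noteq> 0}"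

section \<open>Right modules\<close>

text \<open>
  HOL-Algebra only has modules over commutative rings.  For right modules we use the same record;
  \<open>a \<odot>\<^bsub>M\<^esub> x\<close> stands for the right multiple \<open>x a\<close>.
\<close>

locale right_module = R?: ring R + M?: abelian_group M
  for R :: "('a, 'm) ring_scheme" (structure) and M :: "('a, 'b, 'n) module_scheme" (structure) +
  assumes rsmult_closed: "\<lbrakk>a \<in> carrier R; x \<in> carrier M\<rbrakk> \<Longrightarrow> a \<odot>\<^bsub>M\<^esub> x \<in> carrier M"
    and rsmult_l_distr: "\<lbrakk>a \<in> carrier R; b \<in> carrier R; x \<in> carrier M\<rbrakk> \<Longrightarrow>
          (a \<oplus>\<^bsub>R\<^esub> b) \<odot>\<^bsub>M\<^esub> x = a \<odot>\<^bsub>M\<^esub> x \<oplus>\<^bsub>M\<^esub> b \<odot>\<^bsub>M\<^esub> x"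
    and rsmult_r_distr: "\<lbrakk>a \<in> carrier R; x \<in> carrier M; y \<in> carrier M\<rbrakk> \<Longrightarrow>
          a \<odot>\<^bsub>M\<^esub> (x \<oplus>\<^bsub>M\<^esub> y) = a \<odot>\<^bsub>M\<^esub> x \<oplus>\<^bsub>M\<^esub> a \<odot>\<^bsub>M\<^esub> y"
    and rsmult_assoc: "\<lbrakk>a \<in> carrier R; b \<in> carrier R; x \<in> carrier M\<rbrakk> \<Longrightarrow>
          (a \<otimes>\<^bsub>R\<^esub> b) \<odot>\<^bsub>M\<^esub> x = b \<odot>\<^bsub>M\<^esub> (a \<odot>\<^bsub>M\<^esub> x)"
    and rsmult_one: "x \<in> carrier M \<Longrightarrow> \<one>\<^bsub>R\<^esub> \<odot>\<^bsub>M\<^esub> x = x"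

definition right_module_hom ::
  "('a, 'm) ring_scheme \<Rightarrow> ('a, 'b, 'n) module_scheme \<Rightarrow> ('a, 'c, 'k) module_scheme \<Rightarrow> ('b \<Rightarrow> 'c) set"
  where "right_module_hom R M N =
    {f \<in> carrier M \<rightarrow> carrier N.
       (\<forall>x\<in>carrier M. \<forall>y\<in>carrier M. f (x \<oplus>\<^bsub>M\<^esub> y) = f x \<oplus>\<^bsub>N\<^esub> f y) \<and>
       (\<forall>a\<in>carrier R. \<forall>x\<in>carrier M. f (a \<odot>\<^bsub>M\<^esub> x) = a \<odot>\<^bsub>N\<^esub> f x)}"

definition free_module :: "quat set \<Rightarrow> 'i set \<Rightarrow> (quat, 'i \<Rightarrow> quat) module" where
  "free_module R I =
    \<lparr>carrier = {v. (\<forall>i. v i \<in> R) \<and> (\<forall>i. i \<notin> I \<longrightarrow> v i = 0) \<and> finite {i. v i \<noteq> 0}},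
     monoid.mult = undefined, monoid.one = undefined,
     ring.zero = (\<lambda>i. 0), ring.add = (\<lambda>v w i. v i + w i), smult = (\<lambda>a v i. v i * a)\<rparr>"

definition unit_vec :: "'i \<Rightarrow> quat \<Rightarrow> 'i \<Rightarrow> quat" where
  "unit_vec i c = (\<lambda>j. if j = i then c else 0)"

definition finitely_generated :: "(quat, 'm) ring_scheme \<Rightarrow> (quat, 'b, 'n) module_scheme \<Rightarrow> bool" where
  "finitely_generated R M \<longleftrightarrow>
     (\<exists>S. finite S \<and> S \<subseteq> carrier M \<and>
        (\<forall>x\<in>carrier M. \<exists>c\<in>S \<rightarrow> carrier R. x = (\<Oplus>\<^bsub>M\<^esub>s\<in>S. c s \<odot>\<^bsub>M\<^esub> s)))"

text \<open>
  Projective means: a direct summand (retract) of a free module.  Index sets inside the type of \<open>M\<close>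
  suffice, since a projective module is a direct summand of the free module on its own elements.
\<close>

definition projective :: "quat set \<Rightarrow> (quat, 'b, 'n) module_scheme \<Rightarrow> bool" where
  "projective R M \<longleftrightarrow>
     (\<exists>(I :: 'b set) f g. f \<in> right_module_hom (qring R) M (free_module R I) \<and>
        g \<in> right_module_hom (qring R) (free_module R I) M \<and>
        (\<forall>x\<in>carrier M. g (f x) = x))"

definition is_basis ::
  "('a, 'm) ring_scheme \<Rightarrow> ('a, 'b, 'n) module_scheme \<Rightarrow> nat \<Rightarrow> (nat \<Rightarrow> 'b) \<Rightarrow> bool" where
  "is_basis R M N b \<longleftrightarrow>
     (\<forall>i<N. b i \<in> carrier M) \<and>
     (\<forall>x\<in>carrier M. \<exists>!c. c \<in> {..<N} \<rightarrow>\<^sub>E carrier R \<and> x = (\<Oplus>\<^bsub>M\<^esub>i\<in>{..<N}. c i \<odot>\<^bsub>M\<^esub> b i))"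

definition generated_submodule ::
  "('a, 'm) ring_scheme \<Rightarrow> ('a, 'b, 'n) module_scheme \<Rightarrow> 'b set \<Rightarrow> 'b set" where
  "generated_submodule R M S = \<Inter>{H. submodule H R M \<and> S \<subseteq> H}"

section \<open>Hermitian modules and lattices\<close>

record 'b herm_module = "(quat, 'b) module" +
  form :: "'b \<Rightarrow> 'b \<Rightarrow> quat"

definition hermitian_form :: "quat set \<Rightarrow> ('b, 'n) herm_module_scheme \<Rightarrow> bool" where
  "hermitian_form R M \<longleftrightarrow>
     (\<forall>x\<in>carrier M. \<forall>y\<in>carrier M. form M x y \<in> R \<and> form M y x = qcnj (form M x y)) \<and>
     (\<forall>x\<in>carrier M. \<forall>y\<in>carrier M. \<forall>z\<in>carrier M.
        form M x (y \<oplus>\<^bsub>M\<^esub> z) = form M x y + form M x z) \<and>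
     (\<forall>x\<in>carrier M. \<forall>y\<in>carrier M. \<forall>a\<in>R. form M x (a \<odot>\<^bsub>M\<^esub> y) = form M x y * a)"

definition Rad :: "('b, 'n) herm_module_scheme \<Rightarrow> 'b set" where
  "Rad M = {x \<in> carrier M. \<forall>y\<in>carrier M. form M y x = 0}"

definition hermitian_lattice :: "quat set \<Rightarrow> ('b, 'n) herm_module_scheme \<Rightarrow> bool" where
  "hermitian_lattice R L \<longleftrightarrow>
     right_module (qring R) L \<and> finitely_generated (qring R) L \<and> projective R L \<and>
     hermitian_form R L \<and> Rad L = {\<zero>\<^bsub>L\<^esub>}"

definition isometry :: "quat set \<Rightarrow> ('b, 'n) herm_module_scheme \<Rightarrow> ('b \<Rightarrow> 'b) \<Rightarrow> bool" where
  "isometry R L f \<longleftrightarrow>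
     f \<in> right_module_hom (qring R) L L \<and> bij_betw f (carrier L) (carrier L) \<and>
     (\<forall>x\<in>carrier L. \<forall>y\<in>carrier L. form L (f x) (f y) = form L x y)"

definition free_herm :: "quat set \<Rightarrow> 'i set \<Rightarrow> ('i \<Rightarrow> 'i \<Rightarrow> quat) \<Rightarrow> ('i \<Rightarrow> quat) herm_module" where
  "free_herm R I G = module.extend (free_module R I) (herm_module.fields
     (\<lambda>v w. \<Sum>r | v r \<noteq> 0. \<Sum>s | w s \<noteq> 0. qcnj (v r) * G r s * w s))"

lemma free_herm_simps [simp]:
  "carrier (free_herm R I G) = carrier (free_module R I)"
  "ring.zero (free_herm R I G) = ring.zero (free_module R I)"
  "ring.add (free_herm R I G) = ring.add (free_module R I)"
  "smult (free_herm R I G) = smult (free_module R I)"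
  "form (free_herm R I G) v w = (\<Sum>r | v r \<noteq> 0. \<Sum>s | w s \<noteq> 0. qcnj (v r) * G r s * w s)"
  by (simp_all add: free_herm_def module.defs herm_module.defs)

text \<open>
  The quotient by a submodule \<open>N\<close>, with the induced form.  The latter is meaningful only if
  \<open>N\<close> is contained in the radical, so that the value does not depend on the representatives.
\<close>

definition herm_quot :: "'b herm_module \<Rightarrow> 'b set \<Rightarrow> 'b set herm_module" where
  "herm_quot M N =
    \<lparr>carrier = a_rcosets\<^bsub>M\<^esub> N, monoid.mult = undefined, monoid.one = undefined,
     ring.zero = N, ring.add = set_add M,
     smult = (\<lambda>a C. \<Union>x\<in>C. N +>\<^bsub>M\<^esub> (a \<odot>\<^bsub>M\<^esub> x)),
     form = (\<lambda>C D. the_elem (\<Union>x\<in>C. \<Union>y\<in>D. {form M x y}))\<rparr>"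

section \<open>Extension of scalars, dual lattice and signature\<close>

text \<open>
  \<open>L \<otimes> Frac(R)\<close> is the free \<open>Frac(R)\<close>-module on the elements of \<open>L\<close>, where \<open>unit_vec x c\<close> stands
  for the pure tensor of \<open>x\<close> and \<open>c\<close>, modulo the bilinearity relations.
\<close>

definition tensor_relations :: "quat set \<Rightarrow> ('b, 'n) herm_module_scheme \<Rightarrow> ('b \<Rightarrow> quat) set" where
  "tensor_relations R L =
     {(\<lambda>z. unit_vec (x \<oplus>\<^bsub>L\<^esub> y) 1 z - unit_vec x 1 z - unit_vec y 1 z) | x y.
        x \<in> carrier L \<and> y \<in> carrier L} \<union>
     {(\<lambda>z. unit_vec (a \<odot>\<^bsub>L\<^esub> x) 1 z - unit_vec x a z) | a x. a \<in> R \<and> x \<in> carrier L}"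

definition tensor_kernel :: "quat set \<Rightarrow> ('b, 'n) herm_module_scheme \<Rightarrow> ('b \<Rightarrow> quat) set" where
  "tensor_kernel R L =
     generated_submodule (qring (Frac R)) (free_module (Frac R) (carrier L)) (tensor_relations R L)"

definition extend_scalars ::
  "quat set \<Rightarrow> ('b, 'n) herm_module_scheme \<Rightarrow> ('b \<Rightarrow> quat) set herm_module" where
  "extend_scalars R L = herm_quot (free_herm (Frac R) (carrier L) (form L)) (tensor_kernel R L)"

definition to_extension :: "quat set \<Rightarrow> ('b, 'n) herm_module_scheme \<Rightarrow> 'b \<Rightarrow> ('b \<Rightarrow> quat) set" where
  "to_extension R L x = tensor_kernel R L +>\<^bsub>free_module (Frac R) (carrier L)\<^esub> unit_vec x 1"

text \<open>
  The \<open>R\<close>-valued functionals on \<open>L\<close>, identified via the form with elements of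
  \<open>L \<otimes> Frac(R)\<close>.
\<close>

definition dual_lattice :: "quat set \<Rightarrow> ('b, 'n) herm_module_scheme \<Rightarrow> ('b \<Rightarrow> quat) set set" where
  "dual_lattice R L =
     {t \<in> carrier (extend_scalars R L).
        \<forall>y\<in>carrier L. form (extend_scalars R L) (to_extension R L y) t \<in> R}"

text \<open>
  Eigenvalues of Hermitian matrices are real, and are counted with multiplicity, i.e. by the
  dimension of the eigenspace.  Eigenspaces are taken in the right vector space of
  quaternionic column vectors; for a matrix with real or complex entries they arise from the real
  or complex eigenspaces by extension of scalars and thus have the same dimension.
\<close>

definition eigenspace :: "nat \<Rightarrow> (nat \<Rightarrow> nat \<Rightarrow> quat) \<Rightarrow> real \<Rightarrow> (quat, nat \<Rightarrow> quat) module" where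
  "eigenspace N G t = (free_module UNIV {..<N})
     \<lparr>carrier := {v \<in> carrier (free_module UNIV {..<N}).
        \<forall>i<N. (\<Sum>j<N. G i j * v j) = v i * of_real t}\<rparr>"

definition eigenvalue_multiplicity :: "nat \<Rightarrow> (nat \<Rightarrow> nat \<Rightarrow> quat) \<Rightarrow> real \<Rightarrow> nat" where
  "eigenvalue_multiplicity N G t = (THE d. \<exists>b. is_basis (qring UNIV) (eigenspace N G t) d b)"

definition eigenvalues :: "nat \<Rightarrow> (nat \<Rightarrow> nat \<Rightarrow> quat) \<Rightarrow> real set" where
  "eigenvalues N G = {t. carrier (eigenspace N G t) \<noteq> {\<lambda>i. 0}}"

definition has_signature ::
  "quat set \<Rightarrow> ('b, 'n) herm_module_scheme \<Rightarrow> nat \<Rightarrow> nat \<Rightarrow> bool" where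
  "has_signature R L m k \<longleftrightarrow>
     (\<exists>N b. is_basis (qring (Frac R)) (extend_scalars R L) N b \<and>
        (let G = (\<lambda>i j. form (extend_scalars R L) (b i) (b j)) in
           (\<Sum>t | t \<in> eigenvalues N G \<and> t > 0. eigenvalue_multiplicity N G t) = m \<and>
           (\<Sum>t | t \<in> eigenvalues N G \<and> t < 0. eigenvalue_multiplicity N G t) = k))"

section \<open>The projective plane, its group and the lattice\<close>

text \<open>
  \<open>F\<^sub>q\<close> is a finite field type \<open>'f\<close>.  Points and lines of the projective plane are the
  one- and two-dimensional linear subspaces of \<open>'f ^ 3\<close>; incidence is inclusion.
\<close>

definition points :: "('f::field ^ 3) set set" where
  "points = {U. vec.subspace U \<and> vec.dim U = 1}"

definition lines :: "('f::field ^ 3) set set" where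
  "lines = {U. vec.subspace U \<and> vec.dim U = 2}"

definition plane_gram :: "quat \<Rightarrow> nat \<Rightarrow> ('f::field ^ 3) set \<Rightarrow> ('f ^ 3) set \<Rightarrow> quat" where
  "plane_gram p q r s =
     (if r = s then - of_nat q
      else if r \<in> points \<and> s \<in> lines \<and> r \<subseteq> s then p
      else if r \<in> lines \<and> s \<in> points \<and> s \<subseteq> r then qcnj p
      else 0)"

definition Lq_free :: "quat set \<Rightarrow> quat \<Rightarrow> nat \<Rightarrow> (('f::field ^ 3) set \<Rightarrow> quat) herm_module" where
  "Lq_free R p q = free_herm R (points \<union> lines) (plane_gram p q)"

definition Lq :: "quat set \<Rightarrow> quat \<Rightarrow> nat \<Rightarrow> (('f::field ^ 3) set \<Rightarrow> quat) set herm_module" where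
  "Lq R p q = herm_quot (Lq_free R p q) (Rad (Lq_free R p q))"

definition Lq_root :: "quat set \<Rightarrow> quat \<Rightarrow> nat \<Rightarrow> ('f::field ^ 3) set \<Rightarrow> (('f ^ 3) set \<Rightarrow> quat) set" where
  "Lq_root R p q r = Rad (Lq_free R p q) +>\<^bsub>Lq_free R p q\<^esub> unit_vec r 1"

definition GL3 :: "('f::field ^ 3 ^ 3) monoid" where
  "GL3 = \<lparr>carrier = {A. invertible A}, monoid.mult = (**), monoid.one = mat 1\<rparr>"

definition scalar_matrices :: "('f::field ^ 3 ^ 3) set" where
  "scalar_matrices = {mat c | c. c \<noteq> 0}"

definition PGL3 :: "('f::field ^ 3 ^ 3) set monoid" where
  "PGL3 = GL3 Mod scalar_matrices"

text \<open>
  A matrix \<open>A\<close> permutes points and lines by \<open>U \<mapsto> A U\<close>.  The linear extension of this permutation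
  of the basis sends \<open>v\<close> to the function \<open>U \<mapsto> v (A\<^sup>-\<^sup>1 U)\<close>.
\<close>

definition GL3_permute :: "'f::field ^ 3 ^ 3 \<Rightarrow> (('f ^ 3) set \<Rightarrow> quat) \<Rightarrow> ('f ^ 3) set \<Rightarrow> quat" where
  "GL3_permute A v = (\<lambda>U. v ((\<lambda>x. A *v x) -` U))"

text \<open>
  The induced action on cosets of a submodule; an element \<open>C\<close> of \<open>PGL3\<close> is a coset of
  matrices, all of which act in the same way.
\<close>

definition PGL3_action ::
  "(('f::field ^ 3) set \<Rightarrow> quat) set herm_module \<Rightarrow> ('f ^ 3 ^ 3) set \<Rightarrow>
     (('f ^ 3) set \<Rightarrow> quat) set \<Rightarrow> (('f ^ 3) set \<Rightarrow> quat) set" where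
  "PGL3_action L C = (\<lambda>D\<in>carrier L. \<Union>A\<in>C. GL3_permute A ` D)"

end

(*
  Send a point P of the plane to conj(p) e_P and a line l to e_0 - (sum of the e_P with P on l).
  Under this linear map the form on the free module is the pullback of the Lorentzian form
  diag(1, -1, ..., -1) in n + 1 variables, because a line has q + 1 points and two lines meet in one
  point.  Hence the radical is the kernel of the map, and L_q is a submodule of R^(1,n); it contains
  p R^(1,n), since conj(p) is p times a unit.  This gives the signature.  As p R is a maximal right
  ideal, splitting off one coordinate at a time shows that every module between p R^m and R^m is
  finitely generated and projective, even when R is not a principal ideal domain.  All Gram entries
  -q, p, conj(p) lie in the two-sided ideal R p, so L_q is contained in p L_q'.
*)
theory Submission
  imports Defs
begin

section \<open>Quaternions\<close>

text \<open>The congruence condition is what tames noncommutative coefficients. For \<open>p\<close>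
  itself it gives \<open>qcnj p = p * u\<close>, and comparing norms yields
  \<open>u * qcnj u = 1\<close>. For \<open>z * p\<close> it gives that \<open>R p\<close> lies in
  \<open>p R\<close>, because \<open>qcnj (z * p) = qcnj p * qcnj z\<close> does; conjugation gives
  the reverse inclusion. Maximality of this ideal has two unrelated sources: Euclidean division of
  Hurwitz quaternions, and, for commutative \<open>R\<close>, the congruence of z^2 with the
  rational integer \<open>z * qcnj z\<close>. Two quotients occur, both given abstractly:
  \<open>Lq\<close> by a radical, and its scalar extension by tensor relations among all elements of
  the lattice. Both submodules turn out to be kernels of coordinate maps into functions on the index
  set of the Lorentzian form, so one description of such quotients serves twice. The tensor
  relations are the harder half: clearing denominators makes every tensor pure, and so injectivity
  of the coordinates passes from the lattice to its extension. Over \<open>Frac R\<close> the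
  element \<open>p\<close> is invertible, so the standard basis becomes available; its Gram matrix
  is diagonal with entries 1 and -1, and the eigenspaces can be read off.\<close>

lemma quat_sel_simps [simp]:
  "q_re 0 = 0" "q_i 0 = 0" "q_j 0 = 0" "q_k 0 = 0"
  "q_re 1 = 1" "q_i 1 = 0" "q_j 1 = 0" "q_k 1 = 0"
  "q_re (x + y) = q_re x + q_re y" "q_i (x + y) = q_i x + q_i y"
  "q_j (x + y) = q_j x + q_j y" "q_k (x + y) = q_k x + q_k y"
  "q_re (x - y) = q_re x - q_re y" "q_i (x - y) = q_i x - q_i y"
  "q_j (x - y) = q_j x - q_j y" "q_k (x - y) = q_k x - q_k y"
  "q_re (- x) = - q_re x" "q_i (- x) = - q_i x" "q_j (- x) = - q_j x" "q_k (- x) = - q_k x"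
  "q_re (a *\<^sub>R x) = a * q_re x" "q_i (a *\<^sub>R x) = a * q_i x"
  "q_j (a *\<^sub>R x) = a * q_j x" "q_k (a *\<^sub>R x) = a * q_k x"
  "q_re (qcnj x) = q_re x" "q_i (qcnj x) = - q_i x" "q_j (qcnj x) = - q_j x" "q_k (qcnj x) = - q_k x"
  by (simp_all add: zero_quat_def one_quat_def plus_quat_def minus_quat_def uminus_quat_def
      scaleR_quat_def qcnj_def)

lemma q_mult_sel:
  "q_re (x * y) = q_re x * q_re y - q_i x * q_i y - q_j x * q_j y - q_k x * q_k y"
  "q_i (x * y) = q_re x * q_i y + q_i x * q_re y + q_j x * q_k y - q_k x * q_j y"
  "q_j (x * y) = q_re x * q_j y - q_i x * q_k y + q_j x * q_re y + q_k x * q_i y"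
  "q_k (x * y) = q_re x * q_k y + q_i x * q_j y - q_j x * q_i y + q_k x * q_re y"
  by (simp_all add: times_quat_def)

lemma quat_eq_iff: "x = y \<longleftrightarrow> q_re x = q_re y \<and> q_i x = q_i y \<and> q_j x = q_j y \<and> q_k x = q_k y"
  by (cases x; cases y) simp

lemma q_of_real_sel [simp]:
  "q_re (of_real a) = a" "q_i (of_real a) = 0" "q_j (of_real a) = 0" "q_k (of_real a) = 0"
  by (simp_all add: of_real_def)

lemma q_of_int_sel [simp]:
  "q_re (of_int m) = of_int m" "q_i (of_int m) = 0" "q_j (of_int m) = 0" "q_k (of_int m) = 0"
  using q_of_real_sel[of "of_int m"] by simp_all

lemma q_of_nat_sel [simp]:
  "q_re (of_nat m) = of_nat m" "q_i (of_nat m) = 0" "q_j (of_nat m) = 0" "q_k (of_nat m) = 0"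
  using q_of_real_sel[of "of_nat m"] by simp_all

lemma qcnj_simps [simp]:
  "qcnj 0 = 0" "qcnj 1 = 1" "qcnj (x + y) = qcnj x + qcnj y" "qcnj (x - y) = qcnj x - qcnj y"
  "qcnj (- x) = - qcnj x" "qcnj (a *\<^sub>R x) = a *\<^sub>R qcnj x" "qcnj (qcnj x) = x"
  "qcnj (of_int m) = of_int m" "qcnj (of_nat k) = of_nat k" "qcnj (x * y) = qcnj y * qcnj x"
  by (simp_all add: quat_eq_iff q_mult_sel algebra_simps)

lemma qcnj_eq_0_iff [simp]: "qcnj x = 0 \<longleftrightarrow> x = 0"
  by (metis qcnj_simps(1,7))

lemma qcnj_sum [simp]: "qcnj (sum f A) = (\<Sum>x\<in>A. qcnj (f x))"
  by (induction A rule: infinite_finite_induct) auto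

lemma mult_qcnj: "x * qcnj x = of_real ((qabs x)\<^sup>2)"
  by (simp add: quat_eq_iff q_mult_sel qabs_def power2_eq_square algebra_simps)

lemma qcnj_mult: "qcnj x * x = of_real ((qabs x)\<^sup>2)"
  by (simp add: quat_eq_iff q_mult_sel qabs_def power2_eq_square algebra_simps)

lemma qabs_squared: "(qabs z)\<^sup>2 = (q_re z)\<^sup>2 + (q_i z)\<^sup>2 + (q_j z)\<^sup>2 + (q_k z)\<^sup>2"
  by (simp add: qabs_def)

text \<open>Euler's four-square identity: the squared norms agree as polynomials in the eight
  components.\<close>

lemma qabs_mult: "qabs (x * y) = qabs x * qabs y"
proof -
  have "(qabs (x * y))\<^sup>2 = (qabs x * qabs y)\<^sup>2"
    unfolding qabs_squared power_mult_distrib q_mult_sel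
    unfolding power2_eq_square by (simp add: algebra_simps)
  then show ?thesis
    by (simp add: power2_eq_iff_nonneg qabs_def)
qed

lemma qabs_eq_0_iff: "qabs z = 0 \<longleftrightarrow> z = 0"
  by (auto simp: qabs_def quat_eq_iff add_nonneg_eq_0_iff)

lemma of_nat_as_of_real: "(of_nat m :: quat) = of_real (real m)"
  by simp

section \<open>Coefficient rings\<close>

text \<open>The common frame for \<open>R\<close>, for \<open>Frac R\<close> and for all quaternions
  (\<open>UNIV\<close>): the lattice, its scalar extension and the eigenspaces are right modules
  over these three.\<close>

locale star_ring =
  fixes R :: "quat set"
  assumes one_in: "1 \<in> R"
    and add_in: "\<And>x y. x \<in> R \<Longrightarrow> y \<in> R \<Longrightarrow> x + y \<in> R"
    and uminus_in: "\<And>x. x \<in> R \<Longrightarrow> - x \<in> R"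
    and mult_in: "\<And>x y. x \<in> R \<Longrightarrow> y \<in> R \<Longrightarrow> x * y \<in> R"
    and qcnj_in: "\<And>x. x \<in> R \<Longrightarrow> qcnj x \<in> R"
begin

lemma zero_in: "0 \<in> R"
  using add_in[OF one_in uminus_in[OF one_in]] by simp

lemma minus_in: "x \<in> R \<Longrightarrow> y \<in> R \<Longrightarrow> x - y \<in> R"
  using add_in[of x "- y"] uminus_in by simp

lemma of_nat_in: "of_nat m \<in> R"
  by (induction m) (auto intro: add_in one_in zero_in)

lemma of_int_in: "of_int m \<in> R"
  by (cases m) (auto intro: of_nat_in uminus_in simp del: of_nat_Suc)

lemma sum_in: "(\<And>x. x \<in> A \<Longrightarrow> f x \<in> R) \<Longrightarrow> sum f A \<in> R"
  by (induction A rule: infinite_finite_induct) (auto intro: zero_in add_in)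

lemmas ring_in = one_in add_in uminus_in mult_in qcnj_in zero_in minus_in of_nat_in of_int_in

lemma ring_qring: "ring (qring R)"
proof (rule ringI)
  show "abelian_group (qring R)"
    by (rule abelian_groupI)
       (auto simp: qring_def add_in zero_in ac_simps intro: bexI[OF _ uminus_in])
  show "Group.monoid (qring R)"
    by (rule monoidI) (auto simp: qring_def mult_in one_in mult.assoc)
qed (auto simp: qring_def algebra_simps)

end

text \<open>Integral norms make denominators rational integers, since \<open>inverse s\<close> is
  \<open>qcnj s\<close> divided by \<open>s * qcnj s\<close>.\<close>

locale integral_star_ring = star_ring +
  assumes norm_Ints: "z \<in> R \<Longrightarrow> z * qcnj z \<in> \<int>"
begin

lemma norm_nat:
  assumes "z \<in> R"
  obtains m where "z * qcnj z = of_nat m" "qcnj z * z = of_nat m" "m = 0 \<longleftrightarrow> z = 0"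
proof -
  obtain k where k: "z * qcnj z = of_int k"
    using norm_Ints[OF assms] by (auto elim: Ints_cases)
  then have "(qabs z)\<^sup>2 = of_int k"
    by (metis mult_qcnj q_of_int_sel(1) q_of_real_sel(1))
  then have "k \<ge> 0"
    by (metis of_int_0_le_iff zero_le_power2)
  then obtain m where "k = int m"
    using zero_le_imp_eq_int by blast
  moreover have "qcnj z * z = z * qcnj z"
    by (simp add: qcnj_mult mult_qcnj)
  ultimately show ?thesis
    using that[of m] k by (metis mult_eq_0_iff of_int_of_nat_eq of_nat_eq_0_iff qcnj_eq_0_iff)
qed

text \<open>Extending a fraction by \<open>qcnj s\<close> turns its denominator into the norm of
  \<open>s\<close>, a positive integer and therefore central. Hence common denominators exist even
  for quaternions, which gives closure of \<open>Frac R\<close> under sums and products.\<close>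

lemma Frac_iff: "x \<in> Frac R \<longleftrightarrow> (\<exists>a\<in>R. \<exists>m>0. x = (1 / real m) *\<^sub>R a)"
proof
  assume "x \<in> Frac R"
  then obtain a s where as: "x = a * inverse s" "a \<in> R" "s \<in> R" "s \<noteq> 0"
    by (auto simp: Frac_def)
  obtain m where m: "s * qcnj s = of_nat m" "m \<noteq> 0"
    using norm_nat as by metis
  have "inverse s = qcnj s * inverse (of_nat m)"
    using as(4) m by (simp flip: m(1) add: nonzero_inverse_mult_distrib mult.assoc[symmetric])
  also have "\<dots> = (1 / real m) *\<^sub>R qcnj s"
    by (simp add: of_nat_as_of_real del: of_real_of_nat_eq flip: of_real_inverse)
       (simp add: of_real_def divide_inverse)
  finally have "x = (1 / real m) *\<^sub>R (a * qcnj s)"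
    by (simp add: as)
  then show "\<exists>a\<in>R. \<exists>m>0. x = (1 / real m) *\<^sub>R a"
    using m as by (intro bexI[of _ "a * qcnj s"] exI[of _ m]) (auto intro: ring_in)
next
  assume "\<exists>a\<in>R. \<exists>m>0. x = (1 / real m) *\<^sub>R a"
  then obtain a m where am: "a \<in> R" "m > 0" "x = (1 / real m) *\<^sub>R a"
    by auto
  have "x = a * inverse (of_nat m)"
    by (simp add: am of_nat_as_of_real del: of_real_of_nat_eq flip: of_real_inverse)
       (simp add: of_real_def divide_inverse)
  then show "x \<in> Frac R"
    using am(1,2) of_nat_in[of m] unfolding Frac_def
    by (metis (mono_tags, lifting) mem_Collect_eq of_nat_eq_0_iff less_irrefl)
qed

lemma subset_Frac: "R \<subseteq> Frac R"
proof
  fix x assume "x \<in> R"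
  then have "x = (1 / real 1) *\<^sub>R x" "(1::nat) > 0" by simp_all
  with \<open>x \<in> R\<close> show "x \<in> Frac R" unfolding Frac_iff by blast
qed

lemma inverse_in_Frac: "s \<in> R \<Longrightarrow> inverse s \<in> Frac R"
proof (cases "s = 0")
  case True
  then show ?thesis
    using subset_Frac zero_in by auto
next
  case False
  moreover assume "s \<in> R"
  moreover have "inverse s = 1 * inverse s" by simp
  ultimately show ?thesis
    unfolding Frac_def using one_in by blast
qed

lemma star_ring_Frac: "star_ring (Frac R)"
proof
  show "1 \<in> Frac R"
    using subset_Frac one_in by auto
  fix x assume x: "x \<in> Frac R"
  then obtain a m where am: "a \<in> R" "m > 0" "x = (1 / real m) *\<^sub>R a"
    by (auto simp: Frac_iff)
  have "- x = (1 / real m) *\<^sub>R (- a)" "qcnj x = (1 / real m) *\<^sub>R qcnj a"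
    by (simp_all add: am)
  then show "- x \<in> Frac R" "qcnj x \<in> Frac R"
    using am by (auto simp only: Frac_iff intro!: bexI exI[of _ m] ring_in)
  fix y assume "y \<in> Frac R"
  then obtain b k where bk: "b \<in> R" "k > 0" "y = (1 / real k) *\<^sub>R b"
    by (auto simp: Frac_iff)
  have "x + y = (1 / real (m * k)) *\<^sub>R (of_nat k * a + of_nat m * b)"
    using am(2) bk(2)
    by (simp add: am bk of_nat_as_of_real scaleR_conv_of_real[symmetric] scaleR_add_right
        del: of_real_of_nat_eq)
  moreover have "x * y = (1 / real (m * k)) *\<^sub>R (a * b)"
    by (simp add: am bk)
  moreover have "m * k > 0"
    using am bk by simp
  ultimately show "x + y \<in> Frac R" "x * y \<in> Frac R"
    using am(1) bk(1) by (auto simp only: Frac_iff intro!: bexI exI[of _ "m * k"] ring_in)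
qed

end

text \<open>The last assumption says that \<open>p R\<close> is a maximal right ideal; it is all that is used of the
  primality of \<open>p\<close>.\<close>

locale admissible_ring = integral_star_ring +
  fixes p :: quat and q :: nat
  assumes p_in: "p \<in> R" and q_pos: "q > 0"
    and p_norm: "p * qcnj p = of_nat q"
    and qcnj_cong: "z \<in> R \<Longrightarrow> \<exists>w\<in>R. qcnj z - z = p * w"
    and p_maximal: "z \<in> R \<Longrightarrow> (\<And>w. w \<in> R \<Longrightarrow> z \<noteq> p * w) \<Longrightarrow> \<exists>a\<in>R. \<exists>b\<in>R. z * a + p * b = 1"
begin

lemma p_nonzero: "p \<noteq> 0"
  using p_norm q_pos by auto

lemma p_norm': "qcnj p * p = of_nat q"
  using p_norm by (simp add: qcnj_mult mult_qcnj)

text \<open>The congruence for \<open>z = p\<close> reads \<open>qcnj p = p * (1 + w)\<close>.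
  Taking norms shows that \<open>u = 1 + w\<close> has norm 1, so it is a unit with inverse
  \<open>qcnj u\<close>.\<close>

lemma qcnj_p_right: "\<exists>u\<in>R. \<exists>v\<in>R. qcnj p = p * u \<and> p = qcnj p * v"
proof -
  obtain w where w: "w \<in> R" "qcnj p - p = p * w"
    using qcnj_cong[OF p_in] by auto
  define u where "u = 1 + w"
  have u: "u \<in> R" "qcnj p = p * u"
    using w by (auto simp: u_def algebra_simps ring_in)
  have "u * qcnj u = 1"
  proof -
    have "of_nat q = (p * u) * (qcnj u * qcnj p)"
      by (metis p_norm' qcnj_simps(7,10) u(2))
    also have "\<dots> = p * (u * qcnj u) * qcnj p"
      by (simp add: mult.assoc)
    \<comment> \<open>The norm \<open>u * qcnj u\<close> is real and can be moved past
      \<open>p\<close>.\<close>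
    also have "\<dots> = (u * qcnj u) * (p * qcnj p)"
      by (simp add: mult_qcnj of_real_def)
    finally have "(u * qcnj u) * of_nat q = 1 * of_nat q"
      using p_norm by simp
    then show ?thesis
      using q_pos by (subst (asm) mult_cancel_right) auto
  qed
  then have "p = p * u * qcnj u"
    by (simp add: mult.assoc)
  then have "p = qcnj p * qcnj u"
    using u by simp
  then show ?thesis
    using u qcnj_in by auto
qed

lemma qcnj_p_left: "\<exists>u\<in>R. \<exists>v\<in>R. qcnj p = u * p \<and> p = v * qcnj p"
proof -
  obtain u v where "u \<in> R" "v \<in> R" "qcnj p = p * u" "p = qcnj p * v"
    using qcnj_p_right by auto
  then have "p = qcnj u * qcnj p \<and> qcnj p = qcnj v * p" "qcnj u \<in> R" "qcnj v \<in> R"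
    by (metis qcnj_simps(7,10), auto intro: ring_in)
  then show ?thesis by blast
qed

text \<open>The conjugate \<open>qcnj (z * p) = qcnj p * qcnj z\<close> lies in \<open>p R\<close>
  by \<open>qcnj_p_right\<close>, and \<open>z * p\<close> differs from it by an element of
  \<open>p R\<close>. Thus the right ideal \<open>p R\<close> is two-sided.\<close>

lemma mult_p_commute_right:
  assumes "z \<in> R"
  shows "\<exists>w\<in>R. z * p = p * w"
proof -
  obtain w where w: "w \<in> R" "qcnj (z * p) - z * p = p * w"
    using qcnj_cong mult_in assms p_in by metis
  obtain u where u: "u \<in> R" "qcnj p = p * u"
    using qcnj_p_right by auto
  have "z * p = p * (u * qcnj z - w)"
    using w(2) u(2) by (simp add: algebra_simps)
  then show ?thesis
    using w u assms by (metis minus_in mult_in qcnj_in)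
qed

text \<open>The mirror image, by conjugation: \<open>p * z = qcnj p * (v * z)\<close> is the
  conjugate of an element of \<open>R p\<close>. That element lies in \<open>p R\<close>, so its
  conjugate lies in \<open>R (qcnj p)\<close>, which is contained in \<open>R p\<close>.\<close>

lemma p_mult_commute_left:
  assumes "z \<in> R"
  shows "\<exists>w\<in>R. p * z = w * p"
proof -
  obtain v where v: "v \<in> R" "p = qcnj p * v"
    using qcnj_p_right by auto
  obtain w where w: "w \<in> R" "qcnj (v * z) * p = p * w"
    using mult_p_commute_right[of "qcnj (v * z)"] assms v by (auto intro: ring_in simp del: qcnj_simps)
  have "qcnj p * (v * z) = qcnj w * qcnj p"
    using w(2) by (metis qcnj_simps(7,10))
  then have "p * z = qcnj w * qcnj p"
    using v(2) by (metis mult.assoc)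
  moreover obtain u where "u \<in> R" "qcnj p = u * p"
    using qcnj_p_left by auto
  ultimately show ?thesis
    using w by (intro bexI[of _ "qcnj w * u"]) (auto intro: ring_in simp: mult.assoc)
qed

end

section \<open>Modules with coordinate functions\<close>

lemma qring_simps [simp]:
  "carrier (qring R) = R" "\<zero>\<^bsub>qring R\<^esub> = 0" "\<one>\<^bsub>qring R\<^esub> = 1"
  "a \<oplus>\<^bsub>qring R\<^esub> b = a + b" "a \<otimes>\<^bsub>qring R\<^esub> b = a * b"
  by (simp_all add: qring_def)

text \<open>The map \<open>h\<close> is linear but not assumed injective, so that it can also be a
  map whose kernel is to be factored out. Where it is injective, identities in \<open>M\<close> may
  be checked coordinatewise.\<close>

locale coord_module = star_ring R + MM: right_module "qring R" M
  for R :: "quat set" and M :: "(quat, 'b, 'n) module_scheme" +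
  fixes h :: "'b \<Rightarrow> 'j \<Rightarrow> quat"
  assumes h_add: "x \<in> carrier M \<Longrightarrow> y \<in> carrier M \<Longrightarrow> h (x \<oplus>\<^bsub>M\<^esub> y) = (\<lambda>j. h x j + h y j)"
    and h_smult: "a \<in> R \<Longrightarrow> x \<in> carrier M \<Longrightarrow> h (a \<odot>\<^bsub>M\<^esub> x) = (\<lambda>j. h x j * a)"
begin

lemma h_zero: "h \<zero>\<^bsub>M\<^esub> = (\<lambda>j. 0)"
  using h_add[OF MM.M.zero_closed MM.M.zero_closed] by (simp add: fun_eq_iff)

lemma h_a_inv: "x \<in> carrier M \<Longrightarrow> h (\<ominus>\<^bsub>M\<^esub> x) = (\<lambda>j. - h x j)"
  using h_add[of "\<ominus>\<^bsub>M\<^esub> x" x] by (simp add: MM.M.l_neg h_zero fun_eq_iff add_eq_0_iff)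

lemma h_minus: "x \<in> carrier M \<Longrightarrow> y \<in> carrier M \<Longrightarrow> h (x \<ominus>\<^bsub>M\<^esub> y) = (\<lambda>j. h x j - h y j)"
  by (simp add: a_minus_def h_add h_a_inv)

lemma h_finsum:
  assumes "finite A" "g \<in> A \<rightarrow> carrier M"
  shows "h (\<Oplus>\<^bsub>M\<^esub>i\<in>A. g i) = (\<lambda>j. \<Sum>i\<in>A. h (g i) j)"
  using assms
proof (induction A)
  case (insert x F)
  then have "(\<Oplus>\<^bsub>M\<^esub>i\<in>insert x F. g i) = g x \<oplus>\<^bsub>M\<^esub> (\<Oplus>\<^bsub>M\<^esub>i\<in>F. g i)"
    by (intro MM.M.finsum_insert) auto
  with insert show ?case
    by (simp add: h_add MM.M.finsum_closed)
qed (simp add: h_zero)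

lemma h_lincomb:
  assumes "finite A" "c \<in> A \<rightarrow> R" "b \<in> A \<rightarrow> carrier M"
  shows "(\<Oplus>\<^bsub>M\<^esub>i\<in>A. c i \<odot>\<^bsub>M\<^esub> b i) \<in> carrier M"
    and "h (\<Oplus>\<^bsub>M\<^esub>i\<in>A. c i \<odot>\<^bsub>M\<^esub> b i) = (\<lambda>j. \<Sum>i\<in>A. h (b i) j * c i)"
proof -
  have *: "(\<lambda>i. c i \<odot>\<^bsub>M\<^esub> b i) \<in> A \<rightarrow> carrier M"
    using assms by (auto intro!: MM.rsmult_closed)
  then show "(\<Oplus>\<^bsub>M\<^esub>i\<in>A. c i \<odot>\<^bsub>M\<^esub> b i) \<in> carrier M"
    by (rule MM.M.finsum_closed)
  have "(\<Sum>i\<in>A. h (c i \<odot>\<^bsub>M\<^esub> b i) j) = (\<Sum>i\<in>A. h (b i) j * c i)" for j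
    using assms by (intro sum.cong) (auto simp: h_smult Pi_iff)
  then show "h (\<Oplus>\<^bsub>M\<^esub>i\<in>A. c i \<odot>\<^bsub>M\<^esub> b i) = (\<lambda>j. \<Sum>i\<in>A. h (b i) j * c i)"
    by (subst h_finsum[OF assms(1) *]) auto
qed

end

lemma right_module_free_module:
  assumes "star_ring R"
  shows "right_module (qring R) (free_module R I)"
proof -
  interpret star_ring R by fact
  interpret ring "qring R" by (rule ring_qring)
  have *: "finite {i. v i + w i \<noteq> (0::quat)}" if "finite {i. v i \<noteq> 0}" "finite {i. w i \<noteq> 0}" for v w
    by (rule finite_subset[OF _ finite_UnI[OF that]]) auto
  have **: "finite {i. v i * a \<noteq> (0::quat)}" if "finite {i. v i \<noteq> 0}" for v a
    by (rule finite_subset[OF _ that]) auto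
  have "abelian_group (free_module R I)"
  proof (rule abelian_groupI)
    fix x assume "x \<in> carrier (free_module R I)"
    then show "\<exists>y\<in>carrier (free_module R I). y \<oplus>\<^bsub>free_module R I\<^esub> x = \<zero>\<^bsub>free_module R I\<^esub>"
      by (intro bexI[of _ "\<lambda>i. - x i"]) (auto simp: free_module_def uminus_in)
  qed (auto simp: free_module_def add_in zero_in ac_simps *)
  then show ?thesis
    by (intro right_module.intro right_module_axioms.intro ring_axioms)
       (auto simp: free_module_def mult_in ** algebra_simps)
qed

lemma right_module_free_herm:
  assumes "star_ring R"
  shows "right_module (qring R) (free_herm R I G)"
proof -
  have "right_module (qring R) (free_module R I)"
    by (rule right_module_free_module) fact
  then interpret right_module "qring R" "free_module R I" .
  have "abelian_group (free_herm R I G)"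
  proof (rule abelian_groupI)
    fix x assume "x \<in> carrier (free_herm R I G)"
    then show "\<exists>y\<in>carrier (free_herm R I G). y \<oplus>\<^bsub>free_herm R I G\<^esub> x = \<zero>\<^bsub>free_herm R I G\<^esub>"
      by (intro bexI[of _ "\<ominus>\<^bsub>free_module R I\<^esub> x"]) (auto simp: M.l_neg)
  qed (auto simp: M.a_ac)
  then show ?thesis
    by (intro right_module.intro right_module_axioms.intro R.ring_axioms)
       (use rsmult_closed rsmult_l_distr rsmult_r_distr rsmult_assoc rsmult_one in simp_all)
qed

subsection \<open>Quotients by the kernel of the coordinate map\<close>

text \<open>Used for \<open>Lq\<close>, where \<open>K\<close> is the radical, and for the extension
  of scalars, where \<open>K\<close> is generated by the tensor relations. The form factors through
  \<open>h\<close> as \<beta>, hence is constant on the classes modulo \<open>K\<close>.\<close>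

locale kernel_quotient = coord_module R M h for R and M :: "'b herm_module" and h :: "'b \<Rightarrow> 'j \<Rightarrow> quat" +
  fixes K :: "'b set" and \<beta> :: "('j \<Rightarrow> quat) \<Rightarrow> ('j \<Rightarrow> quat) \<Rightarrow> quat"
  assumes K_eq: "K = {x \<in> carrier M. h x = (\<lambda>j. 0)}"
    and form_eq: "x \<in> carrier M \<Longrightarrow> y \<in> carrier M \<Longrightarrow> form M x y = \<beta> (h x) (h y)"
begin

abbreviation Q where "Q \<equiv> herm_quot M K"

definition cls :: "'b \<Rightarrow> 'b set" where "cls x = K +>\<^bsub>M\<^esub> x"

text \<open>The choice of representative is harmless, as \<open>h\<close> is constant on each
  class.\<close>

definition coord :: "'b set \<Rightarrow> 'j \<Rightarrow> quat" where "coord C = h (SOME x. x \<in> C)"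

lemma cls_eq: "x \<in> carrier M \<Longrightarrow> cls x = {y \<in> carrier M. h y = h x}"
proof (intro equalityI subsetI)
  fix y assume x: "x \<in> carrier M" and y: "y \<in> {y \<in> carrier M. h y = h x}"
  then have "y \<ominus>\<^bsub>M\<^esub> x \<in> K"
    by (auto simp: K_eq h_minus)
  moreover have "y = (y \<ominus>\<^bsub>M\<^esub> x) \<oplus>\<^bsub>M\<^esub> x"
    using x y by (simp add: a_minus_def MM.M.a_assoc MM.M.l_neg)
  ultimately show "y \<in> cls x"
    by (auto simp: cls_def a_r_coset_def')
qed (unfold cls_def, auto simp: a_r_coset_def' K_eq h_add)

lemma carrier_Q: "carrier Q = cls ` carrier M"
  by (auto simp: herm_quot_def A_RCOSETS_def' cls_def)

lemma cls_eq_iff: "x \<in> carrier M \<Longrightarrow> y \<in> carrier M \<Longrightarrow> cls x = cls y \<longleftrightarrow> h x = h y"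
  by (auto simp: cls_eq)

lemma zero_Q: "\<zero>\<^bsub>Q\<^esub> = cls \<zero>\<^bsub>M\<^esub>"
  by (simp add: cls_eq h_zero) (simp add: herm_quot_def K_eq)

lemma add_Q:
  assumes "x \<in> carrier M" "y \<in> carrier M"
  shows "cls x \<oplus>\<^bsub>Q\<^esub> cls y = cls (x \<oplus>\<^bsub>M\<^esub> y)"
proof -
  have "set_add M (cls x) (cls y) = cls (x \<oplus>\<^bsub>M\<^esub> y)"
  proof (intro equalityI subsetI)
    fix z assume "z \<in> cls (x \<oplus>\<^bsub>M\<^esub> y)"
    then have z: "z \<in> carrier M" "h z = h (x \<oplus>\<^bsub>M\<^esub> y)"
      using assms by (auto simp: cls_eq)
    then have "z \<ominus>\<^bsub>M\<^esub> y \<in> cls x" "y \<in> cls y"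
      using assms by (auto simp: cls_eq h_minus h_add)
    moreover have "z = (z \<ominus>\<^bsub>M\<^esub> y) \<oplus>\<^bsub>M\<^esub> y"
      using z assms by (simp add: a_minus_def MM.M.a_assoc MM.M.l_neg)
    ultimately show "z \<in> set_add M (cls x) (cls y)"
      unfolding set_add_def' by blast
  qed (use assms in \<open>auto simp: set_add_def' cls_eq h_add\<close>)
  then show ?thesis
    by (simp add: herm_quot_def)
qed

lemma smult_Q:
  assumes "a \<in> R" "x \<in> carrier M"
  shows "a \<odot>\<^bsub>Q\<^esub> cls x = cls (a \<odot>\<^bsub>M\<^esub> x)"
proof -
  have "a \<odot>\<^bsub>Q\<^esub> cls x = (\<Union>y\<in>cls x. cls (a \<odot>\<^bsub>M\<^esub> y))"
    by (simp add: herm_quot_def cls_def)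
  \<comment> \<open>The classes united in the definition of the scalar multiple all coincide, since
    their elements have the same coordinates.\<close>
  also have "\<dots> = (\<Union>y\<in>cls x. cls (a \<odot>\<^bsub>M\<^esub> x))"
    using assms by (intro SUP_cong) (auto simp: cls_eq_iff MM.rsmult_closed cls_eq[OF assms(2)] h_smult)
  also have "\<dots> = cls (a \<odot>\<^bsub>M\<^esub> x)"
    using assms by (auto simp: cls_eq[OF assms(2)])
  finally show ?thesis .
qed

text \<open>The form sees only \<open>h\<close>, so the set of values over all representatives is a
  singleton and \<open>the_elem\<close> returns its member.\<close>

lemma form_Q:
  assumes "x \<in> carrier M" "y \<in> carrier M"
  shows "form Q (cls x) (cls y) = \<beta> (h x) (h y)"
proof -
  have "(\<Union>x\<in>cls x. \<Union>y\<in>cls y. {form M x y}) = {\<beta> (h x) (h y)}"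
    using assms by (auto simp: cls_eq form_eq)
  then show ?thesis
    by (simp add: herm_quot_def)
qed

lemma coord_cls:
  assumes "x \<in> carrier M"
  shows "coord (cls x) = h x"
proof -
  have "x \<in> cls x"
    using assms by (simp add: cls_eq)
  then have "(SOME y. y \<in> cls x) \<in> cls x"
    by (rule someI)
  then show ?thesis
    using assms by (simp add: coord_def cls_eq)
qed

lemma coord_image: "coord ` carrier Q = h ` carrier M"
  by (force simp: carrier_Q coord_cls image_image)

lemma inj_coord: "inj_on coord (carrier Q)"
  by (auto simp: inj_on_def carrier_Q coord_cls cls_eq_iff)

lemma form_coord: "C \<in> carrier Q \<Longrightarrow> D \<in> carrier Q \<Longrightarrow> form Q C D = \<beta> (coord C) (coord D)"
  by (auto simp: carrier_Q form_Q coord_cls)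

lemma coord_module_Q: "coord_module R Q coord"
proof -
  have "abelian_group Q"
  proof (rule abelian_groupI)
    fix C assume "C \<in> carrier Q"
    then obtain x where x: "x \<in> carrier M" "C = cls x"
      by (auto simp: carrier_Q)
    then show "\<exists>y\<in>carrier Q. y \<oplus>\<^bsub>Q\<^esub> C = \<zero>\<^bsub>Q\<^esub>"
      by (intro bexI[of _ "cls (\<ominus>\<^bsub>M\<^esub> x)"]) (auto simp: carrier_Q add_Q MM.M.l_neg zero_Q)
  qed (auto simp: carrier_Q add_Q zero_Q MM.M.a_ac)
  moreover have "ring (qring R)"
    by (rule ring_qring)
  moreover have "right_module_axioms (qring R) Q"
    using MM.rsmult_l_distr MM.rsmult_r_distr MM.rsmult_assoc MM.rsmult_one
    by unfold_locales
       (auto simp: carrier_Q smult_Q add_Q MM.rsmult_closed MM.rsmult_one one_in add_in mult_in)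
  ultimately have "right_module (qring R) Q"
    by (intro right_module.intro)
  then show ?thesis
    by (intro coord_module.intro star_ring_axioms coord_module_axioms.intro)
       (auto simp: carrier_Q smult_Q add_Q coord_cls h_add h_smult MM.rsmult_closed)
qed

end

section \<open>Diagonal forms and free Hermitian modules\<close>

definition diag_form :: "'j set \<Rightarrow> ('j \<Rightarrow> real) \<Rightarrow> ('j \<Rightarrow> quat) \<Rightarrow> ('j \<Rightarrow> quat) \<Rightarrow> quat" where
  "diag_form J \<epsilon> u v = (\<Sum>j\<in>J. \<epsilon> j *\<^sub>R (qcnj (u j) * v j))"

text \<open>Produces exactly the double sum that defines the form of \<open>free_herm\<close>. The
  factors must keep their order; only the real signs \<epsilon> may be moved.\<close>

lemma diag_form_sums:
  "diag_form J \<epsilon> (\<lambda>j. \<Sum>r\<in>A. f r j * v r) (\<lambda>j. \<Sum>s\<in>B. g s j * w s) =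
   (\<Sum>r\<in>A. \<Sum>s\<in>B. qcnj (v r) * diag_form J \<epsilon> (f r) (g s) * w s)"
proof -
  have "diag_form J \<epsilon> (\<lambda>j. \<Sum>r\<in>A. f r j * v r) (\<lambda>j. \<Sum>s\<in>B. g s j * w s) =
      (\<Sum>j\<in>J. \<Sum>r\<in>A. \<Sum>s\<in>B. qcnj (v r) * (\<epsilon> j *\<^sub>R (qcnj (f r j) * g s j)) * w s)"
    by (simp add: diag_form_def sum_product scaleR_sum_right mult.assoc)
  also have "\<dots> = (\<Sum>r\<in>A. \<Sum>j\<in>J. \<Sum>s\<in>B. qcnj (v r) * (\<epsilon> j *\<^sub>R (qcnj (f r j) * g s j)) * w s)"
    by (rule sum.swap)
  also have "\<dots> = (\<Sum>r\<in>A. \<Sum>s\<in>B. \<Sum>j\<in>J. qcnj (v r) * (\<epsilon> j *\<^sub>R (qcnj (f r j) * g s j)) * w s)"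
    by (intro sum.cong refl sum.swap)
  finally show ?thesis
    by (simp add: diag_form_def sum_distrib_left sum_distrib_right)
qed

lemma diag_form_add_right:
  "diag_form J \<epsilon> u (\<lambda>j. v j + w j) = diag_form J \<epsilon> u v + diag_form J \<epsilon> u w"
  by (simp add: diag_form_def algebra_simps sum.distrib)

lemma diag_form_mult_right: "diag_form J \<epsilon> u (\<lambda>j. v j * a) = diag_form J \<epsilon> u v * a"
  by (simp add: diag_form_def sum_distrib_right mult.assoc)

lemma qcnj_diag_form: "qcnj (diag_form J \<epsilon> u v) = diag_form J \<epsilon> v u"
  by (simp add: diag_form_def)

lemma diag_form_unit_left:
  assumes "finite J" "j \<in> J"
  shows "diag_form J \<epsilon> (unit_vec j a) v = \<epsilon> j *\<^sub>R (qcnj a * v j)"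
proof -
  have "diag_form J \<epsilon> (unit_vec j a) v = (\<Sum>i\<in>J. if j = i then \<epsilon> j *\<^sub>R (qcnj a * v j) else 0)"
    unfolding diag_form_def by (intro sum.cong) (auto simp: unit_vec_def)
  then show ?thesis
    using assms by simp
qed

text \<open>The sum runs over the support rather than an index set, because in the extension of
  scalars the vectors are indexed by all elements of the lattice.\<close>

definition lincomb :: "('r \<Rightarrow> 'j \<Rightarrow> quat) \<Rightarrow> ('r \<Rightarrow> quat) \<Rightarrow> 'j \<Rightarrow> quat" where
  "lincomb f v = (\<lambda>j. \<Sum>r | v r \<noteq> 0. f r j * v r)"

lemma lincomb_superset:
  assumes "finite A" "{r. v r \<noteq> 0} \<subseteq> A"
  shows "lincomb f v = (\<lambda>j. \<Sum>r\<in>A. f r j * v r)"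
  unfolding lincomb_def using assms by (intro ext sum.mono_neutral_left) auto

lemma finite_support_add: "finite {i. v i \<noteq> 0} \<Longrightarrow> finite {i. w i \<noteq> 0} \<Longrightarrow> finite {i. v i + w i \<noteq> (0::quat)}"
  by (rule finite_subset[of _ "{i. v i \<noteq> 0} \<union> {i. w i \<noteq> 0}"]) auto

lemma finite_support_diff: "finite {i. v i \<noteq> 0} \<Longrightarrow> finite {i. w i \<noteq> 0} \<Longrightarrow> finite {i. v i - w i \<noteq> (0::quat)}"
  by (rule finite_subset[of _ "{i. v i \<noteq> 0} \<union> {i. w i \<noteq> 0}"]) auto

lemma finite_support_mult: "finite {i. v i \<noteq> 0} \<Longrightarrow> finite {i. v i * a \<noteq> (0::quat)}"
  by (rule finite_subset[of _ "{i. v i \<noteq> 0}"]) auto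

lemma finite_support_unit_vec [simp]: "finite {i. unit_vec r a i \<noteq> 0}"
  by (rule finite_subset[of _ "{r}"]) (auto simp: unit_vec_def)

lemma unit_vec_mult: "unit_vec r a z * b = unit_vec r (a * b) z"
  by (simp add: unit_vec_def)

lemma lincomb_add:
  assumes "finite {i. v i \<noteq> 0}" "finite {i. w i \<noteq> 0}"
  shows "lincomb f (\<lambda>i. v i + w i) = (\<lambda>j. lincomb f v j + lincomb f w j)"
proof -
  let ?A = "{i. v i \<noteq> 0} \<union> {i. w i \<noteq> 0}"
  have "lincomb f (\<lambda>i. v i + w i) = (\<lambda>j. \<Sum>r\<in>?A. f r j * (v r + w r))"
    "lincomb f v = (\<lambda>j. \<Sum>r\<in>?A. f r j * v r)" "lincomb f w = (\<lambda>j. \<Sum>r\<in>?A. f r j * w r)"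
    by (intro lincomb_superset; use assms in auto)+
  then show ?thesis
    by (simp add: algebra_simps sum.distrib)
qed

lemma lincomb_mult:
  assumes "finite {i. v i \<noteq> 0}"
  shows "lincomb f (\<lambda>i. v i * a) = (\<lambda>j. lincomb f v j * a)"
proof -
  have "lincomb f (\<lambda>i. v i * a) = (\<lambda>j. \<Sum>r | v r \<noteq> 0. f r j * (v r * a))"
    by (intro lincomb_superset) (use assms in auto)
  then show ?thesis
    by (simp add: lincomb_def sum_distrib_right mult.assoc)
qed

lemma lincomb_diff:
  assumes "finite {i. v i \<noteq> 0}" "finite {i. w i \<noteq> 0}"
  shows "lincomb f (\<lambda>i. v i - w i) = (\<lambda>j. lincomb f v j - lincomb f w j)"
  using lincomb_add[of v "\<lambda>i. w i * (-1)" f] lincomb_mult[of w f "-1"] assms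
  by (simp add: finite_support_mult)

lemma lincomb_unit_vec: "lincomb f (unit_vec r a) = (\<lambda>j. f r j * a)"
  by (subst lincomb_superset[of "{r}"]) (auto simp: unit_vec_def)

lemma lincomb_zero: "lincomb f (\<lambda>i. 0) = (\<lambda>j. 0)"
  by (simp add: lincomb_def)

lemma carrier_free_module:
  "v \<in> carrier (free_module R I) \<longleftrightarrow> (\<forall>i. v i \<in> R) \<and> (\<forall>i. i \<notin> I \<longrightarrow> v i = 0) \<and> finite {i. v i \<noteq> 0}"
  by (simp add: free_module_def)

lemma free_module_ops [simp]:
  "\<zero>\<^bsub>free_module R I\<^esub> = (\<lambda>i. 0)" "v \<oplus>\<^bsub>free_module R I\<^esub> w = (\<lambda>i. v i + w i)"
  "a \<odot>\<^bsub>free_module R I\<^esub> v = (\<lambda>i. v i * a)"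
  by (simp_all add: free_module_def)

lemma (in star_ring) unit_vec_in: "r \<in> I \<Longrightarrow> a \<in> R \<Longrightarrow> unit_vec r a \<in> carrier (free_module R I)"
  by (simp add: carrier_free_module) (auto simp: unit_vec_def zero_in)

lemma (in star_ring) free_module_diff:
  assumes "u \<in> carrier (free_module R I)" "v \<in> carrier (free_module R I)"
  shows "(\<lambda>i. u i - v i) \<in> carrier (free_module R I)"
  unfolding carrier_free_module
proof (intro conjI)
  show "finite {i. u i - v i \<noteq> 0}"
    using assms by (intro finite_support_diff) (auto simp: carrier_free_module)
qed (use assms in \<open>auto simp: carrier_free_module minus_in\<close>)

lemma (in star_ring) coord_module_free_herm: "coord_module R (free_herm R I G) (lincomb f)"
  by (intro coord_module.intro coord_module_axioms.intro star_ring_axioms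
      right_module_free_herm[OF star_ring_axioms])
     (simp_all add: carrier_free_module lincomb_add lincomb_mult)

text \<open>Sesquilinearity reduces a pullback of forms to a comparison of Gram matrices. The index
  set is once the set of points and lines, and once the whole lattice.\<close>

lemma form_free_herm_lincomb:
  assumes "x \<in> carrier (free_herm R I G)" "y \<in> carrier (free_herm R I G)"
    and "\<And>r s. r \<in> I \<Longrightarrow> s \<in> I \<Longrightarrow> G r s = diag_form J \<epsilon> (f r) (f s)"
  shows "form (free_herm R I G) x y = diag_form J \<epsilon> (lincomb f x) (lincomb f y)"
proof -
  have "r \<in> I" if "x r \<noteq> 0 \<or> y r \<noteq> 0" for r
    using assms(1,2) that by (auto simp: carrier_free_module)
  then show ?thesis
    by (auto simp: lincomb_def diag_form_sums assms(3) intro!: sum.cong)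
qed

section \<open>Extension of scalars\<close>

context integral_star_ring
begin

lemma tensor_relations_in:
  assumes "abelian_monoid L" "\<And>a x. a \<in> R \<Longrightarrow> x \<in> carrier L \<Longrightarrow> a \<odot>\<^bsub>L\<^esub> x \<in> carrier L"
  shows "tensor_relations R L \<subseteq> carrier (free_module (Frac R) (carrier L))"
proof
  interpret F: star_ring "Frac R" by (rule star_ring_Frac)
  interpret abelian_monoid L by fact
  fix u assume "u \<in> tensor_relations R L"
  then consider x y where "u = (\<lambda>z. unit_vec (x \<oplus>\<^bsub>L\<^esub> y) 1 z - unit_vec x 1 z - unit_vec y 1 z)"
      "x \<in> carrier L" "y \<in> carrier L"
    | a x where "u = (\<lambda>z. unit_vec (a \<odot>\<^bsub>L\<^esub> x) 1 z - unit_vec x a z)" "a \<in> R" "x \<in> carrier L"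
    unfolding tensor_relations_def by auto
  then show "u \<in> carrier (free_module (Frac R) (carrier L))"
  proof cases
    case 1
    then show ?thesis
      by (auto intro!: F.free_module_diff F.unit_vec_in F.one_in)
  next
    case 2
    then show ?thesis
      using subset_Frac assms(2)[of a x]
      by (auto intro!: F.free_module_diff F.unit_vec_in F.one_in)
  qed
qed

lemma tensor_kernel_add:
  "u \<in> tensor_kernel R L \<Longrightarrow> v \<in> tensor_kernel R L \<Longrightarrow> (\<lambda>z. u z + v z) \<in> tensor_kernel R L"
  unfolding tensor_kernel_def generated_submodule_def
  using subgroup.m_closed[OF submodule.axioms(1)] by fastforce

lemma tensor_kernel_smult:
  "a \<in> Frac R \<Longrightarrow> u \<in> tensor_kernel R L \<Longrightarrow> (\<lambda>z. u z * a) \<in> tensor_kernel R L"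
  unfolding tensor_kernel_def generated_submodule_def
  using submodule.smult_closed by fastforce

lemma tensor_relations_subset: "tensor_relations R L \<subseteq> tensor_kernel R L"
  by (auto simp: tensor_kernel_def generated_submodule_def)

lemma tensor_kernel_sum_relation:
  assumes "x \<in> carrier L" "y \<in> carrier L"
  shows "(\<lambda>z. unit_vec (x \<oplus>\<^bsub>L\<^esub> y) 1 z - unit_vec x 1 z - unit_vec y 1 z) \<in> tensor_kernel R L"
  by (rule subsetD[OF tensor_relations_subset])
     (unfold tensor_relations_def, rule UnI1, rule CollectI, intro exI conjI, rule refl, use assms in auto)

lemma tensor_kernel_smult_relation:
  assumes "a \<in> R" "x \<in> carrier L"
  shows "(\<lambda>z. unit_vec (a \<odot>\<^bsub>L\<^esub> x) 1 z - unit_vec x a z) \<in> tensor_kernel R L"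
  by (rule subsetD[OF tensor_relations_subset])
     (unfold tensor_relations_def, rule UnI2, rule CollectI, intro exI conjI, rule refl, use assms in auto)

lemma tensor_kernel_diff:
  assumes "u \<in> tensor_kernel R L" "v \<in> tensor_kernel R L"
  shows "(\<lambda>z. u z - v z) \<in> tensor_kernel R L"
proof -
  have "-1 \<in> Frac R"
    using subset_Frac one_in uminus_in by auto
  from tensor_kernel_add[OF assms(1) tensor_kernel_smult[OF this assms(2)]] show ?thesis
    by simp
qed

text \<open>The linear extension of \<open>f\<close> kills every bilinearity relation, and its
  kernel is a submodule, so this kernel is among the submodules intersected in
  \<open>generated_submodule\<close>.\<close>

lemma tensor_kernel_subset:
  assumes "coord_module R L f"
  shows "tensor_kernel R L \<subseteq> {c \<in> carrier (free_module (Frac R) (carrier L)). lincomb f c = (\<lambda>j. 0)}"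
    (is "_ \<subseteq> ?K")
proof -
  interpret L: coord_module R L f by fact
  interpret F: star_ring "Frac R" by (rule star_ring_Frac)
  interpret M: right_module "qring (Frac R)" "free_module (Frac R) (carrier L)"
    by (rule right_module_free_module[OF star_ring_Frac])
  have "submodule ?K (qring (Frac R)) (free_module (Frac R) (carrier L))"
  proof (intro submodule.intro submodule_axioms.intro)
    show "subgroup ?K (add_monoid (free_module (Frac R) (carrier L)))"
    proof (rule subgroup.intro)
      show "\<one>\<^bsub>add_monoid (free_module (Frac R) (carrier L))\<^esub> \<in> ?K"
        using M.M.zero_closed by (auto simp: lincomb_zero)
      fix u assume u: "u \<in> ?K"
      have u': "(\<lambda>i. u i * (-1)) \<in> carrier (free_module (Frac R) (carrier L))"
        using u by (simp add: carrier_free_module F.uminus_in)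
      then have "\<ominus>\<^bsub>free_module (Frac R) (carrier L)\<^esub> u = (\<lambda>i. u i * (-1))"
        using u by (intro M.M.minus_equality) auto
      then show "inv\<^bsub>add_monoid (free_module (Frac R) (carrier L))\<^esub> u \<in> ?K"
        using u u' lincomb_mult[of u f "-1"] by (simp add: a_inv_def carrier_free_module)
    next
      fix u v assume "u \<in> ?K" "v \<in> ?K"
      then show "u \<otimes>\<^bsub>add_monoid (free_module (Frac R) (carrier L))\<^esub> v \<in> ?K"
        by (auto simp: carrier_free_module finite_support_add lincomb_add F.add_in)
    qed auto
  qed (auto simp: carrier_free_module finite_support_mult lincomb_mult F.mult_in)
  moreover have "tensor_relations R L \<subseteq> ?K"
  proof
    fix u assume u: "u \<in> tensor_relations R L"
    then have "lincomb f u = (\<lambda>j. 0)"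
      unfolding tensor_relations_def
      by (auto simp: lincomb_diff[OF finite_support_diff] lincomb_diff lincomb_unit_vec L.h_add L.h_smult)
    moreover have "u \<in> carrier (free_module (Frac R) (carrier L))"
      using u tensor_relations_in[OF L.MM.M.abelian_monoid_axioms] L.MM.rsmult_closed by auto
    ultimately show "u \<in> ?K"
      by simp
  qed
  ultimately show ?thesis
    unfolding tensor_kernel_def generated_submodule_def by blast
qed

lemma of_real_inverse_in_Frac: "m > 0 \<Longrightarrow> of_real (1 / real m) \<in> Frac R"
  unfolding Frac_iff by (intro bexI[of _ 1] exI[of _ m]) (auto simp: of_real_def one_in)

text \<open>Clearing denominators, every tensor becomes a pure tensor \<open>x \<otimes> 1/m\<close>.\<close>

lemma pure_tensor_exists:
  assumes "coord_module R L f" "finite A" "A \<subseteq> carrier L"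
    and "\<And>i. c i \<in> Frac R" "\<And>i. i \<notin> A \<Longrightarrow> c i = 0"
  shows "\<exists>x\<in>carrier L. \<exists>m>0. (\<lambda>z. c z - unit_vec x (of_real (1 / real m)) z) \<in> tensor_kernel R L"
  using assms(2-5)
proof (induction A arbitrary: c)
  case empty
  interpret L: coord_module R L f by fact
  interpret F: star_ring "Frac R" by (rule star_ring_Frac)
  \<comment> \<open>The additivity relation for 0 + 0 is minus the pure tensor of 0 and 1, which
    represents the empty sum with \<open>m = 1\<close>.\<close>
  have "(\<lambda>z. unit_vec (\<zero>\<^bsub>L\<^esub> \<oplus>\<^bsub>L\<^esub> \<zero>\<^bsub>L\<^esub>) 1 z - unit_vec \<zero>\<^bsub>L\<^esub> 1 z - unit_vec \<zero>\<^bsub>L\<^esub> 1 z) \<in> tensor_kernel R L"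
    by (rule tensor_kernel_sum_relation) auto
  then show ?case
    using empty by (intro bexI[of _ "\<zero>\<^bsub>L\<^esub>"] exI[of _ 1]) (auto simp: fun_eq_iff)
next
  case (insert y A)
  interpret L: coord_module R L f by fact
  interpret F: star_ring "Frac R" by (rule star_ring_Frac)
  let ?c = "c(y := 0)"
  have "\<exists>x\<in>carrier L. \<exists>m>0. (\<lambda>z. ?c z - unit_vec x (of_real (1 / real m)) z) \<in> tensor_kernel R L"
    using insert.prems F.zero_in by (intro insert.IH) auto
  then obtain x m where x: "x \<in> carrier L" "m > 0"
    "(\<lambda>z. ?c z - unit_vec x (of_real (1 / real m)) z) \<in> tensor_kernel R L"
    by blast
  have y: "y \<in> carrier L"
    using insert by auto
  obtain a k where a: "a \<in> R" "k > 0" "c y = (1 / real k) *\<^sub>R a"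
    using insert.prems(2)[of y] Frac_iff by auto
  define ka where "ka = (of_nat k :: quat)"
  define ma where "ma = of_nat m * a"
  have in_R: "ka \<in> R" "ma \<in> R"
    using a by (auto simp: ka_def ma_def ring_in)
  \<comment> \<open>Addition over the common denominator: the tensor of \<open>x\<close> and 1/m
    plus the tensor of \<open>y\<close> and a/k is the tensor of \<open>x'\<close> and 1/(m
    k).\<close>
  define x' where "x' = ka \<odot>\<^bsub>L\<^esub> x \<oplus>\<^bsub>L\<^esub> ma \<odot>\<^bsub>L\<^esub> y"
  have x': "x' \<in> carrier L"
    using in_R x y by (auto simp: x'_def L.MM.rsmult_closed)
  have "(\<lambda>z. unit_vec x' 1 z - unit_vec (ka \<odot>\<^bsub>L\<^esub> x) 1 z - unit_vec (ma \<odot>\<^bsub>L\<^esub> y) 1 z) \<in> tensor_kernel R L"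
    unfolding x'_def by (rule tensor_kernel_sum_relation) (use in_R x y L.MM.rsmult_closed in auto)
  moreover have "(\<lambda>z. unit_vec (ka \<odot>\<^bsub>L\<^esub> x) 1 z - unit_vec x ka z) \<in> tensor_kernel R L"
    "(\<lambda>z. unit_vec (ma \<odot>\<^bsub>L\<^esub> y) 1 z - unit_vec y ma z) \<in> tensor_kernel R L"
    using in_R x y by (auto intro: tensor_kernel_smult_relation)
  ultimately have "(\<lambda>z. (unit_vec x' 1 z - unit_vec (ka \<odot>\<^bsub>L\<^esub> x) 1 z - unit_vec (ma \<odot>\<^bsub>L\<^esub> y) 1 z)
      + (unit_vec (ka \<odot>\<^bsub>L\<^esub> x) 1 z - unit_vec x ka z) + (unit_vec (ma \<odot>\<^bsub>L\<^esub> y) 1 z - unit_vec y ma z))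
      \<in> tensor_kernel R L"
    by (intro tensor_kernel_add)
  then have "(\<lambda>z. unit_vec x' 1 z - unit_vec x ka z - unit_vec y ma z) \<in> tensor_kernel R L"
    by (simp add: algebra_simps)
  from tensor_kernel_smult[OF of_real_inverse_in_Frac[of "m * k"] this]
  have "(\<lambda>z. (unit_vec x' 1 z - unit_vec x ka z - unit_vec y ma z) * of_real (1 / real (m * k)))
      \<in> tensor_kernel R L"
    using x a by simp
  also have "(\<lambda>z. (unit_vec x' 1 z - unit_vec x ka z - unit_vec y ma z) * of_real (1 / real (m * k))) =
      (\<lambda>z. unit_vec x' (of_real (1 / real (m * k))) z - unit_vec x (of_real (1 / real m)) z
         - unit_vec y (c y) z)"
  proof -
    have "ka * of_real (1 / real (m * k)) = of_real (1 / real m)"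
      "ma * of_real (1 / real (m * k)) = c y"
      using x(2) a(2) unfolding ka_def ma_def a(3) of_nat_as_of_real
      by (simp_all add: quat_eq_iff q_mult_sel del: of_real_divide of_real_mult of_real_of_nat_eq)
    then show ?thesis
      by (simp only: left_diff_distrib unit_vec_mult mult_1)
  qed
  finally have "(\<lambda>z. (?c z - unit_vec x (of_real (1 / real m)) z) -
      (unit_vec x' (of_real (1 / real (m * k))) z - unit_vec x (of_real (1 / real m)) z
         - unit_vec y (c y) z)) \<in> tensor_kernel R L"
    by (rule tensor_kernel_diff[OF x(3)])
  also have "(\<lambda>z. (?c z - unit_vec x (of_real (1 / real m)) z) -
      (unit_vec x' (of_real (1 / real (m * k))) z - unit_vec x (of_real (1 / real m)) z
         - unit_vec y (c y) z)) = (\<lambda>z. c z - unit_vec x' (of_real (1 / real (m * k))) z)"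
    by (auto simp: unit_vec_def fun_eq_iff)
  finally show ?case
    using x' x(2) a(2) by (intro bexI[of _ x'] exI[of _ "m * k"]) auto
qed

text \<open>Injectivity of \<open>f\<close> survives the extension of scalars: modulo relations a
  tensor is pure, say of \<open>x\<close> and 1/m, and its coordinates are those of \<open>x\<close>
  divided by \<open>m\<close>. If they vanish then \<open>x\<close> is zero, and a tensor of zero
  lies in \<open>tensor_kernel\<close>.\<close>

lemma tensor_kernel_eq:
  assumes "coord_module R L f" "inj_on f (carrier L)"
  shows "tensor_kernel R L = {c \<in> carrier (free_module (Frac R) (carrier L)). lincomb f c = (\<lambda>j. 0)}"
proof (intro equalityI tensor_kernel_subset assms subsetI)
  interpret L: coord_module R L f by fact
  fix c assume c: "c \<in> {c \<in> carrier (free_module (Frac R) (carrier L)). lincomb f c = (\<lambda>j. 0)}"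
  then have "\<exists>x\<in>carrier L. \<exists>m>0. (\<lambda>z. c z - unit_vec x (of_real (1 / real m)) z) \<in> tensor_kernel R L"
    by (intro pure_tensor_exists[OF assms(1), of "{i. c i \<noteq> 0}"])
       (force simp: carrier_free_module)+
  then obtain x m where x: "x \<in> carrier L" "m > 0"
    and *: "(\<lambda>z. c z - unit_vec x (of_real (1 / real m)) z) \<in> tensor_kernel R L"
    by blast
  have "lincomb f (\<lambda>z. c z - unit_vec x (of_real (1 / real m)) z) = (\<lambda>j. 0)"
    using * tensor_kernel_subset[OF assms(1)] by auto
  then have "f x = f \<zero>\<^bsub>L\<^esub>"
    using c x(2) unfolding carrier_free_module mem_Collect_eq L.h_zero
    by (simp add: lincomb_diff[OF _ finite_support_unit_vec] lincomb_unit_vec fun_eq_iff divide_inverse)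
  then have x0: "x = \<zero>\<^bsub>L\<^esub>"
    using assms(2) x(1) by (auto simp: inj_on_def)
  have "(\<lambda>z. unit_vec (\<zero>\<^bsub>L\<^esub> \<oplus>\<^bsub>L\<^esub> \<zero>\<^bsub>L\<^esub>) 1 z - unit_vec \<zero>\<^bsub>L\<^esub> 1 z - unit_vec \<zero>\<^bsub>L\<^esub> 1 z) \<in> tensor_kernel R L"
    by (rule tensor_kernel_sum_relation) auto
  from tensor_kernel_smult[OF of_real_inverse_in_Frac[OF x(2)] this]
  have "(\<lambda>z. - unit_vec \<zero>\<^bsub>L\<^esub> (of_real (1 / real m)) z) \<in> tensor_kernel R L"
    by (simp only: left_diff_distrib unit_vec_mult mult_1 L.MM.M.l_zero[OF L.MM.M.zero_closed]
        diff_self diff_0 mult_minus_left)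
  from tensor_kernel_diff[OF * this] show "c \<in> tensor_kernel R L"
    by (simp add: x0)
qed

lemma kernel_quotient_extend_scalars:
  assumes "coord_module R L f" "inj_on f (carrier L)"
    and "\<And>x y. x \<in> carrier L \<Longrightarrow> y \<in> carrier L \<Longrightarrow> form L x y = diag_form J \<epsilon> (f x) (f y)"
  shows "kernel_quotient (Frac R) (free_herm (Frac R) (carrier L) (form L)) (lincomb f)
     (tensor_kernel R L) (diag_form J \<epsilon>)"
proof -
  interpret F: star_ring "Frac R" by (rule star_ring_Frac)
  have "kernel_quotient_axioms (free_herm (Frac R) (carrier L) (form L)) (lincomb f)
     (tensor_kernel R L) (diag_form J \<epsilon>)"
  proof (rule kernel_quotient_axioms.intro)
    show "tensor_kernel R L =
        {x \<in> carrier (free_herm (Frac R) (carrier L) (form L)). lincomb f x = (\<lambda>j. 0)}"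
      unfolding free_herm_simps(1) by (rule tensor_kernel_eq[OF assms(1,2)])
  qed (rule form_free_herm_lincomb[where I = "carrier L"], assumption, assumption, rule assms(3))
  then show ?thesis
    by (rule kernel_quotient.intro[OF F.coord_module_free_herm])
qed

end

section \<open>Bases, dimension and signature\<close>

context coord_module
begin

text \<open>The image of \<open>h\<close> is the full coordinate space on \<open>J\<close>, so the
  preimages of the unit vectors are a basis; reading off the coordinate \<sigma> k determines the
  \<open>k\<close>-th coefficient. It serves both the extension of scalars and the
  eigenspaces.\<close>

lemma standard_basis:
  assumes inj: "inj_on h (carrier M)"
    and image: "h ` carrier M = {u. (\<forall>j\<in>J. u j \<in> R) \<and> (\<forall>j. j \<notin> J \<longrightarrow> u j = 0)}"
    and \<sigma>: "bij_betw \<sigma> {..<N} J"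
  shows "\<exists>b. is_basis (qring R) M N b \<and> (\<forall>i<N. h (b i) = unit_vec (\<sigma> i) 1)"
proof -
  have "\<exists>x\<in>carrier M. h x = unit_vec (\<sigma> i) 1" if "i < N" for i
  proof -
    have "\<sigma> i \<in> J"
      using \<sigma> that by (auto simp: bij_betw_def)
    then have "unit_vec (\<sigma> i) 1 \<in> h ` carrier M"
      unfolding image by (auto simp: unit_vec_def one_in zero_in)
    then show ?thesis
      by auto
  qed
  then obtain b where b: "\<And>i. i < N \<Longrightarrow> b i \<in> carrier M" "\<And>i. i < N \<Longrightarrow> h (b i) = unit_vec (\<sigma> i) 1"
    by metis
  have eval: "(\<Sum>i<N. h (b i) (\<sigma> k) * c i) = c k" if "k < N" for k and c :: "nat \<Rightarrow> quat"
  proof -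
    have "(\<Sum>i<N. h (b i) (\<sigma> k) * c i) = (\<Sum>i<N. if k = i then c i else 0)"
      using \<sigma> that b(2) by (intro sum.cong) (auto simp: unit_vec_def bij_betw_def inj_on_def)
    then show ?thesis
      using that by simp
  qed
  have eval0: "(\<Sum>i<N. h (b i) j * c i) = 0" if "j \<notin> J" for j and c :: "nat \<Rightarrow> quat"
    using \<sigma> that b(2) by (intro sum.neutral) (auto simp: unit_vec_def bij_betw_def)
  have "\<exists>!c. c \<in> {..<N} \<rightarrow>\<^sub>E R \<and> x = (\<Oplus>\<^bsub>M\<^esub>i\<in>{..<N}. c i \<odot>\<^bsub>M\<^esub> b i)" if x: "x \<in> carrier M" for x
  proof (rule ex1I)
    have hx: "h x \<in> {u. (\<forall>j\<in>J. u j \<in> R) \<and> (\<forall>j. j \<notin> J \<longrightarrow> u j = 0)}"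
      using x image by blast
    define c where "c = (\<lambda>i\<in>{..<N}. h x (\<sigma> i))"
    have c: "c \<in> {..<N} \<rightarrow>\<^sub>E R"
      using hx \<sigma> by (auto simp: c_def bij_betw_def)
    then have c': "c \<in> {..<N} \<rightarrow> R"
      by auto
    have bb: "b \<in> {..<N} \<rightarrow> carrier M"
      using b by auto
    have "h x = (\<lambda>j. \<Sum>i<N. h (b i) j * c i)"
    proof
      fix j show "h x j = (\<Sum>i<N. h (b i) j * c i)"
      proof (cases "j \<in> J")
        case True
        then obtain k where "k < N" "j = \<sigma> k"
          using \<sigma> by (auto simp: bij_betw_def)
        then show ?thesis
          by (simp add: eval c_def)
      next
        case False
        then show ?thesis
          using hx by (simp add: eval0)
      qed
    qed
    then have "x = (\<Oplus>\<^bsub>M\<^esub>i\<in>{..<N}. c i \<odot>\<^bsub>M\<^esub> b i)"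
      using h_lincomb[OF _ c' bb] inj x by (auto simp: inj_on_def)
    with c show "c \<in> {..<N} \<rightarrow>\<^sub>E R \<and> x = (\<Oplus>\<^bsub>M\<^esub>i\<in>{..<N}. c i \<odot>\<^bsub>M\<^esub> b i)"
      by simp
    fix d assume d: "d \<in> {..<N} \<rightarrow>\<^sub>E R \<and> x = (\<Oplus>\<^bsub>M\<^esub>i\<in>{..<N}. d i \<odot>\<^bsub>M\<^esub> b i)"
    then have "h x = (\<lambda>j. \<Sum>i<N. h (b i) j * d i)"
      using h_lincomb(2)[OF _ _ bb, of d] by auto
    then have "d k = c k" if "k < N" for k
      using that by (simp add: eval c_def)
    then show "d = c"
      by (intro PiE_ext[OF conjunct1[OF d] c]) auto
  qed
  then show ?thesis
    using b unfolding is_basis_def by (intro exI[of _ b]) simp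
qed

end

section \<open>Invariance of dimension over the division ring of quaternions\<close>

lemma homogeneous_system_solution:
  fixes A :: "nat \<Rightarrow> 'i \<Rightarrow> quat"
  assumes "finite I" "e < card I"
  shows "\<exists>x. (\<exists>i\<in>I. x i \<noteq> 0) \<and> (\<forall>j<e. (\<Sum>i\<in>I. A j i * x i) = 0)"
  using assms
proof (induction e arbitrary: I A)
  case 0
  then obtain i where "i \<in> I"
    by fastforce
  then show ?case
    by (intro exI[of _ "\<lambda>_. 1"]) auto
next
  case (Suc e)
  show ?case
  proof (cases "\<forall>i\<in>I. A e i = 0")
    case True
    obtain x where x: "\<exists>i\<in>I. x i \<noteq> 0" "\<forall>j<e. (\<Sum>i\<in>I. A j i * x i) = 0"
      using Suc.IH[of I A] Suc.prems by auto
    have "(\<Sum>i\<in>I. A e i * x i) = 0"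
      using True by simp
    with x show ?thesis
      by (auto simp: less_Suc_eq)
  next
    case False
    then obtain k where k: "k \<in> I" "A e k \<noteq> 0"
      by auto
    define a where "a = A e k"
    have "e < card (I - {k})"
      using Suc.prems k by simp
    then obtain x where x: "\<exists>i\<in>I - {k}. x i \<noteq> 0"
      "\<And>j. j < e \<Longrightarrow> (\<Sum>i\<in>I - {k}. (A j i - A j k * inverse a * A e i) * x i) = 0"
      using Suc.IH[of "I - {k}" "\<lambda>j i. A j i - A j k * inverse a * A e i"] Suc.prems(1)
      by auto
    \<comment> \<open>Equation \<open>e\<close> is solved for the unknown at \<open>k\<close>.
      Coefficients stay on the left and unknowns on the right, so elimination works without
      commutativity.\<close>
    define y where "y = x(k := - (inverse a * (\<Sum>i\<in>I - {k}. A e i * x i)))"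
    have sum_y: "(\<Sum>i\<in>I. A j i * y i) =
        (\<Sum>i\<in>I - {k}. (A j i - A j k * inverse a * A e i) * x i)" for j
    proof -
      have "(\<Sum>i\<in>I. A j i * y i) = A j k * y k + (\<Sum>i\<in>I - {k}. A j i * y i)"
        using Suc.prems k by (simp add: sum.remove)
      also have "(\<Sum>i\<in>I - {k}. A j i * y i) = (\<Sum>i\<in>I - {k}. A j i * x i)"
        by (intro sum.cong) (auto simp: y_def)
      also have "A j k * y k = - (\<Sum>i\<in>I - {k}. A j k * inverse a * A e i * x i)"
        by (simp add: y_def sum_distrib_left mult.assoc)
      finally show ?thesis
        by (simp add: left_diff_distrib sum_subtractf)
    qed
    have "(\<Sum>i\<in>I. A e i * y i) = 0"
      unfolding sum_y using k(2) by (simp add: a_def)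
    moreover have "\<exists>i\<in>I. y i \<noteq> 0"
      using x(1) by (auto simp: y_def)
    ultimately show ?thesis
      using x(2) by (intro exI[of _ y]) (auto simp: less_Suc_eq sum_y)
  qed
qed

text \<open>If \<open>d > e\<close>, expressing \<open>b\<close> through \<open>c\<close> gives a
  homogeneous system with more unknowns than equations. A nontrivial solution is a second
  representation of zero by \<open>b\<close>, against the uniqueness in
  \<open>is_basis\<close>.\<close>

lemma basis_card_le:
  assumes "coord_module UNIV M h" "inj_on h (carrier M)"
    and d: "is_basis (qring UNIV) M d b" and e: "is_basis (qring UNIV) M e c"
  shows "d \<le> e"
proof (rule ccontr)
  interpret coord_module UNIV M h by fact
  assume "\<not> d \<le> e"
  have b: "b \<in> {..<d} \<rightarrow> carrier M" and c: "c \<in> {..<e} \<rightarrow> carrier M"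
    using d e by (auto simp: is_basis_def)
  have "\<exists>A. b i = (\<Oplus>\<^bsub>M\<^esub>j\<in>{..<e}. A j \<odot>\<^bsub>M\<^esub> c j)" if "i < d" for i
  proof -
    have "b i \<in> carrier M"
      using b that by auto
    then have "\<exists>!A. A \<in> {..<e} \<rightarrow>\<^sub>E carrier (qring UNIV) \<and> b i = (\<Oplus>\<^bsub>M\<^esub>j\<in>{..<e}. A j \<odot>\<^bsub>M\<^esub> c j)"
      using e by (simp add: is_basis_def)
    then show ?thesis
      by blast
  qed
  then obtain A where A: "\<And>i. i < d \<Longrightarrow> b i = (\<Oplus>\<^bsub>M\<^esub>j\<in>{..<e}. A i j \<odot>\<^bsub>M\<^esub> c j)"
    by metis
  have hb: "h (b i) = (\<lambda>k. \<Sum>j<e. h (c j) k * A i j)" if "i < d" for i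
    unfolding A[OF that] by (rule h_lincomb(2)) (use c in auto)
  obtain x where x: "\<exists>i<d. x i \<noteq> 0" "\<And>j. j < e \<Longrightarrow> (\<Sum>i<d. A i j * x i) = 0"
    using homogeneous_system_solution[of "{..<d}" e "\<lambda>j i. A i j"] \<open>\<not> d \<le> e\<close> by auto
  have hx: "h (\<Oplus>\<^bsub>M\<^esub>i\<in>{..<d}. x i \<odot>\<^bsub>M\<^esub> b i) = (\<lambda>k. 0)"
  proof -
    have "h (\<Oplus>\<^bsub>M\<^esub>i\<in>{..<d}. x i \<odot>\<^bsub>M\<^esub> b i) = (\<lambda>k. \<Sum>i<d. h (b i) k * x i)"
      by (rule h_lincomb(2)) (use b in auto)
    also have "\<dots> = (\<lambda>k. \<Sum>i<d. \<Sum>j<e. h (c j) k * (A i j * x i))"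
      by (intro ext sum.cong refl) (auto simp: hb sum_distrib_right mult.assoc)
    also have "\<dots> = (\<lambda>k. \<Sum>j<e. \<Sum>i<d. h (c j) k * (A i j * x i))"
      by (intro ext sum.swap)
    also have "\<dots> = (\<lambda>k. 0)"
      by (auto simp flip: sum_distrib_left simp: x(2))
    finally show ?thesis .
  qed
  have lin: "(\<Oplus>\<^bsub>M\<^esub>i\<in>{..<d}. y i \<odot>\<^bsub>M\<^esub> b i) = \<zero>\<^bsub>M\<^esub>"
    if "h (\<Oplus>\<^bsub>M\<^esub>i\<in>{..<d}. y i \<odot>\<^bsub>M\<^esub> b i) = (\<lambda>k. 0)" for y
    using that assms(2) h_lincomb(1)[of "{..<d}" y b] b h_zero MM.M.zero_closed
    by (auto simp: inj_on_def)
  \<comment> \<open>\<open>is_basis\<close> claims uniqueness only among extensional coefficient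
    families, so the solution and the zero family are both cut off outside the index range.\<close>
  define x' where "x' = restrict x {..<d}"
  define z where "z = (\<lambda>i\<in>{..<d}. 0 :: quat)"
  have "(\<Oplus>\<^bsub>M\<^esub>i\<in>{..<d}. x' i \<odot>\<^bsub>M\<^esub> b i) = \<zero>\<^bsub>M\<^esub>"
  proof (rule lin)
    have "h (\<Oplus>\<^bsub>M\<^esub>i\<in>{..<d}. x' i \<odot>\<^bsub>M\<^esub> b i) = (\<lambda>k. \<Sum>i<d. h (b i) k * x' i)"
      by (rule h_lincomb(2)) (use b in auto)
    also have "\<dots> = (\<lambda>k. \<Sum>i<d. h (b i) k * x i)"
      by (simp add: x'_def)
    also have "\<dots> = h (\<Oplus>\<^bsub>M\<^esub>i\<in>{..<d}. x i \<odot>\<^bsub>M\<^esub> b i)"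
      by (rule h_lincomb(2)[symmetric]) (use b in auto)
    finally show "h (\<Oplus>\<^bsub>M\<^esub>i\<in>{..<d}. x' i \<odot>\<^bsub>M\<^esub> b i) = (\<lambda>k. 0)"
      by (simp add: hx)
  qed
  moreover have "(\<Oplus>\<^bsub>M\<^esub>i\<in>{..<d}. z i \<odot>\<^bsub>M\<^esub> b i) = \<zero>\<^bsub>M\<^esub>"
  proof (rule lin)
    have "h (\<Oplus>\<^bsub>M\<^esub>i\<in>{..<d}. z i \<odot>\<^bsub>M\<^esub> b i) = (\<lambda>k. \<Sum>i<d. h (b i) k * z i)"
      by (rule h_lincomb(2)) (use b in auto)
    then show "h (\<Oplus>\<^bsub>M\<^esub>i\<in>{..<d}. z i \<odot>\<^bsub>M\<^esub> b i) = (\<lambda>k. 0)"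
      by (simp add: z_def)
  qed
  moreover have "x' \<in> {..<d} \<rightarrow>\<^sub>E UNIV" "z \<in> {..<d} \<rightarrow>\<^sub>E UNIV"
    by (auto simp: x'_def z_def)
  moreover have "\<exists>!c. c \<in> {..<d} \<rightarrow>\<^sub>E UNIV \<and> \<zero>\<^bsub>M\<^esub> = (\<Oplus>\<^bsub>M\<^esub>i\<in>{..<d}. c i \<odot>\<^bsub>M\<^esub> b i)"
    using d MM.M.zero_closed by (auto simp: is_basis_def)
  ultimately have "x' = z"
    by metis
  then have "x i = 0" if "i < d" for i
  proof -
    have "x' i = z i"
      by (simp only: \<open>x' = z\<close>)
    then show ?thesis
      using that by (simp add: x'_def z_def)
  qed
  with x(1) show False
    by auto
qed

lemma basis_card_eq:
  assumes "coord_module UNIV M h" "inj_on h (carrier M)"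
    and "is_basis (qring UNIV) M d b" "is_basis (qring UNIV) M e c"
  shows "d = e"
  using basis_card_le[OF assms(1,2)] assms(3,4) by (meson antisym)

lemma star_ring_UNIV: "star_ring UNIV"
  by unfold_locales auto

section \<open>Eigenspaces and signature of real diagonal matrices\<close>

lemma carrier_eigenspace_diagonal:
  assumes "\<And>i j. i < N \<Longrightarrow> j < N \<Longrightarrow> G i j = (if i = j then of_real (\<delta> i) else 0)"
  shows "carrier (eigenspace N G t) =
    {v. (\<forall>i\<in>{i. i < N \<and> \<delta> i = t}. v i \<in> UNIV) \<and> (\<forall>i. i \<notin> {i. i < N \<and> \<delta> i = t} \<longrightarrow> v i = 0)}"
proof -
  have *: "(\<Sum>j<N. G i j * v j) = of_real (\<delta> i) * v i" if "i < N" for i v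
  proof -
    have "(\<Sum>j<N. G i j * v j) = (\<Sum>j<N. if i = j then of_real (\<delta> i) * v j else 0)"
      using that by (intro sum.cong) (auto simp: assms)
    then show ?thesis
      using that by simp
  qed
  \<comment> \<open>Real quaternions are central, so the diagonal entry on the left and the
    eigenvalue on the right can be compared.\<close>
  have **: "of_real (\<delta> i) * v = v * of_real t \<longleftrightarrow> \<delta> i = t \<or> v = 0" for i and v :: quat
    by (auto simp: quat_eq_iff q_mult_sel)
  have fin: "finite {i. v i \<noteq> 0}" if "\<forall>i. \<not> i < N \<longrightarrow> v i = (0::quat)" for v
    by (rule finite_subset[of _ "{..<N}"]) (use that in auto)
  show ?thesis
    by (auto simp: eigenspace_def carrier_free_module * ** fin)
qed

lemma eigenspace_ops [simp]:
  "\<zero>\<^bsub>eigenspace N G t\<^esub> = (\<lambda>i. 0)" "v \<oplus>\<^bsub>eigenspace N G t\<^esub> w = (\<lambda>i. v i + w i)"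
  "a \<odot>\<^bsub>eigenspace N G t\<^esub> v = (\<lambda>i. v i * a)"
  by (simp_all add: eigenspace_def)

text \<open>Unit vectors give a basis of the eigenspace; because the multiplicity is defined through
  \<open>THE\<close>, the invariance of the length of a basis enters as well.\<close>

lemma eigenvalue_multiplicity_diagonal:
  assumes G: "\<And>i j. i < N \<Longrightarrow> j < N \<Longrightarrow> G i j = (if i = j then of_real (\<delta> i) else 0)"
  shows "eigenvalue_multiplicity N G t = card {i. i < N \<and> \<delta> i = t}"
proof -
  interpret U: star_ring UNIV by (rule star_ring_UNIV)
  let ?E = "eigenspace N G t" and ?J = "{i. i < N \<and> \<delta> i = t}"
  have carrier: "carrier ?E = {v. (\<forall>i\<in>?J. v i \<in> UNIV) \<and> (\<forall>i. i \<notin> ?J \<longrightarrow> v i = 0)}"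
    using carrier_eigenspace_diagonal[OF G] .
  have "abelian_group ?E"
  proof (rule abelian_groupI)
    fix v assume "v \<in> carrier ?E"
    then show "\<exists>w\<in>carrier ?E. w \<oplus>\<^bsub>?E\<^esub> v = \<zero>\<^bsub>?E\<^esub>"
      by (intro bexI[of _ "\<lambda>i. - v i"]) (auto simp: carrier)
  qed (auto simp: carrier ac_simps)
  then have "right_module (qring UNIV) ?E"
    by (intro right_module.intro right_module_axioms.intro U.ring_qring)
       (auto simp: carrier algebra_simps)
  then have cm: "coord_module UNIV ?E (\<lambda>v. v)"
    by (intro coord_module.intro coord_module_axioms.intro star_ring_UNIV) auto
  obtain \<sigma> where "bij_betw \<sigma> {..<card ?J} ?J"
    using ex_bij_betw_nat_finite[of ?J] by (auto simp: atLeast0LessThan)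
  from coord_module.standard_basis[OF cm _ _ this] carrier
  obtain b where b: "is_basis (qring UNIV) ?E (card ?J) b"
    by (auto simp: inj_on_def)
  show ?thesis
    unfolding eigenvalue_multiplicity_def
  proof (rule the_equality)
    show "\<exists>b. is_basis (qring UNIV) ?E (card ?J) b"
      using b by blast
    fix d assume "\<exists>b'. is_basis (qring UNIV) ?E d b'"
    then obtain b' where b': "is_basis (qring UNIV) ?E d b'" ..
    show "d = card ?J"
      by (rule basis_card_eq[OF cm inj_on_id2 b' b])
  qed
qed

lemma eigenvalues_diagonal:
  assumes G: "\<And>i j. i < N \<Longrightarrow> j < N \<Longrightarrow> G i j = (if i = j then of_real (\<delta> i) else 0)"
  shows "eigenvalues N G = \<delta> ` {..<N}"
proof -
  have carrier: "carrier (eigenspace N G t) = {v. (\<forall>i\<in>{i. i < N \<and> \<delta> i = t}. v i \<in> UNIV) \<and>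
      (\<forall>i. i \<notin> {i. i < N \<and> \<delta> i = t} \<longrightarrow> v i = 0)}" for t
    using carrier_eigenspace_diagonal[OF G] .
  have "t \<in> eigenvalues N G" if t: "t \<in> \<delta> ` {..<N}" for t
  proof -
    obtain i where i: "i < N" "\<delta> i = t"
      using t by auto
    then have "unit_vec i 1 \<in> carrier (eigenspace N G t)"
      unfolding carrier by (auto simp: unit_vec_def)
    moreover have "unit_vec i (1::quat) \<noteq> (\<lambda>i. 0)"
      by (auto simp: unit_vec_def fun_eq_iff)
    ultimately show ?thesis
      by (auto simp: eigenvalues_def)
  qed
  moreover have "t \<in> \<delta> ` {..<N}" if t': "t \<in> eigenvalues N G" for t
  proof (rule ccontr)
    assume "t \<notin> \<delta> ` {..<N}"
    then have "{i. i < N \<and> \<delta> i = t} = {}"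
      by auto
    then have "carrier (eigenspace N G t) = {\<lambda>i. 0}"
      unfolding carrier by auto
    with t' show False
      by (simp add: eigenvalues_def)
  qed
  ultimately show ?thesis
    by blast
qed

text \<open>\<open>P\<close> stands for positivity or negativity. The index sets belonging to
  different eigenvalues are disjoint and together exhaust the counted set.\<close>

lemma signature_diagonal:
  assumes G: "\<And>i j. i < N \<Longrightarrow> j < N \<Longrightarrow> G i j = (if i = j then of_real (\<delta> i) else 0)"
  shows "(\<Sum>t | t \<in> eigenvalues N G \<and> P t. eigenvalue_multiplicity N G t) = card {i. i < N \<and> P (\<delta> i)}"
proof -
  let ?T = "{t. t \<in> eigenvalues N G \<and> P t}"
  have T: "?T = {t \<in> \<delta> ` {..<N}. P t}"
    by (simp add: eigenvalues_diagonal[OF G])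
  have "card {i. i < N \<and> P (\<delta> i)} = card (\<Union>t\<in>?T. {i. i < N \<and> \<delta> i = t})"
    by (rule arg_cong[of _ _ card]) (auto simp: T)
  also have "\<dots> = (\<Sum>t\<in>?T. card {i. i < N \<and> \<delta> i = t})"
    by (rule card_UN_disjoint) (auto simp: T)
  finally show ?thesis
    by (simp add: eigenvalue_multiplicity_diagonal[OF G])
qed

section \<open>Sublattices of diagonal lattices\<close>

context admissible_ring
begin

text \<open>Since \<open>p R\<close> is a maximal right ideal, the \<open>i\<close>-th coordinates of the elements of a submodule
  between \<open>p R\<^sup>J\<close> and \<open>R\<^sup>J\<close> form the ideal \<open>R\<close> or \<open>p R\<close>.  Both are principal, so one can split off
  a rank one summand.\<close>

lemma dual_basis_exists:
  fixes N :: "('j \<Rightarrow> quat) set"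
  assumes "finite J"
    and "\<And>u j. u \<in> N \<Longrightarrow> u j \<in> R" "\<And>u j. u \<in> N \<Longrightarrow> j \<notin> J \<Longrightarrow> u j = 0"
    and "\<And>u v. u \<in> N \<Longrightarrow> v \<in> N \<Longrightarrow> (\<lambda>j. u j + v j) \<in> N"
    and "\<And>u a. u \<in> N \<Longrightarrow> a \<in> R \<Longrightarrow> (\<lambda>j. u j * a) \<in> N"
    and "\<And>j. j \<in> J \<Longrightarrow> unit_vec j p \<in> N"
  shows "\<exists>S c. finite S \<and> S \<subseteq> N \<and>
     (\<forall>s\<in>S. \<forall>u\<in>N. c s u \<in> R \<and> (\<forall>v\<in>N. c s (\<lambda>j. u j + v j) = c s u + c s v) \<and>
        (\<forall>a\<in>R. c s (\<lambda>j. u j * a) = c s u * a)) \<and>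
     (\<forall>u\<in>N. u = (\<lambda>j. \<Sum>s\<in>S. s j * c s u))"
  using assms
proof (induction J arbitrary: N)
  case empty
  then have "\<forall>u\<in>N. u = (\<lambda>j. 0)"
    by auto
  then show ?case
    by (intro exI[of _ "{}"]) auto
next
  case (insert i J N)
  note N_in = insert.prems(1) and N_add = insert.prems(3) and N_mult = insert.prems(4)
  have ip: "unit_vec i p \<in> N"
    using insert.prems by auto
  have "\<exists>y\<in>N. \<exists>k. \<forall>u\<in>N. k u \<in> R \<and> y i * k u = u i \<and> y i \<noteq> 0 \<and>
      (\<forall>v\<in>N. k (\<lambda>j. u j + v j) = k u + k v) \<and> (\<forall>a\<in>R. k (\<lambda>j. u j * a) = k u * a)"
  proof (cases "\<exists>x\<in>N. \<forall>w\<in>R. x i \<noteq> p * w")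
    case True
    then obtain x where x: "x \<in> N" "\<And>w. w \<in> R \<Longrightarrow> x i \<noteq> p * w"
      by auto
    then obtain a b where ab: "a \<in> R" "b \<in> R" "x i * a + p * b = 1"
      using p_maximal[OF N_in] by metis
    \<comment> \<open>By maximality of \<open>p R\<close>, the coordinate of \<open>x\<close>
      outside \<open>p R\<close> combines with \<open>p\<close> to 1, giving an element of
      \<open>N\<close> with \<open>i\<close>-th coordinate 1.\<close>
    define y where "y = (\<lambda>j. x j * a + unit_vec i p j * b)"
    have "y \<in> N"
      unfolding y_def using x(1) ab ip by (intro N_add N_mult)
    moreover have "y i = 1"
      using ab by (simp add: y_def unit_vec_def)
    ultimately show ?thesis
      using N_in by (intro bexI[of _ y] exI[of _ "\<lambda>u. u i"]) auto
  next
    case False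
    \<comment> \<open>Here all \<open>i\<close>-th coordinates lie in \<open>p R\<close>, so
      \<open>unit_vec i p\<close> serves as \<open>y\<close>. Its coefficient is left multiplication
      by \<open>inverse p\<close>, which is compatible with scalars acting on the right.\<close>
    have "inverse p * u i \<in> R \<and> p * (inverse p * u i) = u i" if u: "u \<in> N" for u
    proof -
      obtain w where w: "w \<in> R" "u i = p * w"
        using False u by blast
      have "inverse p * u i = w"
        using p_nonzero by (simp add: w flip: mult.assoc)
      with w show ?thesis
        by simp
    qed
    then show ?thesis
      using ip p_nonzero
      by (intro bexI[of _ "unit_vec i p"] exI[of _ "\<lambda>u. inverse p * u i"])
         (auto simp: unit_vec_def algebra_simps)
  qed
  then obtain y k where y: "y \<in> N" and raw: "\<forall>u\<in>N. k u \<in> R \<and> y i * k u = u i \<and> y i \<noteq> 0 \<and>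
      (\<forall>v\<in>N. k (\<lambda>j. u j + v j) = k u + k v) \<and> (\<forall>a\<in>R. k (\<lambda>j. u j * a) = k u * a)"
    by (elim bexE exE)
  from raw have k: "\<And>u. u \<in> N \<Longrightarrow> k u \<in> R" "\<And>u. u \<in> N \<Longrightarrow> y i * k u = u i" "\<And>u. u \<in> N \<Longrightarrow> y i \<noteq> 0"
      "\<And>u v. u \<in> N \<Longrightarrow> v \<in> N \<Longrightarrow> k (\<lambda>j. u j + v j) = k u + k v"
      "\<And>u a. u \<in> N \<Longrightarrow> a \<in> R \<Longrightarrow> k (\<lambda>j. u j * a) = k u * a"
    by simp_all
  define N' where "N' = {u \<in> N. u i = 0}"
  \<comment> \<open>The projection along \<open>y\<close> onto the elements with vanishing
    \<open>i\<close>-th coordinate. The functionals found for \<open>N'\<close>, composed with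
    \<open>pr\<close>, together with \<open>k\<close> form the dual basis of
    \<open>N\<close>.\<close>
  define pr where "pr u = (\<lambda>j. u j - y j * k u)" for u
  have pr: "pr u \<in> N'" if "u \<in> N" for u
  proof -
    have "(\<lambda>j. u j + y j * (- k u)) \<in> N"
      using that y k(1) by (intro N_add N_mult uminus_in)
    then show ?thesis
      using k(2)[OF that] by (simp add: N'_def pr_def)
  qed
  have "\<exists>S c. finite S \<and> S \<subseteq> N' \<and>
     (\<forall>s\<in>S. \<forall>u\<in>N'. c s u \<in> R \<and> (\<forall>v\<in>N'. c s (\<lambda>j. u j + v j) = c s u + c s v) \<and>
        (\<forall>a\<in>R. c s (\<lambda>j. u j * a) = c s u * a)) \<and>
     (\<forall>u\<in>N'. u = (\<lambda>j. \<Sum>s\<in>S. s j * c s u))"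
  proof (rule insert.IH)
    fix u j assume "u \<in> N'" "j \<notin> J"
    then show "u j = 0"
      using insert.prems(2)[of u j] by (cases "j = i") (auto simp: N'_def)
  next
    fix j assume "j \<in> J"
    then show "unit_vec j p \<in> N'"
      using insert.prems(5)[of j] insert.hyps by (auto simp: N'_def unit_vec_def)
  qed (auto simp: N'_def N_in N_add N_mult)
  then obtain S c where S: "finite S" "S \<subseteq> N'"
    and raw: "\<forall>s\<in>S. \<forall>u\<in>N'. c s u \<in> R \<and> (\<forall>v\<in>N'. c s (\<lambda>j. u j + v j) = c s u + c s v) \<and>
        (\<forall>a\<in>R. c s (\<lambda>j. u j * a) = c s u * a)"
      "\<forall>u\<in>N'. u = (\<lambda>j. \<Sum>s\<in>S. s j * c s u)"
    by (elim exE conjE)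
  have c: "\<And>s u. s \<in> S \<Longrightarrow> u \<in> N' \<Longrightarrow> c s u \<in> R"
      "\<And>s u v. s \<in> S \<Longrightarrow> u \<in> N' \<Longrightarrow> v \<in> N' \<Longrightarrow> c s (\<lambda>j. u j + v j) = c s u + c s v"
      "\<And>s u a. s \<in> S \<Longrightarrow> u \<in> N' \<Longrightarrow> a \<in> R \<Longrightarrow> c s (\<lambda>j. u j * a) = c s u * a"
      "\<And>u. u \<in> N' \<Longrightarrow> u = (\<lambda>j. \<Sum>s\<in>S. s j * c s u)"
    using raw(1) raw(2)[THEN bspec] by simp_all
  have "y \<notin> S"
    using S k(3)[OF y] by (auto simp: N'_def)
  define c' where "c' s u = (if s = y then k u else c s (pr u))" for s u
  have pr_add: "pr (\<lambda>j. u j + v j) = (\<lambda>j. pr u j + pr v j)" if "u \<in> N" "v \<in> N" for u v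
    using that by (simp add: pr_def k algebra_simps)
  have pr_mult: "pr (\<lambda>j. u j * a) = (\<lambda>j. pr u j * a)" if "u \<in> N" "a \<in> R" for u a
    using that by (simp add: pr_def k algebra_simps)
  have "u = (\<lambda>j. \<Sum>s\<in>insert y S. s j * c' s u)" if u: "u \<in> N" for u
  proof
    fix j
    have "(\<Sum>s\<in>insert y S. s j * c' s u) = y j * k u + (\<Sum>s\<in>S. s j * c s (pr u))"
      using S(1) \<open>y \<notin> S\<close> by (auto simp: c'_def intro!: sum.cong)
    also have "(\<Sum>s\<in>S. s j * c s (pr u)) = pr u j"
      using fun_cong[OF c(4)[OF pr[OF u]], of j] by simp
    finally show "u j = (\<Sum>s\<in>insert y S. s j * c' s u)"
      by (simp add: pr_def)
  qed
  moreover have "c' s u \<in> R \<and> (\<forall>v\<in>N. c' s (\<lambda>j. u j + v j) = c' s u + c' s v) \<and>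
        (\<forall>a\<in>R. c' s (\<lambda>j. u j * a) = c' s u * a)" if "s \<in> insert y S" "u \<in> N" for s u
    using that by (auto simp: c'_def k c pr pr_add pr_mult)
  ultimately show ?case
    using S y by (intro exI[of _ "insert y S"] exI[of _ c']) (auto simp: N'_def)
qed

end

text \<open>Isolates the properties of \<open>Lq\<close> behind the lattice statements: the
  coordinates embed \<open>L\<close> between p R^J and R^J. The lower bound
  \<open>unit_in_image\<close> is the source of projectivity, of nondegeneracy and of the full rank
  of the extension.\<close>

locale diagonal_sublattice = admissible_ring R p q + L: coord_module R L f
  for R :: "quat set" and p q and L :: "('b, 'n) herm_module_scheme" and f :: "'b \<Rightarrow> 'j \<Rightarrow> quat" +
  fixes J :: "'j set" and \<epsilon> :: "'j \<Rightarrow> real"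
  assumes finite_J: "finite J"
    and \<epsilon>: "j \<in> J \<Longrightarrow> \<epsilon> j \<in> {1, -1}"
    and inj_f: "inj_on f (carrier L)"
    and f_in: "x \<in> carrier L \<Longrightarrow> f x j \<in> R"
    and f_outside: "x \<in> carrier L \<Longrightarrow> j \<notin> J \<Longrightarrow> f x j = 0"
    and unit_in_image: "j \<in> J \<Longrightarrow> \<exists>x\<in>carrier L. f x = unit_vec j p"
    and form_L: "x \<in> carrier L \<Longrightarrow> y \<in> carrier L \<Longrightarrow> form L x y = diag_form J \<epsilon> (f x) (f y)"
begin

lemma dual_basis:
  obtains S c where "finite S" "S \<subseteq> carrier L"
    "\<And>s x. s \<in> S \<Longrightarrow> x \<in> carrier L \<Longrightarrow> c s x \<in> R"
    "\<And>s x y. s \<in> S \<Longrightarrow> x \<in> carrier L \<Longrightarrow> y \<in> carrier L \<Longrightarrow> c s (x \<oplus>\<^bsub>L\<^esub> y) = c s x + c s y"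
    "\<And>s a x. s \<in> S \<Longrightarrow> x \<in> carrier L \<Longrightarrow> a \<in> R \<Longrightarrow> c s (a \<odot>\<^bsub>L\<^esub> x) = c s x * a"
    "\<And>x. x \<in> carrier L \<Longrightarrow> x = (\<Oplus>\<^bsub>L\<^esub>s\<in>S. c s x \<odot>\<^bsub>L\<^esub> s)"
proof -
  have "\<exists>S c. finite S \<and> S \<subseteq> f ` carrier L \<and>
     (\<forall>s\<in>S. \<forall>u\<in>f ` carrier L. c s u \<in> R \<and> (\<forall>v\<in>f ` carrier L. c s (\<lambda>j. u j + v j) = c s u + c s v) \<and>
        (\<forall>a\<in>R. c s (\<lambda>j. u j * a) = c s u * a)) \<and>
     (\<forall>u\<in>f ` carrier L. u = (\<lambda>j. \<Sum>s\<in>S. s j * c s u))"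
  proof (rule dual_basis_exists[OF finite_J])
    fix u v assume "u \<in> f ` carrier L" "v \<in> f ` carrier L"
    then obtain x y where xy: "x \<in> carrier L" "y \<in> carrier L" "u = f x" "v = f y"
      by auto
    then show "(\<lambda>j. u j + v j) \<in> f ` carrier L"
      by (intro image_eqI[of _ _ "x \<oplus>\<^bsub>L\<^esub> y"]) (auto simp: L.h_add)
  next
    fix u a assume "u \<in> f ` carrier L" "a \<in> R"
    then obtain x where x: "x \<in> carrier L" "u = f x"
      by auto
    then show "(\<lambda>j. u j * a) \<in> f ` carrier L"
      using \<open>a \<in> R\<close> by (intro image_eqI[of _ _ "a \<odot>\<^bsub>L\<^esub> x"]) (auto simp: L.h_smult L.MM.rsmult_closed)
  next
    fix j assume "j \<in> J"
    then show "unit_vec j p \<in> f ` carrier L"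
      using unit_in_image by (metis image_eqI)
  qed (auto simp: f_in f_outside)
  then obtain S c where S: "finite S" "S \<subseteq> f ` carrier L"
    and raw: "\<forall>s\<in>S. \<forall>u\<in>f ` carrier L. c s u \<in> R \<and>
        (\<forall>v\<in>f ` carrier L. c s (\<lambda>j. u j + v j) = c s u + c s v) \<and>
        (\<forall>a\<in>R. c s (\<lambda>j. u j * a) = c s u * a)"
      "\<forall>u\<in>f ` carrier L. u = (\<lambda>j. \<Sum>s\<in>S. s j * c s u)"
    by (elim exE conjE)
  have c: "\<And>s x. s \<in> S \<Longrightarrow> x \<in> carrier L \<Longrightarrow> c s (f x) \<in> R"
      "\<And>s x y. s \<in> S \<Longrightarrow> x \<in> carrier L \<Longrightarrow> y \<in> carrier L \<Longrightarrow>
         c s (\<lambda>j. f x j + f y j) = c s (f x) + c s (f y)"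
      "\<And>s a x. s \<in> S \<Longrightarrow> x \<in> carrier L \<Longrightarrow> a \<in> R \<Longrightarrow> c s (\<lambda>j. f x j * a) = c s (f x) * a"
      "\<And>x. x \<in> carrier L \<Longrightarrow> f x = (\<lambda>j. \<Sum>s\<in>S. s j * c s (f x))"
    using raw(1) raw(2)[THEN bspec, OF imageI] by simp_all
  \<comment> \<open>One preimage is chosen for each generator; injectivity on \<open>T\<close> turns
    sums over \<open>S\<close> into sums over \<open>T\<close>.\<close>
  obtain T where T: "T \<subseteq> carrier L" "inj_on f T" "S = f ` T"
    using S(2) by (meson subset_image_inj)
  have "finite T"
    using S(1) T by (simp add: finite_image_iff)
  define d where "d t x = c (f t) (f x)" for t x
  have d_in: "(\<lambda>t. d t x) \<in> T \<rightarrow> R" if "x \<in> carrier L" for x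
    using c(1) that T(3) by (auto simp: d_def)
  have id: "(\<lambda>t. t) \<in> T \<rightarrow> carrier L"
    using T(1) by auto
  have "x = (\<Oplus>\<^bsub>L\<^esub>t\<in>T. d t x \<odot>\<^bsub>L\<^esub> t)" if x: "x \<in> carrier L" for x
  proof -
    have "f x = (\<lambda>j. \<Sum>t\<in>T. f t j * d t x)"
      by (subst c(4)[OF x]) (simp add: T(3) sum.reindex[OF T(2)] d_def)
    then show ?thesis
      using L.h_lincomb[OF \<open>finite T\<close> d_in[OF x] id] inj_onD[OF inj_f] x by simp
  qed
  then show ?thesis
    using that[of T d] \<open>finite T\<close> T c(1-3)
    by (auto simp: d_def L.h_add L.h_smult)
qed

lemma finitely_generated_L: "finitely_generated (qring R) L"
proof -
  obtain S c where S: "finite S" "S \<subseteq> carrier L"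
    and c: "\<And>s x. s \<in> S \<Longrightarrow> x \<in> carrier L \<Longrightarrow> c s x \<in> R"
      "\<And>s x y. s \<in> S \<Longrightarrow> x \<in> carrier L \<Longrightarrow> y \<in> carrier L \<Longrightarrow> c s (x \<oplus>\<^bsub>L\<^esub> y) = c s x + c s y"
      "\<And>s a x. s \<in> S \<Longrightarrow> x \<in> carrier L \<Longrightarrow> a \<in> R \<Longrightarrow> c s (a \<odot>\<^bsub>L\<^esub> x) = c s x * a"
      "\<And>x. x \<in> carrier L \<Longrightarrow> x = (\<Oplus>\<^bsub>L\<^esub>s\<in>S. c s x \<odot>\<^bsub>L\<^esub> s)"
    by (rule dual_basis) (rule that)
  show ?thesis
    unfolding finitely_generated_def
  proof (intro exI[of _ S] conjI ballI S)
    fix x assume x: "x \<in> carrier L"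
    show "\<exists>d\<in>S \<rightarrow> carrier (qring R). x = (\<Oplus>\<^bsub>L\<^esub>s\<in>S. d s \<odot>\<^bsub>L\<^esub> s)"
      using c(4)[OF x] by (rule bexI[of _ "\<lambda>s. c s x"]) (use c(1) x in auto)
  qed
qed

text \<open>The dual basis makes \<open>L\<close> a retract of the free module on \<open>S\<close>:
  \<open>F\<close> collects the coefficient functionals and \<open>G\<close> evaluates a linear
  combination. The index set \<open>S\<close> consists of elements of \<open>L\<close>, as the type
  in \<open>projective\<close> demands.\<close>

lemma projective_L: "projective R L"
proof -
  obtain S c where S: "finite S" "S \<subseteq> carrier L"
    and c: "\<And>s x. s \<in> S \<Longrightarrow> x \<in> carrier L \<Longrightarrow> c s x \<in> R"
      "\<And>s x y. s \<in> S \<Longrightarrow> x \<in> carrier L \<Longrightarrow> y \<in> carrier L \<Longrightarrow> c s (x \<oplus>\<^bsub>L\<^esub> y) = c s x + c s y"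
      "\<And>s a x. s \<in> S \<Longrightarrow> x \<in> carrier L \<Longrightarrow> a \<in> R \<Longrightarrow> c s (a \<odot>\<^bsub>L\<^esub> x) = c s x * a"
      "\<And>x. x \<in> carrier L \<Longrightarrow> x = (\<Oplus>\<^bsub>L\<^esub>s\<in>S. c s x \<odot>\<^bsub>L\<^esub> s)"
    by (rule dual_basis) (rule that)
  define F where "F x = (\<lambda>s. if s \<in> S then c s x else 0)" for x
  define G where "G v = (\<Oplus>\<^bsub>L\<^esub>s\<in>S. v s \<odot>\<^bsub>L\<^esub> s)" for v
  have fin: "finite {i. v i \<noteq> 0}" if "\<forall>i. i \<notin> S \<longrightarrow> v i = (0::quat)" for v
    using S(1) by (rule finite_subset[rotated]) (use that in auto)
  have F: "F \<in> right_module_hom (qring R) L (free_module R S)"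
    unfolding right_module_hom_def
    by (auto simp: F_def carrier_free_module fin c zero_in)
  have G_closed: "G v \<in> carrier L" "f (G v) = (\<lambda>j. \<Sum>s\<in>S. f s j * v s)"
    if "v \<in> carrier (free_module R S)" for v
    unfolding G_def using L.h_lincomb[OF S(1), of v "\<lambda>s. s"] that S(2)
    by (auto simp: carrier_free_module)
  interpret FM: right_module "qring R" "free_module R S"
    by (rule right_module_free_module[OF star_ring_axioms])
  have "G (\<lambda>i. v i + w i) = G v \<oplus>\<^bsub>L\<^esub> G w"
    if "v \<in> carrier (free_module R S)" "w \<in> carrier (free_module R S)" for v w
  proof -
    have vw: "(\<lambda>i. v i + w i) \<in> carrier (free_module R S)"
      using FM.M.a_closed[OF that] by simp
    have "f (G (\<lambda>i. v i + w i)) = f (G v \<oplus>\<^bsub>L\<^esub> G w)"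
      using that vw by (simp add: G_closed L.h_add algebra_simps sum.distrib)
    then show ?thesis
      using inj_f that vw by (auto simp: inj_on_def G_closed)
  qed
  moreover have "G (\<lambda>i. v i * a) = a \<odot>\<^bsub>L\<^esub> G v"
    if "v \<in> carrier (free_module R S)" "a \<in> R" for v a
  proof -
    have va: "(\<lambda>i. v i * a) \<in> carrier (free_module R S)"
      using FM.rsmult_closed[of a v] that by simp
    have "f (G (\<lambda>i. v i * a)) = f (a \<odot>\<^bsub>L\<^esub> G v)"
      using that va by (simp add: G_closed L.h_smult sum_distrib_right mult.assoc)
    then show ?thesis
      using inj_f that va by (auto simp: inj_on_def G_closed L.MM.rsmult_closed)
  qed
  ultimately have G: "G \<in> right_module_hom (qring R) (free_module R S) L"
    by (auto simp: right_module_hom_def G_closed)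
  have "G (F x) = x" if "x \<in> carrier L" for x
  proof -
    have "G (F x) = (\<Oplus>\<^bsub>L\<^esub>s\<in>S. c s x \<odot>\<^bsub>L\<^esub> s)"
      unfolding G_def using c(1) that S(2)
      by (intro L.MM.M.finsum_cong') (auto simp: F_def intro!: L.MM.rsmult_closed)
    then show ?thesis
      using c(4)[OF that] by simp
  qed
  with F G show ?thesis
    unfolding projective_def by blast
qed

lemma hermitian_form_L: "hermitian_form R L"
  unfolding hermitian_form_def
proof (intro conjI ballI)
  fix x y assume xy: "x \<in> carrier L" "y \<in> carrier L"
  have "\<epsilon> j *\<^sub>R z \<in> R" if "j \<in> J" "z \<in> R" for j z
    using \<epsilon>[OF that(1)] that(2) by (auto intro: uminus_in)
  then have "(\<Sum>j\<in>J. \<epsilon> j *\<^sub>R (qcnj (f x j) * f y j)) \<in> R"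
    using f_in[OF xy(1)] f_in[OF xy(2)] by (intro sum_in) (blast intro: mult_in qcnj_in)
  then show "form L x y \<in> R"
    using xy by (simp add: form_L diag_form_def)
  show "form L y x = qcnj (form L x y)"
    using xy by (simp add: form_L qcnj_diag_form)
qed (simp_all add: form_L L.h_add L.h_smult diag_form_add_right diag_form_mult_right L.MM.rsmult_closed)

text \<open>Pairing with the element whose coordinates are \<open>unit_vec j p\<close> isolates the
  \<open>j\<close>-th coordinate up to sign and the nonzero left factor
  \<open>qcnj p\<close>.\<close>

lemma Rad_L: "Rad L = {\<zero>\<^bsub>L\<^esub>}"
proof -
  have "x = \<zero>\<^bsub>L\<^esub>" if x: "x \<in> carrier L" and orth: "\<And>y. y \<in> carrier L \<Longrightarrow> form L y x = 0" for x
  proof -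
    have "f x j = 0" for j
    proof (cases "j \<in> J")
      case True
      then obtain y where y: "y \<in> carrier L" "f y = unit_vec j p"
        using unit_in_image by blast
      then have "\<epsilon> j *\<^sub>R (qcnj p * f x j) = 0"
        using orth[OF y(1)] x True finite_J by (simp add: form_L diag_form_unit_left)
      then show ?thesis
        using \<epsilon>[OF True] p_nonzero by auto
    qed (simp add: f_outside x)
    then have "f x = f \<zero>\<^bsub>L\<^esub>"
      by (simp add: L.h_zero fun_eq_iff)
    then show ?thesis
      using inj_f x by (auto simp: inj_on_def)
  qed
  moreover have "form L y \<zero>\<^bsub>L\<^esub> = 0" if "y \<in> carrier L" for y
    using that by (simp add: form_L L.h_zero diag_form_def)
  ultimately show ?thesis
    by (auto simp: Rad_def)
qed

lemma hermitian_lattice_L: "hermitian_lattice R L"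
  unfolding hermitian_lattice_def
  using L.MM.right_module_axioms finitely_generated_L projective_L hermitian_form_L Rad_L by simp

sublocale ext: kernel_quotient "Frac R" "free_herm (Frac R) (carrier L) (form L)" "lincomb f"
    "tensor_kernel R L" "diag_form J \<epsilon>"
  by (rule kernel_quotient_extend_scalars[OF L.coord_module_axioms inj_f form_L])

lemma extend_scalars_eq: "extend_scalars R L = ext.Q"
  by (simp add: extend_scalars_def)

lemma unit_vec_in_free: "x \<in> carrier L \<Longrightarrow> a \<in> Frac R \<Longrightarrow>
    unit_vec x a \<in> carrier (free_herm (Frac R) (carrier L) (form L))"
  by (simp add: ext.unit_vec_in)

text \<open>Over \<open>Frac R\<close> the vectors \<open>unit_vec j p\<close> can be divided by
  \<open>p\<close>, so the coordinates fill the whole space although \<open>L\<close> itself need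
  not contain the unit vectors.\<close>

lemma ext_coord_image:
  "ext.coord ` carrier ext.Q = {u. (\<forall>j\<in>J. u j \<in> Frac R) \<and> (\<forall>j. j \<notin> J \<longrightarrow> u j = 0)}"
  unfolding ext.coord_image
proof (intro equalityI subsetI)
  fix u assume "u \<in> lincomb f ` carrier (free_herm (Frac R) (carrier L) (form L))"
  then obtain v where v: "u = lincomb f v" "\<And>i. v i \<in> Frac R" "\<And>i. i \<notin> carrier L \<Longrightarrow> v i = 0"
    by (auto simp: carrier_free_module)
  have "i \<in> carrier L" if "v i \<noteq> 0" for i
    using v(3) that by blast
  then show "u \<in> {u. (\<forall>j\<in>J. u j \<in> Frac R) \<and> (\<forall>j. j \<notin> J \<longrightarrow> u j = 0)}"
    using v(1,2) subset_Frac
    by (auto simp: lincomb_def f_outside f_in intro!: ext.sum_in ext.mult_in)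
next
  fix u assume u: "u \<in> {u. (\<forall>j\<in>J. u j \<in> Frac R) \<and> (\<forall>j. j \<notin> J \<longrightarrow> u j = 0)}"
  obtain x where x: "\<And>j. j \<in> J \<Longrightarrow> x j \<in> carrier L" "\<And>j. j \<in> J \<Longrightarrow> f (x j) = unit_vec j p"
    using unit_in_image by metis
  have "inj_on x J"
  proof (rule inj_onI)
    fix i j assume "i \<in> J" "j \<in> J" "x i = x j"
    then have "unit_vec i p = unit_vec j p"
      using x(2) by metis
    then show "i = j"
      using p_nonzero by (metis unit_vec_def)
  qed
  \<comment> \<open>The sum of the tensors of \<open>x j\<close> and \<open>inverse p * u j\<close>;
    injectivity of \<open>x\<close> lets \<open>inv_into\<close> recover \<open>j\<close>.\<close>
  define v where "v = (\<lambda>z. if z \<in> x ` J then inverse p * u (inv_into J x z) else 0)"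
  have "finite {z. v z \<noteq> 0}"
    by (rule finite_subset[of _ "x ` J"]) (auto simp: v_def finite_J)
  moreover have "v z \<in> Frac R" for z
    using u \<open>inj_on x J\<close> inverse_in_Frac[OF p_in]
    by (auto simp: v_def ext.zero_in intro!: ext.mult_in)
  ultimately have "v \<in> carrier (free_herm (Frac R) (carrier L) (form L))"
    using x(1) by (auto simp: carrier_free_module v_def)
  moreover have "lincomb f v = u"
  proof -
    have "lincomb f v = (\<lambda>j. \<Sum>z\<in>x ` J. f z j * v z)"
      by (intro lincomb_superset) (auto simp: v_def finite_J)
    also have "\<dots> = (\<lambda>j. \<Sum>i\<in>J. f (x i) j * v (x i))"
      by (simp add: sum.reindex[OF \<open>inj_on x J\<close>])
    also have "\<dots> = (\<lambda>j. \<Sum>i\<in>J. if j = i then u i else 0)"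
      using x(2) \<open>inj_on x J\<close> p_nonzero
      by (intro ext sum.cong) (auto simp: unit_vec_def v_def simp flip: mult.assoc)
    also have "\<dots> = u"
      using u finite_J by auto
    finally show ?thesis .
  qed
  ultimately show "u \<in> lincomb f ` carrier (free_herm (Frac R) (carrier L) (form L))"
    by blast
qed

text \<open>The signature is read off in the basis with unit vectors as coordinates, where the Gram
  matrix is diagonal with the signs \<epsilon> as entries.\<close>

lemma has_signature_L: "has_signature R L (card {j \<in> J. \<epsilon> j = 1}) (card {j \<in> J. \<epsilon> j = -1})"
proof -
  interpret E: coord_module "Frac R" ext.Q ext.coord
    by (rule ext.coord_module_Q)
  obtain \<sigma> where \<sigma>: "bij_betw \<sigma> {..<card J} J"
    using ex_bij_betw_nat_finite[OF finite_J] by (auto simp: atLeast0LessThan)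
  obtain b where b: "is_basis (qring (Frac R)) ext.Q (card J) b"
    "\<And>i. i < card J \<Longrightarrow> ext.coord (b i) = unit_vec (\<sigma> i) 1"
    using E.standard_basis[OF ext.inj_coord ext_coord_image \<sigma>] by blast
  define G where "G = (\<lambda>i j. form ext.Q (b i) (b j))"
  have G: "G i j = (if i = j then of_real (\<epsilon> (\<sigma> i)) else 0)" if "i < card J" "j < card J" for i j
  proof -
    have "\<sigma> i \<in> J" "\<sigma> i = \<sigma> j \<longleftrightarrow> i = j"
      using \<sigma> that by (auto simp: bij_betw_def inj_on_def)
    moreover have "b i \<in> carrier ext.Q" "b j \<in> carrier ext.Q"
      using b(1) that by (auto simp: is_basis_def)
    ultimately show ?thesis
      using that finite_J
      by (simp add: G_def ext.form_coord b(2) diag_form_unit_left) (simp add: unit_vec_def of_real_def)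
  qed
  have card: "card {i. i < card J \<and> P (\<epsilon> (\<sigma> i))} = card {j \<in> J. P (\<epsilon> j)}" for P
  proof -
    have "{j \<in> J. P (\<epsilon> j)} = \<sigma> ` {i. i < card J \<and> P (\<epsilon> (\<sigma> i))}"
      using \<sigma> by (auto simp: bij_betw_def)
    moreover have "inj_on \<sigma> {i. i < card J \<and> P (\<epsilon> (\<sigma> i))}"
      using \<sigma> by (auto simp: bij_betw_def inj_on_def)
    ultimately show ?thesis
      by (simp add: card_image)
  qed
  have pos: "{j \<in> J. \<epsilon> j > 0} = {j \<in> J. \<epsilon> j = 1}" and neg: "{j \<in> J. \<epsilon> j < 0} = {j \<in> J. \<epsilon> j = -1}"
    using \<epsilon> by fastforce+
  have sig: "(\<Sum>t | t \<in> eigenvalues (card J) G \<and> P t. eigenvalue_multiplicity (card J) G t)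
      = card {j \<in> J. P (\<epsilon> j)}" for P
    unfolding card[symmetric] by (rule signature_diagonal) (rule G)
  have "(\<Sum>t | t \<in> eigenvalues (card J) G \<and> t > 0. eigenvalue_multiplicity (card J) G t)
      = card {j \<in> J. \<epsilon> j = 1}"
    "(\<Sum>t | t \<in> eigenvalues (card J) G \<and> t < 0. eigenvalue_multiplicity (card J) G t)
      = card {j \<in> J. \<epsilon> j = -1}"
    unfolding sig pos neg by (rule refl)+
  then show ?thesis
    unfolding has_signature_def extend_scalars_eq Let_def using b(1) unfolding G_def by blast
qed

text \<open>The witness is the tensor of \<open>x\<close> and \<open>inverse p\<close>. Its pairing
  with \<open>y\<close> is \<open>form L y x * inverse p\<close>, which is why divisibility is
  required with \<open>p\<close> as a right factor.\<close>

lemma subset_p_dual: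
  assumes div: "\<And>x y. x \<in> carrier L \<Longrightarrow> y \<in> carrier L \<Longrightarrow> \<exists>w\<in>R. form L x y = w * p"
  shows "to_extension R L ` carrier L \<subseteq> (\<lambda>t. p \<odot>\<^bsub>extend_scalars R L\<^esub> t) ` dual_lattice R L"
proof (rule image_subsetI)
  have to_ext: "to_extension R L x = ext.cls (unit_vec x 1)" for x
    by (simp add: to_extension_def ext.cls_def a_r_coset_def')
  fix x assume x: "x \<in> carrier L"
  have ip: "inverse p \<in> Frac R"
    using p_in by (rule inverse_in_Frac)
  define t where "t = ext.cls (unit_vec x (inverse p))"
  have t: "t \<in> carrier ext.Q"
    unfolding t_def ext.carrier_Q using x ip by (intro imageI unit_vec_in_free)
  have "form ext.Q (to_extension R L y) t \<in> R" if y: "y \<in> carrier L" for y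
  proof -
    have "form ext.Q (to_extension R L y) t = diag_form J \<epsilon> (f y) (\<lambda>j. f x j * inverse p)"
      unfolding to_ext t_def using x y ip
      by (subst ext.form_Q) (auto simp: lincomb_unit_vec unit_vec_in_free ext.one_in
          simp del: free_herm_simps)
    also have "\<dots> = form L y x * inverse p"
      using x y by (simp add: diag_form_mult_right form_L)
    finally show ?thesis
      using div[OF y x] p_nonzero by (auto simp: mult.assoc)
  qed
  then have "t \<in> dual_lattice R L"
    using t by (simp add: dual_lattice_def extend_scalars_eq)
  moreover have "to_extension R L x = p \<odot>\<^bsub>extend_scalars R L\<^esub> t"
  proof -
    have "p \<odot>\<^bsub>ext.Q\<^esub> t = ext.cls (p \<odot>\<^bsub>free_herm (Frac R) (carrier L) (form L)\<^esub> unit_vec x (inverse p))"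
      unfolding t_def using p_in subset_Frac x ip by (intro ext.smult_Q unit_vec_in_free) auto
    also have "p \<odot>\<^bsub>free_herm (Frac R) (carrier L) (form L)\<^esub> unit_vec x (inverse p) = unit_vec x 1"
      using p_nonzero by (auto simp: unit_vec_def)
    finally show ?thesis
      by (simp add: to_ext extend_scalars_eq)
  qed
  ultimately show "to_extension R L x \<in> (\<lambda>t. p \<odot>\<^bsub>extend_scalars R L\<^esub> t) ` dual_lattice R L"
    by blast
qed

end

section \<open>Admissible triples\<close>

subsection \<open>Imaginary quadratic integers\<close>

lemma poly_of_int_add:
  "poly (map_poly of_int (P + Q)) (z::'a::comm_ring_1) = poly (map_poly of_int P) z + poly (map_poly of_int Q) z"
  by (induction P Q rule: poly_induct2) (simp_all add: map_poly_pCons algebra_simps)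

lemma poly_of_int_smult:
  "poly (map_poly of_int (Polynomial.smult c P)) (z::'a::comm_ring_1) = of_int c * poly (map_poly of_int P) z"
  by (induction P) (simp_all add: map_poly_pCons algebra_simps)

lemma poly_of_int_mult:
  "poly (map_poly of_int (P * Q)) (z::'a::comm_ring_1) = poly (map_poly of_int P) z * poly (map_poly of_int Q) z"
  by (induction P) (simp_all add: map_poly_pCons poly_of_int_add poly_of_int_smult algebra_simps)

text \<open>The Gauss lemma, for a polynomial of degree 2 vanishing at a non-real algebraic integer.\<close>

lemma primitive_quadratic_lead_unit:
  fixes F :: "int poly" and z :: complex
  assumes z: "algebraic_int z" "Im z \<noteq> 0"
    and F: "Polynomial.degree F = 2" "content F = 1" "poly (map_poly of_int F) z = 0"
  shows "\<bar>Polynomial.lead_coeff F\<bar> = 1"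
proof -
  obtain P where P: "poly (map_poly of_int P) z = 0" "Polynomial.lead_coeff P = (1::int)"
    using z(1) by (auto simp: algebraic_int_altdef_ipoly)
  have "F \<noteq> 0"
    using F(1) by auto
  \<comment> \<open>Pseudo-division keeps the quotient and the remainder integral, at the price of
    the multiplier \<open>a\<close>.\<close>
  define r where "r = pseudo_mod P F"
  obtain a Q where aQ: "a \<noteq> 0" "Polynomial.smult a P = F * Q + r" and deg_r: "r = 0 \<or> Polynomial.degree r < 2"
    using pseudo_mod[OF \<open>F \<noteq> 0\<close>, of P] F(1) by (auto simp: r_def)
  have "poly (map_poly of_int (Polynomial.smult a P)) z = poly (map_poly of_int (F * Q + r)) z"
    by (simp add: aQ)
  then have rz: "poly (map_poly of_int r) z = 0"
    by (simp add: poly_of_int_smult poly_of_int_add poly_of_int_mult P F)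
  \<comment> \<open>An integral polynomial of degree at most 1 with a non-real root
    vanishes.\<close>
  have "r = 0"
  proof -
    have "Polynomial.degree r \<le> 1"
      using deg_r by auto
    then have uv: "r = [:Polynomial.coeff r 0, Polynomial.coeff r 1:]" (is "r = [:?u, ?v:]")
      by (intro poly_eqI) (auto simp: coeff_pCons coeff_eq_0 split: nat.splits)
    have "poly (map_poly of_int [:?u, ?v:]) z = 0"
      using rz uv by metis
    then have eq: "of_int ?u + z * of_int ?v = 0"
      by (simp add: map_poly_pCons)
    then have "?v = 0"
      using z(2) by (auto simp: complex_eq_iff)
    moreover from this eq have "?u = 0"
      by simp
    ultimately show ?thesis
      by (subst uv) simp
  qed
  then have FQ: "Polynomial.smult a P = F * Q"
    using aQ by simp
  have "content P dvd 1"
    using content_dvd_coeff[of P "Polynomial.degree P"] P(2) by simp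
  then have "content P = 1"
    using is_unit_content_iff by blast
  \<comment> \<open>Contents are multiplicative and both \<open>P\<close> and \<open>F\<close> are
    primitive. So \<open>a\<close> is, up to sign, the content of \<open>Q\<close> and divides its
    leading coefficient; comparing leading coefficients leaves a unit for \<open>F\<close>.\<close>
  then have "content Q = \<bar>a\<bar>"
    using arg_cong[OF FQ, of content] F(2) by (simp add: content_mult)
  then have "a dvd Polynomial.lead_coeff Q"
    using content_dvd_coeff[of Q "Polynomial.degree Q"] by simp
  moreover have "a = Polynomial.lead_coeff F * Polynomial.lead_coeff Q"
    using arg_cong[OF FQ, of Polynomial.lead_coeff] P(2) aQ(1) by (simp add: lead_coeff_mult)
  ultimately have "a * Polynomial.lead_coeff F dvd a * 1"
    by (metis dvd_triv_left mult.commute mult.right_neutral mult_dvd_mono dvd_refl mult_cancel_left)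
  then show ?thesis
    using aQ(1) by simp
qed

lemma of_rat_complex: "of_rat c = complex_of_real (of_rat c)"
  by (cases c) (simp add: of_rat_rat)

text \<open>Twice the real part and the squared absolute value are the coefficients of a monic
  quadratic polynomial with root \<open>z\<close>, which settles one direction. Conversely, for
  non-real \<open>z\<close> the primitive integral multiple of this polynomial has leading
  coefficient 1 or -1, and a real element of the field is rational.\<close>

lemma quadratic_integer_iff:
  assumes z: "z \<in> imag_quadratic_field d"
  shows "algebraic_int z \<longleftrightarrow> 2 * Re z \<in> \<int> \<and> (Re z)\<^sup>2 + (Im z)\<^sup>2 \<in> \<int>"
proof
  assume "2 * Re z \<in> \<int> \<and> (Re z)\<^sup>2 + (Im z)\<^sup>2 \<in> \<int>"
  then obtain t n where tn: "2 * Re z = of_int t" "(Re z)\<^sup>2 + (Im z)\<^sup>2 = of_int n"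
    by (auto elim!: Ints_cases)
  have "poly [:of_int n, - of_int t, 1:] z = 0"
    by (simp add: complex_eq_iff tn[symmetric] algebra_simps power2_eq_square)
  moreover have "\<forall>i. Polynomial.coeff [:of_int n, - of_int t, 1 :: complex:] i \<in> \<int>"
    by (auto simp: coeff_pCons split: nat.splits)
  ultimately show "algebraic_int z"
    by (intro algebraic_int.intros[of "[:of_int n, - of_int t, 1:]"]) auto
next
  assume alg: "algebraic_int z"
  obtain a b where ab: "z = of_rat a + of_rat b * (\<i> * of_real (sqrt (real d)))"
    using z by (auto simp: imag_quadratic_field_def)
  have Re: "Re z = of_rat a" and Im: "Im z = of_rat b * sqrt d"
    by (simp_all add: ab of_rat_complex)
  show "2 * Re z \<in> \<int> \<and> (Re z)\<^sup>2 + (Im z)\<^sup>2 \<in> \<int>"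
  proof (cases "Im z = 0")
    case True
    then have "z = of_rat a"
      using Re by (simp add: complex_eq_iff of_rat_complex)
    then have "z \<in> \<rat>"
      by simp
    with alg have "z \<in> \<int>"
      by (rule rational_algebraic_int_is_int)
    then show ?thesis
      by (auto elim!: Ints_cases)
  next
    case False
    define n where "n = a\<^sup>2 + b\<^sup>2 * of_nat d"
    have n: "(Re z)\<^sup>2 + (Im z)\<^sup>2 = of_rat n"
      by (simp add: Re Im n_def power_mult_distrib of_rat_add of_rat_mult of_rat_power)
    obtain t1 t2 where t: "2 * a = of_int t1 / of_int t2" "t2 > 0"
      by (metis quotient_of_div quotient_of_denom_pos surj_pair)
    obtain n1 n2 where n': "n = of_int n1 / of_int n2" "n2 > 0"
      by (metis quotient_of_div quotient_of_denom_pos surj_pair)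
    \<comment> \<open>The quadratic polynomial with the denominators of trace and norm
      cleared.\<close>
    define F0 where "F0 = [:n1 * t2, - t1 * n2, t2 * n2:]"
    have Re': "2 * Re z = of_int t1 / of_int t2"
      using arg_cong[OF t(1), of "of_rat :: rat \<Rightarrow> real"] by (simp add: Re of_rat_mult of_rat_divide)
    have n'': "(Re z)\<^sup>2 + (Im z)\<^sup>2 = of_int n1 / of_int n2"
      using n by (simp add: n' of_rat_divide)
    have "poly (map_poly of_int F0) z = of_int (t2 * n2) * (of_real ((Re z)\<^sup>2 + (Im z)\<^sup>2) - of_real (2 * Re z) * z + z * z)"
      using t(2) n'(2) unfolding Re' n'' by (simp add: F0_def map_poly_pCons field_simps)
    also have "of_real ((Re z)\<^sup>2 + (Im z)\<^sup>2) - of_real (2 * Re z) * z + z * z = 0"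
      by (auto simp: complex_eq_iff algebra_simps power2_eq_square)
    finally have F0: "poly (map_poly of_int F0) z = 0"
      by simp
    have "F0 \<noteq> 0" "Polynomial.degree F0 = 2"
      using t(2) n'(2) by (auto simp: F0_def)
    define F where "F = primitive_part F0"
    have F: "content F = 1" "F0 = Polynomial.smult (content F0) F"
      using \<open>F0 \<noteq> 0\<close> by (auto simp: F_def)
    have "content F0 \<noteq> 0"
      using \<open>F0 \<noteq> 0\<close> by simp
    have Fz: "poly (map_poly of_int F) z = 0"
      using F0 \<open>content F0 \<noteq> 0\<close> by (subst (asm) F(2)) (simp add: poly_of_int_smult)
    have deg: "Polynomial.degree F = 2"
      using \<open>Polynomial.degree F0 = 2\<close> \<open>content F0 \<noteq> 0\<close> by (subst (asm) F(2)) simp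
    obtain \<gamma> \<beta> \<alpha> where F_coeffs: "F = [:\<gamma>, \<beta>, \<alpha>:]"
    proof -
      have "F = [:Polynomial.coeff F 0, Polynomial.coeff F 1, Polynomial.coeff F 2:]"
      proof (rule poly_eqI)
        fix k
        show "Polynomial.coeff F k = Polynomial.coeff [:Polynomial.coeff F 0, Polynomial.coeff F 1, Polynomial.coeff F 2:] k"
          using deg by (cases "k > 2")
            (auto simp: coeff_pCons coeff_eq_0 numeral_2_eq_2 less_Suc_eq split: nat.splits)
      qed
      then show ?thesis
        by (rule that)
    qed
    have "\<bar>\<alpha>\<bar> = 1"
      using primitive_quadratic_lead_unit[OF alg False deg F(1) Fz] deg
      by (auto simp: F_coeffs numeral_2_eq_2 split: if_splits)
    then have "\<alpha> = 1 \<or> \<alpha> = -1"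
      by auto
    from Fz have eq: "of_int \<gamma> + z * (of_int \<beta> + z * of_int \<alpha>) = 0"
      by (simp add: F_coeffs map_poly_pCons)
    then have "Im z * (of_int \<beta> + 2 * Re z * of_int \<alpha>) = 0"
      by (simp add: complex_eq_iff algebra_simps)
    then have eq1: "of_int \<beta> + 2 * Re z * of_int \<alpha> = 0"
      using False by simp
    have eq2: "of_int \<gamma> + Re z * (of_int \<beta> + Re z * of_int \<alpha>) - Im z * (Im z * of_int \<alpha>) = 0"
      using eq by (simp add: complex_eq_iff algebra_simps)
    have "2 * Re z = of_int (- \<beta> * \<alpha>)"
      using eq1 \<open>\<alpha> = 1 \<or> \<alpha> = -1\<close> by auto
    moreover have "(Re z)\<^sup>2 + (Im z)\<^sup>2 = of_int (\<gamma> * \<alpha>)"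
    proof -
      have b: "of_int \<beta> = - (2 * Re z * of_int \<alpha>)"
        using eq1 by simp
      show ?thesis
        using eq2 \<open>\<alpha> = 1 \<or> \<alpha> = -1\<close> unfolding b by (auto simp: power2_eq_square algebra_simps)
    qed
    ultimately show ?thesis
      by (metis Ints_of_int)
  qed
qed

lemma imag_quadratic_field_iff:
  "z \<in> imag_quadratic_field d \<longleftrightarrow> (\<exists>a b. Re z = of_rat a \<and> Im z = of_rat b * sqrt (real d))"
  unfolding imag_quadratic_field_def by (auto simp: complex_eq_iff of_rat_complex)

definition quadratic_integers :: "nat \<Rightarrow> complex set" where
  "quadratic_integers d = ring_of_integers (imag_quadratic_field d)"

lemma quadratic_integers_iff:
  "z \<in> quadratic_integers d \<longleftrightarrow>
     (\<exists>a b. Re z = of_rat a \<and> Im z = of_rat b * sqrt (real d)) \<and>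
     2 * Re z \<in> \<int> \<and> (Re z)\<^sup>2 + (Im z)\<^sup>2 \<in> \<int>"
  using quadratic_integer_iff imag_quadratic_field_iff
  unfolding quadratic_integers_def ring_of_integers_def by blast

text \<open>Writing \<open>A, B\<close> for the traces and \<open>Y = 4 Im z Im w\<close>, one has \<open>Y\<^sup>2 \<equiv> (A B)\<^sup>2\<close> modulo 4.\<close>

lemma quadratic_integers_trace_mult:
  assumes "z \<in> quadratic_integers d" "w \<in> quadratic_integers d"
  shows "2 * (Re z * Re w + Im z * Im w) \<in> \<int>" "2 * (Re z * Re w - Im z * Im w) \<in> \<int>"
proof -
  obtain b b' where b: "Im z = of_rat b * sqrt (real d)" "Im w = of_rat b' * sqrt (real d)"
    using assms by (auto simp: quadratic_integers_iff)
  obtain A B M N where AB: "2 * Re z = of_int A" "2 * Re w = of_int B"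
    and MN: "(Re z)\<^sup>2 + (Im z)\<^sup>2 = of_int M" "(Re w)\<^sup>2 + (Im w)\<^sup>2 = of_int N"
    using assms by (auto simp: quadratic_integers_iff elim!: Ints_cases)
  have sq: "(2 * Im z)\<^sup>2 = of_int (4 * M - A\<^sup>2)" "(2 * Im w)\<^sup>2 = of_int (4 * N - B\<^sup>2)"
    using MN by (simp_all add: power_mult_distrib flip: AB)
  define x where "x = 4 * Im z * Im w"
  have x2: "x\<^sup>2 = of_int ((4 * M - A\<^sup>2) * (4 * N - B\<^sup>2))"
    unfolding of_int_mult sq[symmetric] x_def by (simp add: power2_eq_square)
  \<comment> \<open>The two square roots multiply to the integer \<open>d\<close>, so
    \<open>x\<close> is rational; its square being an integer, \<open>x\<close> is one too.\<close>
  have "x = of_rat (4 * b * b' * of_nat d)"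
    by (simp add: x_def b of_rat_mult)
  then have "x \<in> \<rat>"
    by simp
  moreover have "algebraic_int x"
  proof (rule algebraic_int.intros[of "[:- of_int ((4 * M - A\<^sup>2) * (4 * N - B\<^sup>2)), 0, 1:]"])
    show "\<forall>i. Polynomial.coeff [:- of_int ((4 * M - A\<^sup>2) * (4 * N - B\<^sup>2)), 0, 1 :: real:] i \<in> \<int>"
      by (auto simp: coeff_pCons split: nat.splits)
    show "poly [:- of_int ((4 * M - A\<^sup>2) * (4 * N - B\<^sup>2)), 0, 1:] x = 0"
      unfolding x2[symmetric] by (simp add: power2_eq_square)
  qed auto
  ultimately have "x \<in> \<int>"
    using rational_algebraic_int_is_int by blast
  then obtain Y where Y: "x = of_int Y"
    by (auto elim: Ints_cases)
  have "Y\<^sup>2 = (4 * M - A\<^sup>2) * (4 * N - B\<^sup>2)"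
    using x2 unfolding Y by (metis of_int_eq_iff of_int_power)
  also have "\<dots> = 2 * (8 * M * N - 2 * M * B\<^sup>2 - 2 * N * A\<^sup>2) + (A * B)\<^sup>2"
    by (simp add: algebra_simps power_mult_distrib)
  finally have "even (Y\<^sup>2) \<longleftrightarrow> even ((A * B)\<^sup>2)"
    by simp
  then have "even (A * B + Y)" "even (A * B - Y)"
    by (auto simp: power2_eq_square)
  then obtain k l where kl: "A * B + Y = 2 * k" "A * B - Y = 2 * l"
    unfolding dvd_def by blast
  have "2 * (2 * (Re z * Re w + Im z * Im w)) = of_int (A * B + Y)"
    "2 * (2 * (Re z * Re w - Im z * Im w)) = of_int (A * B - Y)"
    unfolding of_int_add of_int_diff of_int_mult AB[symmetric] Y[symmetric] x_def
    by (simp_all add: algebra_simps)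
  then have "2 * (Re z * Re w + Im z * Im w) = of_int k" "2 * (Re z * Re w - Im z * Im w) = of_int l"
    unfolding kl by simp_all
  then show "2 * (Re z * Re w + Im z * Im w) \<in> \<int>" "2 * (Re z * Re w - Im z * Im w) \<in> \<int>"
    by (metis Ints_of_int)+
qed

text \<open>In the trace and norm criterion the only new term is the mixed one in the norm of a sum,
  namely the trace of \<open>z * cnj w\<close>.\<close>

lemma quadratic_integers_add:
  assumes z: "z \<in> quadratic_integers d" and w: "w \<in> quadratic_integers d"
  shows "z + w \<in> quadratic_integers d"
proof -
  obtain a b a' b' where ab: "Re z = of_rat a" "Im z = of_rat b * sqrt (real d)"
    "Re w = of_rat a'" "Im w = of_rat b' * sqrt (real d)"
    using z w by (auto simp: quadratic_integers_iff)
  have "Re (z + w) = of_rat (a + a')" "Im (z + w) = of_rat (b + b') * sqrt (real d)"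
    by (simp_all add: ab of_rat_add algebra_simps)
  moreover have "2 * Re z + 2 * Re w \<in> \<int>"
    using z w by (intro Ints_add) (auto simp: quadratic_integers_iff)
  then have "2 * Re (z + w) \<in> \<int>"
    by (simp add: algebra_simps)
  moreover have "((Re z)\<^sup>2 + (Im z)\<^sup>2) + ((Re w)\<^sup>2 + (Im w)\<^sup>2) + 2 * (Re z * Re w + Im z * Im w) \<in> \<int>"
    using z w quadratic_integers_trace_mult[OF z w] unfolding quadratic_integers_iff
    by (blast intro: Ints_add)
  then have "(Re (z + w))\<^sup>2 + (Im (z + w))\<^sup>2 \<in> \<int>"
    by (simp add: algebra_simps power2_eq_square)
  ultimately show ?thesis
    unfolding quadratic_integers_iff by blast
qed

lemma quadratic_integers_mult:
  assumes z: "z \<in> quadratic_integers d" and w: "w \<in> quadratic_integers d"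
  shows "z * w \<in> quadratic_integers d"
proof -
  obtain a b a' b' where ab: "Re z = of_rat a" "Im z = of_rat b * sqrt (real d)"
    "Re w = of_rat a'" "Im w = of_rat b' * sqrt (real d)"
    using z w by (auto simp: quadratic_integers_iff)
  have "Re (z * w) = of_rat (a * a' - b * b' * of_nat d)"
    "Im (z * w) = of_rat (a * b' + b * a') * sqrt (real d)"
    by (simp_all add: ab of_rat_add of_rat_mult of_rat_diff algebra_simps)
  moreover have "2 * Re (z * w) \<in> \<int>"
    using quadratic_integers_trace_mult(2)[OF z w] by simp
  moreover have "((Re z)\<^sup>2 + (Im z)\<^sup>2) * ((Re w)\<^sup>2 + (Im w)\<^sup>2) \<in> \<int>"
    using z w unfolding quadratic_integers_iff by (blast intro: Ints_mult)
  then have "(Re (z * w))\<^sup>2 + (Im (z * w))\<^sup>2 \<in> \<int>"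
    by (simp add: algebra_simps power2_eq_square)
  ultimately show ?thesis
    unfolding quadratic_integers_iff by blast
qed

lemma quadratic_integers_uminus: "z \<in> quadratic_integers d \<Longrightarrow> - z \<in> quadratic_integers d"
  by (auto simp: quadratic_integers_iff) (metis of_rat_minus mult_minus_left)+

lemma quadratic_integers_cnj: "z \<in> quadratic_integers d \<Longrightarrow> cnj z \<in> quadratic_integers d"
  by (auto simp: quadratic_integers_iff) (metis of_rat_minus mult_minus_left)+

lemma one_quadratic_integers: "1 \<in> quadratic_integers d"
  unfolding quadratic_integers_iff by (auto intro!: exI[of _ 1] exI[of _ 0])

lemma quat_of_complex_simps:
  "quat_of_complex 1 = 1" "quat_of_complex (z + w) = quat_of_complex z + quat_of_complex w"
  "quat_of_complex (- z) = - quat_of_complex z"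
  "quat_of_complex (z * w) = quat_of_complex z * quat_of_complex w"
  "quat_of_complex (cnj z) = qcnj (quat_of_complex z)"
  by (simp_all add: quat_eq_iff q_mult_sel quat_of_complex_def)

lemma integral_star_ring_quadratic: "integral_star_ring (quat_of_complex ` quadratic_integers d)"
proof
  fix x assume "x \<in> quat_of_complex ` quadratic_integers d"
  then obtain z where z: "x = quat_of_complex z" "z \<in> quadratic_integers d"
    by auto
  then obtain n where "(Re z)\<^sup>2 + (Im z)\<^sup>2 = of_int n"
    by (auto simp: quadratic_integers_iff elim!: Ints_cases)
  then have "x * qcnj x = of_int n"
    by (simp add: z quat_eq_iff q_mult_sel quat_of_complex_def power2_eq_square)
  then show "x * qcnj x \<in> \<int>"
    by simp
qed (auto simp flip: quat_of_complex_simps intro!: imageI one_quadratic_integers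
    quadratic_integers_add quadratic_integers_uminus quadratic_integers_mult quadratic_integers_cnj)

lemma integral_star_ring_Ints: "integral_star_ring \<int>"
  by unfold_locales (auto elim!: Ints_cases simp flip: of_int_mult)

subsection \<open>Hurwitz integers\<close>

text \<open>Integral coordinates with respect to (1+i+j+k)/2, i, j, k. One formula covers integral
  and half-integral quaternions, so that closure under the ring operations becomes a matter of
  polynomial identities.\<close>

lemma hurwitz_integers_iff:
  "z \<in> hurwitz_integers \<longleftrightarrow> (\<exists>a b c d. z = Quat (of_int a / 2) (of_int a / 2 + of_int b)
     (of_int a / 2 + of_int c) (of_int a / 2 + of_int d))" (is "_ \<longleftrightarrow> ?rhs")
proof
  assume "z \<in> hurwitz_integers"
  then show ?rhs
    unfolding hurwitz_integers_def mem_Collect_eq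
  proof
    assume "q_re z \<in> \<int> \<and> q_i z \<in> \<int> \<and> q_j z \<in> \<int> \<and> q_k z \<in> \<int>"
    then obtain a b c d where "q_re z = of_int a" "q_i z = of_int b" "q_j z = of_int c" "q_k z = of_int d"
      by (auto elim!: Ints_cases)
    then show ?thesis
      by (intro exI[of _ "2 * a"] exI[of _ "b - a"] exI[of _ "c - a"] exI[of _ "d - a"])
         (simp add: quat_eq_iff)
  next
    assume "q_re z - 1/2 \<in> \<int> \<and> q_i z - 1/2 \<in> \<int> \<and> q_j z - 1/2 \<in> \<int> \<and> q_k z - 1/2 \<in> \<int>"
    then obtain a b c d where "q_re z - 1/2 = of_int a" "q_i z - 1/2 = of_int b"
      "q_j z - 1/2 = of_int c" "q_k z - 1/2 = of_int d"
      by (auto elim!: Ints_cases)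
    then show ?thesis
      by (intro exI[of _ "2 * a + 1"] exI[of _ "b - a"] exI[of _ "c - a"] exI[of _ "d - a"])
         (simp add: quat_eq_iff field_simps)
  qed
next
  assume ?rhs
  then obtain a b c d where z: "z = Quat (of_int a / 2) (of_int a / 2 + of_int b)
     (of_int a / 2 + of_int c) (of_int a / 2 + of_int d)"
    by blast
  show "z \<in> hurwitz_integers"
  proof (cases "even a")
    case True
    then obtain k where "a = 2 * k"
      by (auto elim: evenE)
    then show ?thesis
      by (auto simp: z hurwitz_integers_def)
  next
    case False
    then obtain k where k: "a = 2 * k + 1"
      by (auto elim: oddE)
    have "real_of_int a / 2 - 1/2 = of_int k" "real_of_int a / 2 + of_int b - 1/2 = of_int (k + b)"
      "real_of_int a / 2 + of_int c - 1/2 = of_int (k + c)"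
      "real_of_int a / 2 + of_int d - 1/2 = of_int (k + d)"
      by (simp_all add: k field_simps)
    then show ?thesis
      unfolding hurwitz_integers_def z mem_Collect_eq quat.sel by (metis Ints_of_int)
  qed
qed

lemma integral_star_ring_hurwitz: "integral_star_ring hurwitz_integers"
proof
  show "1 \<in> hurwitz_integers"
    by (simp add: hurwitz_integers_def)
  fix x assume "x \<in> hurwitz_integers"
  then obtain a b c d where x: "x = Quat (of_int a / 2) (of_int a / 2 + of_int b)
     (of_int a / 2 + of_int c) (of_int a / 2 + of_int d)"
    unfolding hurwitz_integers_iff by blast
  have "- x = Quat (of_int (- a) / 2) (of_int (- a) / 2 + of_int (- b))
     (of_int (- a) / 2 + of_int (- c)) (of_int (- a) / 2 + of_int (- d))"
    by (simp add: x quat_eq_iff)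
  then show "- x \<in> hurwitz_integers"
    unfolding hurwitz_integers_iff by blast
  have "qcnj x = Quat (of_int a / 2) (of_int a / 2 + of_int (- a - b))
     (of_int a / 2 + of_int (- a - c)) (of_int a / 2 + of_int (- a - d))"
    by (simp add: x quat_eq_iff field_simps)
  then show "qcnj x \<in> hurwitz_integers"
    unfolding hurwitz_integers_iff by blast
  have "x * qcnj x = of_int (a * a + a * (b + c + d) + b * b + c * c + d * d)"
    by (simp add: x quat_eq_iff q_mult_sel field_simps)
  then show "x * qcnj x \<in> \<int>"
    by (metis Ints_of_int)
  fix y assume "y \<in> hurwitz_integers"
  then obtain a' b' c' d' where y: "y = Quat (of_int a' / 2) (of_int a' / 2 + of_int b')
     (of_int a' / 2 + of_int c') (of_int a' / 2 + of_int d')"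
    unfolding hurwitz_integers_iff by blast
  have "x + y = Quat (of_int (a + a') / 2) (of_int (a + a') / 2 + of_int (b + b'))
     (of_int (a + a') / 2 + of_int (c + c')) (of_int (a + a') / 2 + of_int (d + d'))"
    by (simp add: x y quat_eq_iff field_simps)
  then show "x + y \<in> hurwitz_integers"
    unfolding hurwitz_integers_iff by blast
  \<comment> \<open>Twice the real part of the product. The integers added to \<open>A / 2\<close>
    below are the imaginary components minus the real part.\<close>
  define A where "A = - a * a' - a * (b' + c' + d') - a' * (b + c + d) - 2 * (b * b' + c * c' + d * d')"
  have "x * y = Quat (of_int A / 2)
     (of_int A / 2 + of_int (a * a' + a * b' + a * d' + a' * b + a' * c + b * b' + c * c' + d * d' + c * d' - d * c'))
     (of_int A / 2 + of_int (a * a' + a * c' + a * b' + a' * c + a' * d + b * b' + c * c' + d * d' + d * b' - b * d'))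
     (of_int A / 2 + of_int (a * a' + a * d' + a * c' + a' * d + a' * b + b * b' + c * c' + d * d' + b * c' - c * b'))"
    by (simp add: x y quat_eq_iff q_mult_sel A_def field_simps)
  then show "x * y \<in> hurwitz_integers"
    unfolding hurwitz_integers_iff by blast
qed

text \<open>Rounding each coordinate leaves a squared error of at most 4 * (1/4) = 1. Equality
  forces all four coordinates to be half-integers, and then \<open>x\<close> is itself a Hurwitz
  integer.\<close>

lemma hurwitz_rounding: "\<exists>e\<in>hurwitz_integers. qabs (x - e) < 1"
proof -
  define e where "e = Quat (round (q_re x)) (round (q_i x)) (round (q_j x)) (round (q_k x))"
  have e: "e \<in> hurwitz_integers"
    by (simp add: e_def hurwitz_integers_def)
  have le: "\<bar>y - round y\<bar> \<le> 1/2" for y :: real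
    using of_int_round_abs_le[of y] by (simp add: abs_minus_commute)
  then have le2: "(y - round y)\<^sup>2 \<le> 1/4" for y :: real
    using power_mono[OF le[of y], of 2] by (simp add: power2_eq_square)
  have norm: "(qabs (x - e))\<^sup>2 = (q_re x - round (q_re x))\<^sup>2 + (q_i x - round (q_i x))\<^sup>2 +
      (q_j x - round (q_j x))\<^sup>2 + (q_k x - round (q_k x))\<^sup>2"
    by (simp add: qabs_squared e_def)
  show ?thesis
  proof (cases "(qabs (x - e))\<^sup>2 < 1")
    case True
    then have "qabs (x - e) < 1"
      by (simp add: power_less_one_iff qabs_def)
    with e show ?thesis
      by blast
  next
    case False
    have half: "y - 1/2 \<in> \<int>" if "(y - round y)\<^sup>2 = 1/4" for y :: real
    proof -
      have "(y - round y)\<^sup>2 = (1/2)\<^sup>2"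
        using that by (simp add: power2_eq_square)
      then have "y - 1/2 = of_int (round y) \<or> y - 1/2 = of_int (round y - 1)"
        by (auto simp: power2_eq_iff)
      then show ?thesis
        by (metis Ints_of_int)
    qed
    have "x \<in> hurwitz_integers"
      using False le2[of "q_re x"] le2[of "q_i x"] le2[of "q_j x"] le2[of "q_k x"]
      unfolding norm hurwitz_integers_def by (intro CollectI disjI2 conjI half) linarith+
    then show ?thesis
      by (intro bexI[of _ x]) (simp_all add: qabs_def)
  qed
qed

subsection \<open>Maximality of the ideal generated by a prime\<close>

text \<open>By Euclidean division an element \<open>d\<close> of least norm generates the right
  ideal spanned by \<open>z\<close> and \<open>p\<close>. It is a left divisor of \<open>p\<close>,
  and a proper one because \<open>p\<close> does not divide \<open>z\<close> on the left, so
  irreducibility makes it a unit.\<close>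

lemma hurwitz_irreducible_maximal:
  assumes p: "p \<in> hurwitz_integers" "ring_irreducible\<^bsub>qring hurwitz_integers\<^esub> p"
    and z: "z \<in> hurwitz_integers" "\<And>w. w \<in> hurwitz_integers \<Longrightarrow> z \<noteq> p * w"
  shows "\<exists>a\<in>hurwitz_integers. \<exists>b\<in>hurwitz_integers. z * a + p * b = 1"
proof -
  interpret integral_star_ring hurwitz_integers
    by (rule integral_star_ring_hurwitz)
  let ?H = hurwitz_integers
  define I where "I = {z * a + p * b | a b. a \<in> ?H \<and> b \<in> ?H}"
  have I_H: "x \<in> ?H" if "x \<in> I" for x
    using that p(1) z(1) by (auto simp: I_def intro: ring_in)
  have zI: "z \<in> I" and pI: "p \<in> I"
    unfolding I_def using one_in zero_in by (force intro: exI[of _ 1] exI[of _ 0])+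
  have I_mult: "x * a \<in> I" if "x \<in> I" "a \<in> ?H" for x a
    using that unfolding I_def
    by (auto simp: distrib_right mult.assoc) (metis mult_in)
  have I_diff: "x - y \<in> I" if xy: "x \<in> I" "y \<in> I" for x y
  proof -
    obtain a b a' b' where "x = z * a + p * b" "y = z * a' + p * b'" "a \<in> ?H" "b \<in> ?H" "a' \<in> ?H" "b' \<in> ?H"
      using xy unfolding I_def by blast
    then have "x - y = z * (a - a') + p * (b - b')" "a - a' \<in> ?H" "b - b' \<in> ?H"
      by (auto simp: algebra_simps minus_in)
    then show ?thesis
      unfolding I_def by blast
  qed
  have "p \<noteq> 0"
    using p(2) by (simp add: ring_irreducible_def)
  \<comment> \<open>The floor only changes the type: squared norms of Hurwitz integers are natural
    numbers.\<close>
  define d where "d = arg_min (\<lambda>x. nat \<lfloor>(qabs x)\<^sup>2\<rfloor>) (\<lambda>x. x \<in> I \<and> x \<noteq> 0)"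
  have "d \<in> I \<and> d \<noteq> 0"
    unfolding d_def by (rule arg_min_natI[of _ p]) (use pI \<open>p \<noteq> 0\<close> in simp)
  then have d: "d \<in> I" "d \<noteq> 0"
    by auto
  have d_min: "nat \<lfloor>(qabs d)\<^sup>2\<rfloor> \<le> nat \<lfloor>(qabs x)\<^sup>2\<rfloor>" if "x \<in> I" "x \<noteq> 0" for x
    unfolding d_def by (rule arg_min_nat_le) (use that in simp)
  have norm_int: "\<exists>m. (qabs x)\<^sup>2 = real m" if "x \<in> ?H" for x
    using norm_nat[OF that] by (metis mult_qcnj q_of_nat_sel(1) q_of_real_sel(1))
  have d_dvd: "\<exists>e\<in>?H. x = d * e" if x: "x \<in> I" for x
  proof -
    obtain e where e: "e \<in> ?H" "qabs (inverse d * x - e) < 1"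
      using hurwitz_rounding by blast
    define y where "y = x - d * e"
    have yI: "y \<in> I"
      unfolding y_def using x d e by (intro I_diff I_mult)
    have "y = d * (inverse d * x - e)"
      using d(2) by (simp add: y_def right_diff_distrib flip: mult.assoc)
    then have "qabs y = qabs d * qabs (inverse d * x - e)"
      by (simp add: qabs_mult)
    moreover have "qabs d > 0"
      using d(2) qabs_eq_0_iff[of d] by (simp add: qabs_def order_less_le)
    ultimately have "qabs y < qabs d"
      using e(2) by simp
    then have less: "(qabs y)\<^sup>2 < (qabs d)\<^sup>2"
      by (intro power_strict_mono) (auto simp: qabs_def)
    have "y = 0"
    proof (rule ccontr)
      assume "y \<noteq> 0"
      obtain m k where "(qabs y)\<^sup>2 = real m" "(qabs d)\<^sup>2 = real k"
        using norm_int[OF I_H[OF yI]] norm_int[OF I_H[OF d(1)]] by auto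
      with less d_min[OF yI \<open>y \<noteq> 0\<close>] show False
        by simp
    qed
    with e show ?thesis
      by (auto simp: y_def)
  qed
  obtain e where e: "e \<in> ?H" "p = d * e"
    using d_dvd[OF pI] by blast
  obtain f where f: "f \<in> ?H" "z = d * f"
    using d_dvd[OF zI] by blast
  have "properfactor (qring ?H) d p"
    unfolding properfactor_def factor_def
  proof (intro conjI notI)
    show "\<exists>c\<in>carrier (qring ?H). p = d \<otimes>\<^bsub>qring ?H\<^esub> c"
      using e by auto
    assume "\<exists>c\<in>carrier (qring ?H). d = p \<otimes>\<^bsub>qring ?H\<^esub> c"
    then obtain c where "c \<in> ?H" "d = p * c"
      by auto
    then show False
      using z(2)[of "c * f"] f by (auto simp: mult.assoc mult_in)
  qed
  then have "d \<in> Units (qring ?H)"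
    using p(2) I_H[OF d(1)] by (simp add: ring_irreducible_def irreducible_def)
  then obtain d' where d': "d' \<in> ?H" "d * d' = 1"
    by (auto simp: Units_def)
  have "1 \<in> I"
    using I_mult[OF d(1) d'(1)] d'(2) by simp
  then obtain a b where "1 = z * a + p * b" "a \<in> ?H" "b \<in> ?H"
    unfolding I_def by blast
  then show ?thesis
    by metis
qed

text \<open>Modulo \<open>p R\<close> the square of \<open>z\<close> is the rational integer \<open>z qcnj z\<close>, which is invertible
  modulo the rational prime contained in \<open>p R\<close>.\<close>

lemma (in integral_star_ring) commutative_prime_maximal:
  assumes comm: "\<And>x y. x \<in> R \<Longrightarrow> y \<in> R \<Longrightarrow> x * y = y * x"
    and p: "p \<in> R" "ring_prime\<^bsub>qring R\<^esub> p" and q: "primepow q" "p * qcnj p = of_nat q"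
    and cong: "\<And>z. z \<in> R \<Longrightarrow> \<exists>w\<in>R. qcnj z - z = p * w"
    and z: "z \<in> R" "\<And>w. w \<in> R \<Longrightarrow> z \<noteq> p * w"
  shows "\<exists>a\<in>R. \<exists>b\<in>R. z * a + p * b = 1"
proof -
  define P where "P x \<longleftrightarrow> (\<exists>w\<in>R. x = p * w)" for x
  have prime: "P x \<or> P y" if "P (x * y)" "x \<in> R" "y \<in> R" for x y
    using p(2) that unfolding ring_prime_def Divisibility.prime_def factor_def P_def by auto
  have P_mult: "P (x * y)" if "P x" "y \<in> R" for x y
    using that unfolding P_def by (metis mult.assoc mult_in)
  obtain N where N: "z * qcnj z = of_nat N"
    using norm_nat[OF z(1)] by metis
  have "\<not> P (of_nat N)"
  proof
    assume "P (of_nat N)"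
    then obtain u where u: "u \<in> R" "of_nat N = p * u"
      unfolding P_def by auto
    obtain w where w: "w \<in> R" "qcnj z - z = p * w"
      using cong[OF z(1)] by auto
    have "z * z = z * qcnj z - z * (qcnj z - z)"
      by (simp add: algebra_simps)
    also have "\<dots> = p * u - z * (p * w)"
      by (simp add: N u w)
    also have "\<dots> = p * (u - z * w)"
      using comm[OF z(1) p(1)] by (simp add: algebra_simps flip: mult.assoc)
    finally have "P (z * z)"
      unfolding P_def using u w z(1) by (auto intro!: bexI[of _ "u - z * w"] ring_in)
    then have "P z"
      using prime z(1) by blast
    with z(2) show False
      unfolding P_def by blast
  qed
  obtain l k where l: "Factorial_Ring.prime l" "k > 0" "q = l ^ k"
    using q(1) by (auto simp: primepow_def)
  have "P (of_nat q)"
    unfolding P_def using q(2) p(1) qcnj_in by metis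
  then have "P (of_nat l ^ k)"
    by (simp add: l)
  then have "P (of_nat l)"
  proof (induction k)
    \<comment> \<open>The exponent 0 would put 1, and hence \<open>z\<close>, into
      \<open>p R\<close>.\<close>
    case 0
    then have "P (1 * z)"
      using P_mult[of 1 z] z(1) by simp
    with z(2) show ?case
      unfolding P_def by auto
  next
    case (Suc k)
    then have "P (of_nat l) \<or> P (of_nat l ^ k)"
      using prime[of "of_nat l" "of_nat l ^ k"] of_nat_in[of l] of_nat_in[of "l ^ k"] by simp
    with Suc.IH show ?case
      by blast
  qed
  have "\<not> l dvd N"
  proof
    assume "l dvd N"
    then obtain m where "N = l * m" ..
    then have "P (of_nat N)"
      using P_mult[OF \<open>P (of_nat l)\<close> of_nat_in[of m]] by simp
    with \<open>\<not> P (of_nat N)\<close> show False ..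
  qed
  then have "Rings.coprime (int N) (int l)"
    using l(1) prime_imp_coprime[of l N] by (simp add: ac_simps)
  then obtain x y where xy: "x * int N + y * int l = 1"
    by (metis bezout_int coprime_imp_gcd_eq_1)
  obtain c where c: "c \<in> R" "of_nat l = p * c"
    using \<open>P (of_nat l)\<close> unfolding P_def by auto
  have "z * (qcnj z * of_int x) + p * (c * of_int y) = of_nat N * of_int x + of_nat l * of_int y"
    by (simp add: N c flip: mult.assoc)
  also have "\<dots> = of_int (x * int N + y * int l)"
    by (simp add: mult_of_int_commute)
  finally have "z * (qcnj z * of_int x) + p * (c * of_int y) = 1"
    by (simp add: xy)
  then show ?thesis
    using z(1) c(1) by (metis mult_in qcnj_in of_int_in)
qed

lemma admissible_ring_if_admissible_triple:
  assumes "admissible_triple R p q"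
  shows "admissible_ring R p q"
proof -
  have cases: "(R = \<int> \<or> (\<exists>d. R = quat_of_complex ` quadratic_integers d)) \<and> ring_prime\<^bsub>qring R\<^esub> p \<or>
      R = hurwitz_integers \<and> ring_irreducible\<^bsub>qring R\<^esub> p"
    and q: "primepow q" and p: "p \<in> R" "(qabs p)\<^sup>2 = real q"
    and cong: "\<And>z. z \<in> R \<Longrightarrow> \<exists>w\<in>R. qcnj z - z = p * w"
    using assms unfolding admissible_triple_def quadratic_integers_def by blast+
  have p_norm: "p * qcnj p = of_nat q"
    by (simp add: mult_qcnj p)
  have "integral_star_ring R"
    using cases integral_star_ring_Ints integral_star_ring_quadratic integral_star_ring_hurwitz by auto
  then interpret integral_star_ring R .
  have maximal: "\<exists>a\<in>R. \<exists>b\<in>R. z * a + p * b = 1"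
    if z: "z \<in> R" "\<And>w. w \<in> R \<Longrightarrow> z \<noteq> p * w" for z
    using cases
  proof
    assume R: "(R = \<int> \<or> (\<exists>d. R = quat_of_complex ` quadratic_integers d)) \<and> ring_prime\<^bsub>qring R\<^esub> p"
    then have "x * y = y * x" if "x \<in> R" "y \<in> R" for x y
      using that by (auto elim!: Ints_cases simp: mult.commute simp flip: quat_of_complex_simps of_int_mult)
    then show ?thesis
      using commutative_prime_maximal[OF _ p(1) _ q p_norm cong z] R by blast
  next
    assume "R = hurwitz_integers \<and> ring_irreducible\<^bsub>qring R\<^esub> p"
    then show ?thesis
      using hurwitz_irreducible_maximal[of p z] p(1) z by blast
  qed
  have "q > 0"
    using q by (rule primepow_gt_0_nat)
  show ?thesis
    by (intro admissible_ring.intro admissible_ring_axioms.intro integral_star_ring_axioms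
        p(1) \<open>q > 0\<close> p_norm cong maximal)
qed

section \<open>The projective plane\<close>

text \<open>A vector \<open>a\<close> outside the span multiplies the cardinality by that of the
  field, since the vectors \<open>k *s a + y\<close> are pairwise distinct and fill the larger
  span.\<close>

lemma card_span_independent:
  fixes B :: "('f::{field,finite} ^ 'n) set"
  assumes "finite B" "vec.independent B"
  shows "card (vec.span B) = CARD('f) ^ card B"
  using assms
proof (induction B)
  case (insert a B)
  then have indep: "vec.independent B" "a \<notin> vec.span B"
    by (auto simp: vec.independent_insert)
  define g where "g = (\<lambda>(k::'f, y). k *s a + y)"
  have "inj_on g (UNIV \<times> vec.span B)"
  proof (rule inj_onI, clarify)
    fix k y k' y' assume y: "y \<in> vec.span B" "y' \<in> vec.span B" and eq: "g (k, y) = g (k', y')"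
    then have diff: "(k - k') *s a = y' - y"
      by (simp add: g_def vec.scale_left_diff_distrib algebra_simps)
    have "(k - k') *s a \<in> vec.span B"
      unfolding diff using y by (intro vec.span_diff)
    have "k = k'"
    proof (rule ccontr)
      assume "k \<noteq> k'"
      then have "inverse (k - k') * (k - k') = 1"
        by simp
      then have "a = inverse (k - k') *s ((k - k') *s a)"
        by (simp only: vec.scale_scale vec.scale_one)
      also have "\<dots> \<in> vec.span B"
        by (rule vec.span_scale) fact
      finally show False
        using indep by simp
    qed
    with diff show "k = k' \<and> y = y'"
      by simp
  qed
  moreover have "g ` (UNIV \<times> vec.span B) = vec.span (insert a B)"
  proof (intro equalityI subsetI)
    fix x assume "x \<in> vec.span (insert a B)"
    then obtain k where "x - k *s a \<in> vec.span B"
      by (auto simp: vec.span_insert)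
    then show "x \<in> g ` (UNIV \<times> vec.span B)"
      by (intro image_eqI[of _ _ "(k, x - k *s a)"]) (auto simp: g_def)
  next
    fix x assume "x \<in> g ` (UNIV \<times> vec.span B)"
    then obtain k y where "x = k *s a + y" "y \<in> vec.span B"
      by (auto simp: g_def)
    then show "x \<in> vec.span (insert a B)"
      unfolding vec.span_insert by (auto intro!: exI[of _ k])
  qed
  ultimately have "card (vec.span (insert a B)) = CARD('f) * card (vec.span B)"
    by (metis card_image card_cartesian_product)
  then show ?case
    using insert indep by simp
qed simp

lemma card_subspace:
  fixes U :: "('f::{field,finite} ^ 'n) set"
  assumes "vec.subspace U"
  shows "card U = CARD('f) ^ vec.dim U"
proof -
  obtain B where B: "B \<subseteq> U" "vec.independent B" "U \<subseteq> vec.span B" "card B = vec.dim U"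
    by (rule vec.basis_exists)
  then have "vec.span B = U"
    using assms by (metis vec.span_minimal subset_antisym)
  with card_span_independent[OF _ B(2)] B(4) show ?thesis
    by simp
qed

lemma CARD_field_ge_2: "CARD('f::{field,finite}) \<ge> 2"
proof -
  have "card {0, 1 :: 'f} \<le> CARD('f)"
    by (intro card_mono) auto
  then show ?thesis
    by simp
qed

lemma dim_UNIV_3: "vec.dim (UNIV :: ('f::field ^ 3) set) = 3"
  by (subst vec_dim_card) simp

lemma points_lines_disjoint: "points \<inter> lines = {}"
  by (auto simp: points_def lines_def)

lemma point_eq_if_subset: "P \<in> points \<Longrightarrow> U \<in> points \<Longrightarrow> P \<subseteq> U \<Longrightarrow> P = U"
  unfolding points_def by (intro vec.subspace_dim_equal) simp_all

lemma point_eq_if_common_vector: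
  fixes P :: "('f::field ^ 3) set"
  assumes "P \<in> points" "P' \<in> points" "x \<in> P" "x \<in> P'" "x \<noteq> 0"
  shows "P = P'"
proof -
  have "vec.dim {x} = 1"
    using assms(5) by (subst vec.dim_eq_card[of "{x}"]) auto
  then have "vec.span {x} \<in> points"
    by (simp add: points_def vec.subspace_span vec.dim_span)
  moreover have "vec.span {x} \<subseteq> P" "vec.span {x} \<subseteq> P'"
    using assms by (simp_all add: vec.span_minimal points_def)
  ultimately show ?thesis
    using assms point_eq_if_subset by metis
qed

text \<open>The points inside \<open>U\<close> partition its nonzero vectors into classes with
  \<open>CARD('f) - 1\<close> elements each.\<close>

lemma card_points_in_subspace:
  fixes U :: "('f::{field,finite} ^ 3) set"
  assumes "vec.subspace U"
  shows "card {P \<in> points. P \<subseteq> U} * (CARD('f) - 1) = CARD('f) ^ vec.dim U - 1"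
proof -
  have zero: "0 \<in> P" if "P \<in> points" for P :: "('f ^ 3) set"
    using that by (auto simp: points_def vec.subspace_0)
  have "U - {0} = (\<Union>P\<in>{P \<in> points. P \<subseteq> U}. P - {0})"
  proof (intro equalityI subsetI)
    fix x assume x: "x \<in> U - {0}"
    then have "vec.dim {x} = 1"
      by (subst vec.dim_eq_card[of "{x}"]) auto
    then have "vec.span {x} \<in> points"
      by (simp add: points_def vec.subspace_span vec.dim_span)
    moreover have "vec.span {x} \<subseteq> U" "x \<in> vec.span {x}"
      using x assms by (simp_all add: vec.span_minimal vec.span_base)
    ultimately show "x \<in> (\<Union>P\<in>{P \<in> points. P \<subseteq> U}. P - {0})"
      using x by blast
  qed auto
  then have "card (U - {0}) = card (\<Union>P\<in>{P \<in> points. P \<subseteq> U}. P - {0})"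
    by simp
  also have "\<dots> = (\<Sum>P\<in>{P \<in> points. P \<subseteq> U}. card (P - {0}))"
    using point_eq_if_common_vector by (intro card_UN_disjoint) auto
  also have "\<dots> = (\<Sum>P\<in>{P \<in> points. P \<subseteq> U}. CARD('f) - 1)"
  proof (intro sum.cong refl)
    fix P assume "P \<in> {P \<in> points. P \<subseteq> U}"
    then show "card (P - {0}) = CARD('f) - 1"
      using zero[of P] card_subspace[of P] by (auto simp: points_def)
  qed
  finally have "card {P \<in> points. P \<subseteq> U} * (CARD('f) - 1) = card (U - {0})"
    by simp
  also have "\<dots> = CARD('f) ^ vec.dim U - 1"
    using card_subspace[OF assms] vec.subspace_0[OF assms] by simp
  finally show ?thesis .
qed

lemma card_points:
  "card (points :: ('f::{field,finite} ^ 3) set set) = CARD('f)\<^sup>2 + CARD('f) + 1"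
proof -
  \<comment> \<open>Writing the order of the field as r + 1 removes the truncated subtraction, and
    the positive factor \<open>r\<close> can be cancelled at the end.\<close>
  obtain r where r: "CARD('f) = Suc r" "r > 0"
    using CARD_field_ge_2[where 'f = 'f] by (cases "CARD('f)") auto
  have "card {P \<in> points. P \<subseteq> (UNIV :: ('f ^ 3) set)} * r = Suc r ^ 3 - 1"
    using card_points_in_subspace[of "UNIV :: ('f ^ 3) set"] r(1)
    by (simp only: vec.subspace_UNIV dim_UNIV_3) simp
  also have "\<dots> = ((Suc r)\<^sup>2 + Suc r + 1) * r"
    by (simp add: power2_eq_square power3_eq_cube algebra_simps)
  finally show ?thesis
    unfolding mult_cancel2 using r by simp
qed

lemma card_points_on_line:
  fixes l :: "('f::{field,finite} ^ 3) set"
  assumes "l \<in> lines"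
  shows "card {P \<in> points. P \<subseteq> l} = CARD('f) + 1"
proof -
  obtain r where r: "CARD('f) = Suc r" "r > 0"
    using CARD_field_ge_2[where 'f = 'f] by (cases "CARD('f)") auto
  have "card {P \<in> points. P \<subseteq> l} * r = (Suc r)\<^sup>2 - 1"
    using card_points_in_subspace[of l] assms r(1) by (simp add: lines_def)
  also have "\<dots> = (Suc r + 1) * r"
    by (simp add: power2_eq_square)
  finally show ?thesis
    unfolding mult_cancel2 using r by simp
qed

text \<open>In dimension 3 two planes meet in dimension at least 2 + 2 - 3 = 1, and dimension 2
  would make them equal.\<close>

lemma points_on_two_lines:
  fixes l m :: "('f::field ^ 3) set"
  assumes "l \<in> lines" "m \<in> lines" "l \<noteq> m"
  shows "{P \<in> points. P \<subseteq> l \<and> P \<subseteq> m} = {l \<inter> m}"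
proof -
  have sub: "vec.subspace l" "vec.subspace m" and dim: "vec.dim l = 2" "vec.dim m = 2"
    using assms by (auto simp: lines_def)
  have "vec.dim {x + y |x y. x \<in> l \<and> y \<in> m} \<le> vec.dim (UNIV :: ('f ^ 3) set)"
    by (rule vec.dim_subset) simp
  then have "vec.dim (l \<inter> m) \<ge> 1"
    using vec.dim_sums_Int[OF sub] dim unfolding dim_UNIV_3 by linarith
  moreover have "\<not> vec.dim (l \<inter> m) \<ge> 2"
  proof
    assume "vec.dim (l \<inter> m) \<ge> 2"
    then have "l \<inter> m = l" "l \<inter> m = m"
      using sub dim by (intro vec.subspace_dim_equal; simp add: vec.subspace_inter)+
    with assms(3) show False
      by simp
  qed
  ultimately have "l \<inter> m \<in> points"
    using vec.subspace_inter[OF sub] by (auto simp: points_def)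
  then show ?thesis
    using point_eq_if_subset by auto
qed

lemma line_exists: "\<exists>l :: ('f::field ^ 3) set. l \<in> lines"
proof -
  have "2 \<le> vec.dim (vec.span (UNIV :: ('f ^ 3) set))"
    by (simp only: vec.span_UNIV dim_UNIV_3)
  then obtain l :: "('f ^ 3) set" where "vec.subspace l" "vec.dim l = 2"
    by (rule vec.choose_subspace_of_subspace) (rule that)
  then show ?thesis
    by (auto simp: lines_def)
qed

subsection \<open>Permutation of subspaces by invertible matrices\<close>

lemma bij_invertible_matrix:
  fixes A :: "'f::field ^ 'n ^ 'n"
  assumes "invertible A"
  shows "bij ((*v) A)"
proof -
  obtain B where "A ** B = mat 1" "B ** A = mat 1"
    using assms by (auto simp: invertible_def)
  then show ?thesis
    by (intro o_bij[of "(*v) B"]) (auto simp: fun_eq_iff matrix_vector_mul_assoc)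
qed

lemma dim_invertible_image:
  fixes A :: "'f::field ^ 'n ^ 'n"
  assumes "invertible A"
  shows "vec.dim ((*v) A ` U) = vec.dim U"
  using bij_invertible_matrix[OF assms]
  by (intro vec.dim_image_eq matrix_vector_mul_linear_gen) (auto simp: bij_def inj_on_def)

lemma subspace_matrix_image:
  "vec.subspace U \<Longrightarrow> vec.subspace ((*v) A ` U)"
  by (rule vec.linear_subspace_image[OF matrix_vector_mul_linear_gen])

lemma subspace_invertible_image_iff:
  fixes A :: "'f::field ^ 'n ^ 'n"
  assumes "invertible A"
  shows "vec.subspace ((*v) A ` U) \<longleftrightarrow> vec.subspace U"
proof -
  obtain B where "B ** A = mat 1"
    using assms by (auto simp: invertible_def)
  then have "(*v) B ` (*v) A ` U = U"
    by (simp add: image_image matrix_vector_mul_assoc)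
  then show ?thesis
    using subspace_matrix_image[of U A] subspace_matrix_image[of "(*v) A ` U" B] by metis
qed

lemma image_in_points_iff: "invertible A \<Longrightarrow> (*v) A ` U \<in> points \<longleftrightarrow> U \<in> points"
  by (simp add: points_def dim_invertible_image subspace_invertible_image_iff)

lemma image_in_lines_iff: "invertible A \<Longrightarrow> (*v) A ` U \<in> lines \<longleftrightarrow> U \<in> lines"
  by (simp add: lines_def dim_invertible_image subspace_invertible_image_iff)

lemma bij_image_matrix:
  fixes A :: "'f::field ^ 'n ^ 'n"
  shows "invertible A \<Longrightarrow> bij ((`) ((*v) A))"
  using bij_betw_Pow[OF bij_invertible_matrix[of A]] by simp

lemma plane_gram_image:
  assumes "invertible A"
  shows "plane_gram p q ((*v) A ` r) ((*v) A ` s) = plane_gram p q r s"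
proof -
  have "inj ((*v) A)"
    using bij_invertible_matrix[OF assms] by (simp add: bij_def)
  then show ?thesis
    by (simp add: plane_gram_def image_in_points_iff[OF assms] image_in_lines_iff[OF assms]
        inj_image_subset_iff inj_image_eq_iff)
qed

lemma GL3_permute_image:
  assumes "invertible A"
  shows "GL3_permute A v ((*v) A ` U) = v U"
  using bij_invertible_matrix[OF assms] by (simp add: GL3_permute_def bij_def inj_vimage_image_eq)

lemma GL3_permute_mult: "GL3_permute (A ** B) v = GL3_permute A (GL3_permute B v)"
  by (simp add: GL3_permute_def matrix_vector_mul_assoc[symmetric] vimage_def)

lemma GL3_permute_one: "GL3_permute (mat 1) v = v"
  by (simp add: GL3_permute_def vimage_def)

section \<open>The lattice of the projective plane\<close>

text \<open>Coordinates in which the form on the free module becomes the standard Lorentzian form: \<open>None\<close>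
  is the positive direction, and the points are the negative ones.\<close>

definition lorentz_coord :: "quat \<Rightarrow> ('f::field ^ 3) set \<Rightarrow> ('f ^ 3) set option \<Rightarrow> quat" where
  "lorentz_coord p r j =
     (if r \<in> points then if j = Some r then qcnj p else 0
      else if r \<in> lines then
        (case j of None \<Rightarrow> 1 | Some P \<Rightarrow> if P \<in> points \<and> P \<subseteq> r then -1 else 0)
      else 0)"

definition lorentz_index :: "('f::field ^ 3) set option set" where
  "lorentz_index = insert None (Some ` points)"

definition lorentz_sign :: "'a option \<Rightarrow> real" where
  "lorentz_sign j = (if j = None then 1 else -1)"

lemma finite_lorentz_index: "finite (lorentz_index :: ('f::{field,finite} ^ 3) set option set)"
  by (simp add: lorentz_index_def)

lemma diag_form_lorentz:
  fixes u :: "('f::{field,finite} ^ 3) set option \<Rightarrow> quat"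
  shows "diag_form lorentz_index lorentz_sign u v =
    qcnj (u None) * v None - (\<Sum>P\<in>points. qcnj (u (Some P)) * v (Some P))"
proof -
  have "None \<notin> Some ` (points :: ('f ^ 3) set set)"
    by auto
  then show ?thesis
    by (simp add: diag_form_def lorentz_index_def lorentz_sign_def sum.reindex sum_negf)
qed

context admissible_ring
begin

lemma plane_gram_eq_diag_form:
  fixes r s :: "('f::{field,finite} ^ 3) set"
  assumes q: "CARD('f) = q" and rs: "r \<in> points \<union> lines" "s \<in> points \<union> lines"
  shows "plane_gram p q r s = diag_form lorentz_index lorentz_sign (lorentz_coord p r) (lorentz_coord p s)"
proof -
  have disj: "x \<notin> lines" if "x \<in> points" for x :: "('f ^ 3) set"
    using points_lines_disjoint that by blast
  have disj': "x \<notin> points" if "x \<in> lines" for x :: "('f ^ 3) set"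
    using points_lines_disjoint that by blast
  have delta: "(\<Sum>P\<in>points. (if P = x then f P else 0)) = f x" if "x \<in> points"
    for x :: "('f ^ 3) set" and f :: "('f ^ 3) set \<Rightarrow> quat"
    using that by simp
  consider "r \<in> points" "s \<in> points" | "r \<in> points" "s \<in> lines" | "r \<in> lines" "s \<in> points"
    | "r \<in> lines" "s \<in> lines"
    using rs by blast
  then show ?thesis
  proof cases
    case 1
    have "(\<Sum>P\<in>points. qcnj (lorentz_coord p r (Some P)) * lorentz_coord p s (Some P)) =
        (\<Sum>P\<in>points. if P = r then if r = s then of_nat q else 0 else 0)"
      using 1 by (intro sum.cong) (auto simp: lorentz_coord_def p_norm)
    also have "\<dots> = (if r = s then of_nat q else 0)"
      using 1 by (simp only: delta)
    finally show ?thesis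
      using 1 disj by (simp add: diag_form_lorentz plane_gram_def lorentz_coord_def[of _ _ None])
  next
    case 2
    have "(\<Sum>P\<in>points. qcnj (lorentz_coord p r (Some P)) * lorentz_coord p s (Some P)) =
        (\<Sum>P\<in>points. if P = r then if r \<subseteq> s then - p else 0 else 0)"
      using 2 disj' by (intro sum.cong) (auto simp: lorentz_coord_def)
    also have "\<dots> = (if r \<subseteq> s then - p else 0)"
      using 2 by (simp only: delta)
    finally show ?thesis
      using 2 disj disj' by (auto simp: diag_form_lorentz plane_gram_def lorentz_coord_def[of _ _ None])
  next
    case 3
    have "(\<Sum>P\<in>points. qcnj (lorentz_coord p r (Some P)) * lorentz_coord p s (Some P)) =
        (\<Sum>P\<in>points. if P = s then if s \<subseteq> r then - qcnj p else 0 else 0)"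
      using 3 disj' by (intro sum.cong) (auto simp: lorentz_coord_def)
    also have "\<dots> = (if s \<subseteq> r then - qcnj p else 0)"
      using 3 by (simp only: delta)
    finally show ?thesis
      using 3 disj disj' by (auto simp: diag_form_lorentz plane_gram_def lorentz_coord_def[of _ _ None])
  next
    case 4
    have "(\<Sum>P\<in>points. qcnj (lorentz_coord p r (Some P)) * lorentz_coord p s (Some P)) =
        (\<Sum>P\<in>points. if P \<subseteq> r \<and> P \<subseteq> s then 1 else 0)"
      using 4 disj' by (intro sum.cong) (auto simp: lorentz_coord_def)
    also have "\<dots> = of_nat (card {P \<in> points. P \<subseteq> r \<and> P \<subseteq> s})"
      by (simp add: sum.If_cases Int_def)
    \<comment> \<open>Subtracted from the contribution 1 of the positive direction, these counts
      give \<open>- of_nat q\<close> on the diagonal and 0 for distinct lines.\<close>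
    also have "card {P \<in> points. P \<subseteq> r \<and> P \<subseteq> s} = (if r = s then q + 1 else 1)"
      using 4 points_on_two_lines[of r s] card_points_on_line[of r] q by auto
    finally show ?thesis
      using 4 disj' by (auto simp: diag_form_lorentz plane_gram_def lorentz_coord_def[of _ _ None])
  qed
qed

lemma lorentz_coord_in: "lorentz_coord p r j \<in> R"
  by (auto simp: lorentz_coord_def ring_in p_in split: option.split)

lemma lorentz_coord_outside: "j \<notin> lorentz_index \<Longrightarrow> lorentz_coord p r j = 0"
  by (auto simp: lorentz_coord_def lorentz_index_def split: option.split)

lemma form_Lq_free:
  fixes x y :: "('f::{field,finite} ^ 3) set \<Rightarrow> quat"
  assumes "CARD('f) = q" "x \<in> carrier (Lq_free R p q)" "y \<in> carrier (Lq_free R p q)"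
  shows "form (Lq_free R p q) x y =
    diag_form lorentz_index lorentz_sign (lincomb (lorentz_coord p) x) (lincomb (lorentz_coord p) y)"
  using assms plane_gram_eq_diag_form[OF assms(1)] unfolding Lq_free_def
  by (intro form_free_herm_lincomb)

lemma coord_module_Lq_free:
  "coord_module R (Lq_free R p q :: (('f::field ^ 3) set \<Rightarrow> quat) herm_module) (lincomb (lorentz_coord p))"
  unfolding Lq_free_def by (rule coord_module_free_herm)

lemma unit_vec_in_Lq_free:
  "r \<in> points \<union> lines \<Longrightarrow> a \<in> R \<Longrightarrow> unit_vec r a \<in> carrier (Lq_free R p q)"
  unfolding Lq_free_def free_herm_simps by (rule unit_vec_in)

text \<open>It suffices to pair with basis vectors: a point \<open>P\<close> yields
  \<open>p * u (Some P) = 0\<close>, and once these coordinates vanish any line isolates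
  \<open>u None\<close>. The diagonal form restricted to the image is therefore
  nondegenerate.\<close>

lemma Rad_Lq_free:
  assumes q: "CARD('f::{field,finite}) = q"
  shows "Rad (Lq_free R p q :: (('f ^ 3) set \<Rightarrow> quat) herm_module) =
    {x \<in> carrier (Lq_free R p q). lincomb (lorentz_coord p) x = (\<lambda>j. 0)}"
proof (intro equalityI subsetI)
  fix x :: "('f ^ 3) set \<Rightarrow> quat"
  assume "x \<in> {x \<in> carrier (Lq_free R p q). lincomb (lorentz_coord p) x = (\<lambda>j. 0)}"
  then show "x \<in> Rad (Lq_free R p q)"
    by (auto simp: Rad_def form_Lq_free[OF q] diag_form_def)
next
  fix x :: "('f ^ 3) set \<Rightarrow> quat"
  assume "x \<in> Rad (Lq_free R p q)"
  then have x: "x \<in> carrier (Lq_free R p q)"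
    and orth: "\<And>y. y \<in> carrier (Lq_free R p q) \<Longrightarrow> form (Lq_free R p q) y x = 0"
    by (auto simp: Rad_def)
  define u where "u = lincomb (lorentz_coord p) x"
  have orth': "diag_form lorentz_index lorentz_sign (lorentz_coord p r) u = 0"
    if "r \<in> points \<union> lines" for r :: "('f ^ 3) set"
    using orth[OF unit_vec_in_Lq_free[OF that one_in]] unit_vec_in_Lq_free[OF that one_in] x
    by (simp add: form_Lq_free[OF q] lincomb_unit_vec u_def)
  have u_point: "u (Some P) = 0" if P: "P \<in> points" for P
  proof -
    have "(\<Sum>P'\<in>points. qcnj (lorentz_coord p P (Some P')) * u (Some P')) =
        (\<Sum>P'\<in>points. if P' = P then p * u (Some P) else 0)"
      using P by (intro sum.cong) (auto simp: lorentz_coord_def)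
    also have "\<dots> = p * u (Some P)"
      using P by simp
    finally have "p * u (Some P) = 0"
      using orth'[of P] P by (simp add: diag_form_lorentz lorentz_coord_def[of _ _ None])
    then show ?thesis
      using p_nonzero by simp
  qed
  obtain l :: "('f ^ 3) set" where l: "l \<in> lines"
    using line_exists by blast
  then have "l \<notin> points"
    using points_lines_disjoint by blast
  then have "u None = 0"
    using orth'[of l] l by (simp add: diag_form_lorentz u_point lorentz_coord_def[of _ _ None])
  have "u j = 0" for j
  proof (cases "j \<in> lorentz_index")
    case True
    then show ?thesis
      using u_point \<open>u None = 0\<close> by (auto simp: lorentz_index_def)
  next
    case False
    then show ?thesis
      by (simp add: u_def lincomb_def lorentz_coord_outside)
  qed
  with x show "x \<in> {x \<in> carrier (Lq_free R p q). lincomb (lorentz_coord p) x = (\<lambda>j. 0)}"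
    by (auto simp: u_def)
qed

lemma kernel_quotient_Lq:
  assumes "CARD('f::{field,finite}) = q"
  shows "kernel_quotient R (Lq_free R p q :: (('f ^ 3) set \<Rightarrow> quat) herm_module)
    (lincomb (lorentz_coord p)) (Rad (Lq_free R p q)) (diag_form lorentz_index lorentz_sign)"
proof (rule kernel_quotient.intro[OF coord_module_Lq_free kernel_quotient_axioms.intro])
  show "Rad (Lq_free R p q :: (('f ^ 3) set \<Rightarrow> quat) herm_module) =
    {x \<in> carrier (Lq_free R p q). lincomb (lorentz_coord p) x = (\<lambda>j. 0)}"
    by (rule Rad_Lq_free[OF assms])
qed (rule form_Lq_free[OF assms])

text \<open>The set \<open>R p\<close> absorbs factors from \<open>R\<close> on both sides, on the
  right by \<open>p_mult_commute_left\<close>. So the sesquilinear expansion stays inside as soon as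
  the Gram entries do.\<close>

lemma form_Lq_free_divisible:
  fixes x y :: "('f::{field,finite} ^ 3) set \<Rightarrow> quat"
  assumes "x \<in> carrier (Lq_free R p q)" "y \<in> carrier (Lq_free R p q)"
  shows "\<exists>w\<in>R. form (Lq_free R p q) x y = w * p"
proof -
  define D where "D z \<longleftrightarrow> (\<exists>w\<in>R. z = w * p)" for z
  have D_0: "D 0"
    unfolding D_def using zero_in by (auto intro: bexI[of _ 0])
  have D_add: "D (a + b)" if "D a" "D b" for a b
    using that unfolding D_def by (metis add_in distrib_right)
  have D_sum: "D (sum f A)" if "\<And>i. i \<in> A \<Longrightarrow> D (f i)" for f and A :: "('f ^ 3) set set"
    using that by (induction A rule: infinite_finite_induct) (auto intro: D_0 D_add)
  have D_mult: "D (a * z * b)" if ab: "a \<in> R" "b \<in> R" and z: "D z" for a b z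
  proof -
    obtain w where w: "w \<in> R" "z = w * p"
      using z unfolding D_def by auto
    obtain b' where b': "b' \<in> R" "p * b = b' * p"
      using p_mult_commute_left[OF ab(2)] by auto
    have "a * z * b = a * w * b' * p"
      using b'(2) by (simp add: w mult.assoc)
    then show ?thesis
      unfolding D_def using ab w b' by (auto intro: ring_in)
  qed
  have "- of_nat q = - qcnj p * p"
    by (simp add: p_norm')
  moreover have "- qcnj p \<in> R"
    using p_in by (intro ring_in)
  ultimately have "D (- of_nat q)"
    unfolding D_def by blast
  moreover have "D p"
    unfolding D_def using one_in by (auto intro: bexI[of _ 1])
  moreover have "D (qcnj p)"
    unfolding D_def using qcnj_p_left by blast
  ultimately have "D (plane_gram p q r s)" for r s :: "('f ^ 3) set"
    by (simp add: plane_gram_def D_0)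
  moreover have "x r \<in> R" "y r \<in> R" for r
    using assms by (auto simp: Lq_free_def carrier_free_module)
  ultimately have "D (form (Lq_free R p q) x y)"
    unfolding Lq_free_def free_herm_simps by (intro D_sum D_mult qcnj_in)
  then show ?thesis
    by (simp add: D_def)
qed

lemma lincomb_lorentz_image:
  assumes q: "CARD('f::{field,finite}) = q" and j: "j \<in> lorentz_index"
  shows "\<exists>x\<in>carrier (Lq_free R p q :: (('f ^ 3) set \<Rightarrow> quat) herm_module).
    lincomb (lorentz_coord p) x = unit_vec j p"
proof -
  obtain v where v: "v \<in> R" "p = qcnj p * v"
    using qcnj_p_right by auto
  show ?thesis
  proof (cases j)
    case (Some P)
    then have P: "P \<in> points"
      using j by (auto simp: lorentz_index_def)
    have "lincomb (lorentz_coord p) (unit_vec P v) = unit_vec j p"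
      unfolding lincomb_unit_vec using P v(2)[symmetric] by (auto simp: lorentz_coord_def unit_vec_def Some)
    moreover have "unit_vec P v \<in> carrier (Lq_free R p q)"
      using P v(1) by (intro unit_vec_in_Lq_free) auto
    ultimately show ?thesis
      by blast
  next
    case None
    obtain l :: "('f ^ 3) set" where l: "l \<in> lines"
      using line_exists by blast
    have lp: "l \<notin> points"
      using points_lines_disjoint l by blast
    \<comment> \<open>The line with coefficient \<open>p\<close> contributes \<open>p\<close> in the
      positive direction and \<open>- p\<close> at each of its points; the coefficient
      \<open>v\<close> at these points adds \<open>qcnj p * v = p\<close> and cancels the
      latter.\<close>
    define x where "x = (\<lambda>r. if r = l then p else if r \<in> points \<and> r \<subseteq> l then v else 0)"
    have "x \<in> carrier (Lq_free R p q)"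
      using l by (auto simp: Lq_free_def carrier_free_module x_def p_in v(1) zero_in)
    moreover have "lincomb (lorentz_coord p) x = unit_vec j p"
    proof
      fix i
      have "lincomb (lorentz_coord p) x i = (\<Sum>r\<in>insert l points. lorentz_coord p r i * x r)"
        by (subst lincomb_superset[of "insert l points"]) (auto simp: x_def)
      also have "\<dots> = lorentz_coord p l i * p + (\<Sum>r\<in>points. lorentz_coord p r i * x r)"
        using lp by (simp add: x_def)
      also have "(\<Sum>r\<in>points. lorentz_coord p r i * x r) =
          (\<Sum>r\<in>points. if Some r = i then if r \<subseteq> l then p else 0 else 0)"
        using lp v(2)[symmetric] by (intro sum.cong) (auto simp: lorentz_coord_def x_def)
      also have "lorentz_coord p l i * p + \<dots> = unit_vec j p i"
      proof (cases i)
        case None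
        then show ?thesis
          using l lp \<open>j = None\<close> by (simp add: lorentz_coord_def unit_vec_def)
      next
        case (Some P)
        then show ?thesis
          using l lp \<open>j = None\<close> by (auto simp: lorentz_coord_def unit_vec_def)
      qed
      finally show "lincomb (lorentz_coord p) x i = unit_vec j p i" .
    qed
    ultimately show ?thesis
      by blast
  qed
qed

end

section \<open>The action of the projective linear group\<close>

lemma GL3_simps [simp]:
  "carrier GL3 = {A. invertible A}" "A \<otimes>\<^bsub>GL3\<^esub> B = A ** B" "\<one>\<^bsub>GL3\<^esub> = mat 1"
  by (simp_all add: GL3_def)

lemma invertible_mat_1: "invertible (mat 1 :: 'f::field ^ 'n ^ 'n)"
  unfolding invertible_def by (intro exI[of _ "mat 1"]) simp

lemma group_GL3: "group (GL3 :: ('f::field ^ 3 ^ 3) monoid)"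
proof (rule groupI)
  fix A :: "'f ^ 3 ^ 3" assume "A \<in> carrier GL3"
  then obtain B where "A ** B = mat 1" "B ** A = mat 1"
    by (auto simp: invertible_def)
  then show "\<exists>B\<in>carrier GL3. B \<otimes>\<^bsub>GL3\<^esub> A = \<one>\<^bsub>GL3\<^esub>"
    by (intro bexI[of _ B]) (auto simp: invertible_def)
qed (auto simp: invertible_mult invertible_mat_1 matrix_mul_assoc)

lemma mat_vector_mult: "mat c *v x = c *s (x :: 'f::field ^ 'n)"
proof -
  have "(\<Sum>j\<in>UNIV. (if i = j then c else 0) * x $ j) = c * x $ i" for i
  proof -
    have "(\<Sum>j\<in>UNIV. (if i = j then c else 0) * x $ j) = (\<Sum>j\<in>UNIV. if i = j then c * x $ j else 0)"
      by (intro sum.cong) auto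
    then show ?thesis
      by simp
  qed
  then show ?thesis
    by (simp add: matrix_vector_mult_def mat_def vec_eq_iff)
qed

lemma mat_mult_mat: "mat c ** mat d = (mat (c * d) :: 'f::field ^ 'n ^ 'n)"
  by (simp add: matrix_eq mat_vector_mult flip: matrix_vector_mul_assoc)

lemma mat_commute: "mat c ** A = A ** (mat c :: 'f::field ^ 'n ^ 'n)"
  by (simp add: matrix_eq mat_vector_mult vector_scalar_commute flip: matrix_vector_mul_assoc)

lemma invertible_mat: "c \<noteq> 0 \<Longrightarrow> invertible (mat c :: 'f::field ^ 'n ^ 'n)"
  unfolding invertible_def by (intro exI[of _ "mat (inverse c)"]) (simp add: mat_mult_mat)

lemma scalar_matrices_normal: "(scalar_matrices :: ('f::field ^ 3 ^ 3) set) \<lhd> GL3"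
proof -
  interpret group "GL3 :: ('f ^ 3 ^ 3) monoid" by (rule group_GL3)
  have "subgroup (scalar_matrices :: ('f ^ 3 ^ 3) set) GL3"
  proof (rule subgroupI)
    show "(scalar_matrices :: ('f ^ 3 ^ 3) set) \<noteq> {}"
      by (auto simp: scalar_matrices_def intro: exI[of _ 1])
    fix S :: "'f ^ 3 ^ 3" assume "S \<in> scalar_matrices"
    then obtain c where c: "S = mat c" "c \<noteq> 0"
      by (auto simp: scalar_matrices_def)
    then have "inv\<^bsub>GL3\<^esub> S = mat (inverse c)"
      by (intro inv_equality) (auto simp: mat_mult_mat invertible_mat)
    with c(2) show "inv\<^bsub>GL3\<^esub> S \<in> scalar_matrices"
      by (auto simp: scalar_matrices_def)
  next
    fix S T :: "'f ^ 3 ^ 3" assume "S \<in> scalar_matrices" "T \<in> scalar_matrices"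
    then show "S \<otimes>\<^bsub>GL3\<^esub> T \<in> scalar_matrices"
      by (auto simp: scalar_matrices_def mat_mult_mat)
  qed (auto simp: scalar_matrices_def invertible_mat)
  then show ?thesis
    by (rule normalI) (auto simp: r_coset_def l_coset_def scalar_matrices_def mat_commute)
qed

lemma group_PGL3: "group (PGL3 :: ('f::field ^ 3 ^ 3) set monoid)"
  unfolding PGL3_def by (rule normal.factorgroup_is_group[OF scalar_matrices_normal])

lemma carrier_PGL3_iff:
  fixes C :: "('a::field ^ 3 ^ 3) set"
  shows
  "C \<in> carrier PGL3 \<longleftrightarrow> (\<exists>A. invertible A \<and> C = {mat c ** A | c. c \<noteq> 0})"
proof -
  have "(\<Union>h\<in>scalar_matrices. {h ** A}) = {mat c ** A | c. c \<noteq> 0}" for A :: "'a ^ 3 ^ 3"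
    by (auto simp: scalar_matrices_def)
  then show ?thesis
    by (auto simp: PGL3_def FactGroup_def RCOSETS_def r_coset_def)
qed

lemma PGL3_mult: "C \<otimes>\<^bsub>PGL3\<^esub> D = {A ** B | A B. A \<in> C \<and> B \<in> D}"
  by (auto simp: PGL3_def FactGroup_def set_mult_def)

lemma PGL3_elem:
  assumes "C \<in> carrier PGL3" "A \<in> C"
  shows "invertible A" "C = {mat c ** A | c. c \<noteq> 0}"
proof -
  obtain B where B: "invertible B" "C = {mat c ** B | c. c \<noteq> 0}"
    using assms(1) by (auto simp: carrier_PGL3_iff)
  then obtain d where d: "A = mat d ** B" "d \<noteq> 0"
    using assms(2) by auto
  show "invertible A"
    using B d by (simp add: invertible_mult invertible_mat)
  have "{mat c ** B | c. c \<noteq> 0} = {mat c ** A | c. c \<noteq> 0}"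
  proof (intro equalityI subsetI)
    fix S assume "S \<in> {mat c ** B | c. c \<noteq> 0}"
    then obtain c where c: "S = mat c ** B" "c \<noteq> 0"
      by auto
    then have "S = mat (c / d) ** A"
      using d by (simp add: matrix_mul_assoc mat_mult_mat)
    then show "S \<in> {mat c ** A | c. c \<noteq> 0}"
      using c(2) d(2) by (intro CollectI exI[of _ "c / d"]) auto
  next
    fix S assume "S \<in> {mat c ** A | c. c \<noteq> 0}"
    then obtain c where c: "S = mat c ** A" "c \<noteq> 0"
      by auto
    then have "S = mat (c * d) ** B"
      using d by (simp add: matrix_mul_assoc mat_mult_mat)
    then show "S \<in> {mat c ** B | c. c \<noteq> 0}"
      using c(2) d(2) by (intro CollectI exI[of _ "c * d"]) auto
  qed
  with B(2) show "C = {mat c ** A | c. c \<noteq> 0}"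
    by simp
qed

lemma PGL3_nonempty: "C \<in> carrier PGL3 \<Longrightarrow> \<exists>A. A \<in> C"
  by (auto simp: carrier_PGL3_iff) (metis zero_neq_one)

section \<open>The permutation action of invertible matrices on the free module\<close>

context star_ring
begin

lemma carrier_Lq_free:
  "v \<in> carrier (Lq_free R p q) \<longleftrightarrow> (\<forall>r. v r \<in> R) \<and> (\<forall>r. r \<notin> points \<union> lines \<longrightarrow> v r = 0)"
  for v :: "('f::{field,finite} ^ 3) set \<Rightarrow> quat"
  by (simp add: Lq_free_def carrier_free_module)

lemma GL3_permute_in:
  fixes A :: "'f::{field,finite} ^ 3 ^ 3"
  assumes "invertible A" "v \<in> carrier (Lq_free R p q)"
  shows "GL3_permute A v \<in> carrier (Lq_free R p q)"
  unfolding carrier_Lq_free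
proof (intro conjI allI impI)
  fix r :: "('f ^ 3) set"
  obtain s where s: "r = (*v) A ` s"
    using bij_image_matrix[OF assms(1)] by (meson bij_pointE)
  show "GL3_permute A v r \<in> R"
    using assms by (simp add: s GL3_permute_image carrier_Lq_free)
  assume "r \<notin> points \<union> lines"
  then show "GL3_permute A v r = 0"
    using assms by (simp add: s GL3_permute_image carrier_Lq_free image_in_points_iff image_in_lines_iff)
qed

text \<open>Both support sums are extended to all subsets of the finite vector space. On these the
  matrix acts as a bijection that leaves \<open>plane_gram\<close> invariant, so the double sum can
  be reindexed.\<close>

lemma form_GL3_permute:
  fixes A :: "'f::{field,finite} ^ 3 ^ 3"
  assumes "invertible A"
  shows "form (Lq_free R p q) (GL3_permute A v) (GL3_permute A w) = form (Lq_free R p q) v w"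
proof -
  have form: "form (Lq_free R p q) v w = (\<Sum>r\<in>UNIV. \<Sum>s\<in>UNIV. qcnj (v r) * plane_gram p q r s * w s)"
    for v w :: "('f ^ 3) set \<Rightarrow> quat"
  proof -
    have "form (Lq_free R p q) v w =
        (\<Sum>r | v r \<noteq> 0. \<Sum>s\<in>UNIV. qcnj (v r) * plane_gram p q r s * w s)"
      unfolding Lq_free_def free_herm_simps by (intro sum.cong sum.mono_neutral_left) auto
    also have "\<dots> = (\<Sum>r\<in>UNIV. \<Sum>s\<in>UNIV. qcnj (v r) * plane_gram p q r s * w s)"
      by (intro sum.mono_neutral_left) auto
    finally show ?thesis .
  qed
  let ?g = "(`) ((*v) A)"
  have reindex: "(\<Sum>r\<in>UNIV. h r) = (\<Sum>r\<in>UNIV. h (?g r))" for h :: "('f ^ 3) set \<Rightarrow> quat"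
    using sum.reindex_bij_betw[OF bij_image_matrix[OF assms], of h] by simp
  have "form (Lq_free R p q) (GL3_permute A v) (GL3_permute A w) =
      (\<Sum>r\<in>UNIV. \<Sum>s\<in>UNIV. qcnj (GL3_permute A v (?g r)) * plane_gram p q (?g r) (?g s) * GL3_permute A w (?g s))"
    unfolding form by (subst reindex, rule sum.cong[OF refl], rule reindex)
  then show ?thesis
    unfolding form by (simp add: GL3_permute_image[OF assms] plane_gram_image[OF assms])
qed

text \<open>Subspaces are stable under nonzero scalars, and outside the points and lines both
  functions vanish. This is why all matrices in one element of \<open>PGL3\<close> act
  alike.\<close>

lemma GL3_permute_scalar:
  fixes v :: "('f::{field,finite} ^ 3) set \<Rightarrow> quat"
  assumes "c \<noteq> 0" "v \<in> carrier (Lq_free R p q)"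
  shows "GL3_permute (mat c) v = v"
proof
  fix r :: "('f ^ 3) set"
  show "GL3_permute (mat c) v r = v r"
  proof (cases "r \<in> points \<union> lines")
    case True
    then have sub: "vec.subspace r"
      by (auto simp: points_def lines_def)
    have "c *s x \<in> r \<longleftrightarrow> x \<in> r" for x
    proof
      assume "c *s x \<in> r"
      then have "inverse c *s (c *s x) \<in> r"
        using sub by (rule vec.subspace_scale[rotated])
      then show "x \<in> r"
        using assms(1) by (simp add: vec.scale_scale)
    qed (use sub in \<open>rule vec.subspace_scale\<close>)
    then show ?thesis
      by (simp add: GL3_permute_def vimage_def mat_vector_mult)
  next
    case False
    then show ?thesis
      using GL3_permute_in[OF invertible_mat[OF assms(1)] assms(2)] assms(2)
      by (simp add: carrier_Lq_free)
  qed
qed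

lemma GL3_permute_PGL3:
  assumes "C \<in> carrier PGL3" "A \<in> C" "B \<in> C" "v \<in> carrier (Lq_free R p q)"
  shows "GL3_permute B v = GL3_permute (A :: 'f::{field,finite} ^ 3 ^ 3) v"
proof -
  obtain c where "B = mat c ** A" "c \<noteq> 0"
    using PGL3_elem(2)[OF assms(1,2)] assms(3) by auto
  then show ?thesis
    using GL3_permute_in[OF PGL3_elem(1)[OF assms(1,2)] assms(4)]
    by (simp add: GL3_permute_mult GL3_permute_scalar)
qed

end

section \<open>The quotient lattice and its isometries\<close>

locale plane_lattice = admissible_ring R p q for R p q +
  fixes field_type :: "'f::{field,finite} itself"
  assumes card_field: "CARD('f) = q"
begin

abbreviation L0 :: "(('f ^ 3) set \<Rightarrow> quat) herm_module" where "L0 \<equiv> Lq_free R p q"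

sublocale kernel_quotient R L0 "lincomb (lorentz_coord p)" "Rad L0"
    "diag_form lorentz_index lorentz_sign"
  by (rule kernel_quotient_Lq[OF card_field])

lemma Lq_eq: "Lq R p q = Q"
  by (simp add: Lq_def)

lemma diagonal_sublattice_Q: "diagonal_sublattice R p q Q coord lorentz_index lorentz_sign"
proof (intro diagonal_sublattice.intro diagonal_sublattice_axioms.intro admissible_ring_axioms
    coord_module_Q inj_coord finite_lorentz_index)
  fix j :: "('f ^ 3) set option"
  show "lorentz_sign j \<in> {1, -1}"
    by (simp add: lorentz_sign_def)
  assume "j \<in> lorentz_index"
  then obtain x where "x \<in> carrier L0" "lincomb (lorentz_coord p) x = unit_vec j p"
    using lincomb_lorentz_image[OF card_field] by blast
  then show "\<exists>C\<in>carrier Q. coord C = unit_vec j p"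
    by (auto simp: carrier_Q coord_cls)
next
  fix C and j :: "('f ^ 3) set option"
  assume "C \<in> carrier Q"
  then obtain x where x: "x \<in> carrier L0" "C = cls x"
    by (auto simp: carrier_Q)
  then show "coord C j \<in> R"
    by (auto simp: coord_cls lincomb_def carrier_Lq_free intro!: sum_in mult_in lorentz_coord_in)
  assume "j \<notin> lorentz_index"
  with x show "coord C j = 0"
    by (simp add: coord_cls lincomb_def lorentz_coord_outside)
qed (rule form_coord)

text \<open>The radical is the kernel of the coordinates, so a class is determined by its pairings.
  This describes classes through the form, which the permutations preserve.\<close>

lemma lincomb_eq_iff:
  assumes "x \<in> carrier L0" "y \<in> carrier L0"
  shows "lincomb (lorentz_coord p) x = lincomb (lorentz_coord p) y \<longleftrightarrow>
    (\<forall>z\<in>carrier L0. form L0 z x = form L0 z y)"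
proof
  assume "\<forall>z\<in>carrier L0. form L0 z x = form L0 z y"
  then have eq: "form L0 z x = form L0 z y" if "z \<in> carrier L0" for z
    using that by blast
  have "form L0 z (x \<ominus>\<^bsub>L0\<^esub> y) = 0" if z: "z \<in> carrier L0" for z
  proof -
    have "form L0 z (x \<ominus>\<^bsub>L0\<^esub> y) + form L0 z y = form L0 z x"
      using assms z by (simp add: form_eq h_minus flip: diag_form_add_right)
    then show ?thesis
      using eq[OF z] by simp
  qed
  then have "x \<ominus>\<^bsub>L0\<^esub> y \<in> Rad L0"
    using assms by (simp add: Rad_def)
  then show "lincomb (lorentz_coord p) x = lincomb (lorentz_coord p) y"
    unfolding Rad_Lq_free[OF card_field] using assms by (auto simp: h_minus fun_eq_iff)
qed (use assms in \<open>simp add: form_eq\<close>)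

lemma GL3_permute_inverse:
  assumes "invertible A"
  obtains B where "invertible B" "\<And>v. GL3_permute A (GL3_permute B v) = v"
    "\<And>v. GL3_permute B (GL3_permute A v) = v"
proof -
  obtain B where "A ** B = mat 1" "B ** A = mat 1"
    using assms by (auto simp: invertible_def)
  moreover from this have "invertible B"
    by (auto simp: invertible_def)
  ultimately show ?thesis
    using that[of B] by (simp add: GL3_permute_one flip: GL3_permute_mult)
qed

text \<open>The matrix is moved to the test vector: pairing \<open>z\<close> with
  \<open>GL3_permute A x\<close> equals pairing \<open>GL3_permute B z\<close> with
  \<open>x\<close>, where \<open>B\<close> is inverse to \<open>A\<close>.\<close>

lemma lincomb_GL3_permute:
  assumes A: "invertible A" and xy: "x \<in> carrier L0" "y \<in> carrier L0"
    and eq: "lincomb (lorentz_coord p) x = lincomb (lorentz_coord p) y"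
  shows "lincomb (lorentz_coord p) (GL3_permute A x) = lincomb (lorentz_coord p) (GL3_permute A y)"
proof -
  obtain B where B: "invertible B" "\<And>v. GL3_permute A (GL3_permute B v) = v"
    by (rule GL3_permute_inverse[OF A]) (rule that)
  have "form L0 z (GL3_permute A x) = form L0 z (GL3_permute A y)" if "z \<in> carrier L0" for z
  proof -
    have "form L0 (GL3_permute B z) x = form L0 (GL3_permute B z) y"
      using GL3_permute_in[OF B(1) that] eq xy lincomb_eq_iff by blast
    then show ?thesis
      using form_GL3_permute[OF A, of p q "GL3_permute B z"] by (simp add: B(2))
  qed
  then show ?thesis
    using lincomb_eq_iff GL3_permute_in[OF A] xy by blast
qed

text \<open>One inclusion is compatibility of \<open>A\<close> with the classes; the other is the
  same fact for the inverse matrix.\<close>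

lemma GL3_permute_cls:
  assumes A: "invertible A" and x: "x \<in> carrier L0"
  shows "GL3_permute A ` cls x = cls (GL3_permute A x)"
proof (intro equalityI subsetI)
  fix y assume "y \<in> GL3_permute A ` cls x"
  then obtain z where z: "y = GL3_permute A z" "z \<in> cls x"
    by blast
  then have "z \<in> carrier L0" "lincomb (lorentz_coord p) z = lincomb (lorentz_coord p) x"
    using cls_eq[OF x] by simp_all
  then show "y \<in> cls (GL3_permute A x)"
    unfolding z(1) cls_eq[OF GL3_permute_in[OF A x]]
    using GL3_permute_in[OF A] lincomb_GL3_permute[OF A _ x] by blast
next
  fix y assume "y \<in> cls (GL3_permute A x)"
  then have y: "y \<in> carrier L0"
    "lincomb (lorentz_coord p) y = lincomb (lorentz_coord p) (GL3_permute A x)"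
    using cls_eq[OF GL3_permute_in[OF A x]] by simp_all
  obtain B where B: "invertible B" "\<And>v. GL3_permute A (GL3_permute B v) = v"
    "\<And>v. GL3_permute B (GL3_permute A v) = v"
    by (rule GL3_permute_inverse[OF A]) (rule that)
  have "GL3_permute B y \<in> cls x"
    using lincomb_GL3_permute[OF B(1) y(1) GL3_permute_in[OF A x] y(2)] GL3_permute_in[OF B(1) y(1)]
    unfolding cls_eq[OF x] B(3) by simp
  then show "y \<in> GL3_permute A ` cls x"
    using B(2) by (metis image_eqI)
qed

text \<open>Matrices in one coset differ by scalars, so the union in \<open>PGL3_action\<close>
  consists of equal classes and any representative \<open>A\<close> computes it.\<close>

lemma PGL3_action_cls:
  assumes "C \<in> carrier PGL3" "A \<in> C" "x \<in> carrier L0"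
  shows "PGL3_action Q C (cls x) = cls (GL3_permute A x)"
proof -
  have "PGL3_action Q C (cls x) = (\<Union>B\<in>C. GL3_permute B ` cls x)"
    using assms(3) by (simp add: PGL3_action_def carrier_Q)
  also have "\<dots> = (\<Union>B\<in>C. cls (GL3_permute A x))"
  proof (rule SUP_cong[OF refl])
    fix B assume B: "B \<in> C"
    show "GL3_permute B ` cls x = cls (GL3_permute A x)"
      unfolding GL3_permute_cls[OF PGL3_elem(1)[OF assms(1) B] assms(3)]
        GL3_permute_PGL3[OF assms(1,2) B assms(3)] by (rule refl)
  qed
  also have "\<dots> = cls (GL3_permute A x)"
    using assms(2) by auto
  finally show ?thesis .
qed

lemma bij_PGL3_action:
  assumes C: "C \<in> carrier PGL3"
  shows "bij_betw (PGL3_action Q C) (carrier Q) (carrier Q)"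
proof -
  obtain A where A: "A \<in> C" "invertible A"
    using PGL3_nonempty[OF C] PGL3_elem(1)[OF C] by blast
  obtain B where B: "invertible B" "\<And>v. GL3_permute A (GL3_permute B v) = v"
    "\<And>v. GL3_permute B (GL3_permute A v) = v"
    by (rule GL3_permute_inverse[OF A(2)]) (rule that)
  note act = PGL3_action_cls[OF C A(1)] and in_A = GL3_permute_in[OF A(2)]
    and in_B = GL3_permute_in[OF B(1)] and cls_B = GL3_permute_cls[OF B(1)]
  show ?thesis
  proof (rule bij_betw_byWitness[where f' = "\<lambda>D. GL3_permute B ` D"])
    show "\<forall>D\<in>carrier Q. GL3_permute B ` PGL3_action Q C D = D"
      unfolding carrier_Q by (simp add: act in_A cls_B B(3))
    show "\<forall>D\<in>carrier Q. PGL3_action Q C (GL3_permute B ` D) = D"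
      unfolding carrier_Q by (simp add: act in_B cls_B B(2))
    show "PGL3_action Q C ` carrier Q \<subseteq> carrier Q"
      unfolding carrier_Q by (rule image_subsetI, elim imageE) (simp add: act in_A)
    show "(`) (GL3_permute B) ` carrier Q \<subseteq> carrier Q"
      unfolding carrier_Q by (rule image_subsetI, elim imageE) (simp add: cls_B in_B)
  qed
qed

lemma group_action_PGL3: "group_action PGL3 (carrier Q) (PGL3_action Q)"
proof (rule group_action.intro, rule group_hom.intro)
  show "group (PGL3 :: ('f ^ 3 ^ 3) set monoid)"
    by (rule group_PGL3)
  show "group (BijGroup (carrier Q))"
    by (rule group_BijGroup)
  \<comment> \<open>The restriction built into \<open>PGL3_action\<close> supplies the
    extensionality that \<open>Bij\<close> demands.\<close>
  have Bij: "PGL3_action Q C \<in> Bij (carrier Q)" if "C \<in> carrier PGL3" for C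
    using bij_PGL3_action[OF that] by (simp add: Bij_def PGL3_action_def)
  show "group_hom_axioms PGL3 (BijGroup (carrier Q)) (PGL3_action Q)"
  proof (rule group_hom_axioms.intro, rule homI)
    fix C :: "('f ^ 3 ^ 3) set" assume "C \<in> carrier PGL3"
    then show "PGL3_action Q C \<in> carrier (BijGroup (carrier Q))"
      by (simp add: BijGroup_def Bij)
  next
    fix C D :: "('f ^ 3 ^ 3) set" assume CD: "C \<in> carrier PGL3" "D \<in> carrier PGL3"
    interpret group "PGL3 :: ('f ^ 3 ^ 3) set monoid"
      by (rule group_PGL3)
    have CD': "C \<otimes>\<^bsub>PGL3\<^esub> D \<in> carrier PGL3"
      using CD by simp
    obtain A B where AB: "A \<in> C" "B \<in> D"
      using PGL3_nonempty CD by meson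
    then have "A ** B \<in> C \<otimes>\<^bsub>PGL3\<^esub> D"
      by (auto simp: PGL3_mult)
    have "PGL3_action Q (C \<otimes>\<^bsub>PGL3\<^esub> D) = compose (carrier Q) (PGL3_action Q C) (PGL3_action Q D)"
    proof (rule extensionalityI)
      show "PGL3_action Q (C \<otimes>\<^bsub>PGL3\<^esub> D) \<in> extensional (carrier Q)"
        by (simp add: PGL3_action_def)
      fix E assume "E \<in> carrier Q"
      then obtain x where x: "x \<in> carrier L0" "E = cls x"
        by (auto simp: carrier_Q)
      then show "PGL3_action Q (C \<otimes>\<^bsub>PGL3\<^esub> D) E = compose (carrier Q) (PGL3_action Q C) (PGL3_action Q D) E"
        using GL3_permute_in[OF PGL3_elem(1)[OF CD(2) AB(2)] x(1)]
        by (simp add: compose_def carrier_Q PGL3_action_cls[OF CD' \<open>A ** B \<in> _\<close>]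
            PGL3_action_cls[OF CD(1) AB(1)] PGL3_action_cls[OF CD(2) AB(2)] GL3_permute_mult)
    qed simp
    then show "PGL3_action Q (C \<otimes>\<^bsub>PGL3\<^esub> D) =
        PGL3_action Q C \<otimes>\<^bsub>BijGroup (carrier Q)\<^esub> PGL3_action Q D"
      using CD by (simp add: BijGroup_def Bij)
  qed
qed

lemma isometry_PGL3_action:
  assumes C: "C \<in> carrier PGL3"
  shows "isometry R Q (PGL3_action Q C)"
proof -
  obtain A where A: "A \<in> C" "invertible A"
    using PGL3_nonempty[OF C] PGL3_elem(1)[OF C] by blast
  note act = PGL3_action_cls[OF C A(1)] and permute_in = GL3_permute_in[OF A(2)]
  have "GL3_permute A (x \<oplus>\<^bsub>L0\<^esub> y) = GL3_permute A x \<oplus>\<^bsub>L0\<^esub> GL3_permute A y" for x y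
    by (simp add: Lq_free_def GL3_permute_def)
  moreover have "GL3_permute A (a \<odot>\<^bsub>L0\<^esub> x) = a \<odot>\<^bsub>L0\<^esub> GL3_permute A x" for a x
    by (simp add: Lq_free_def GL3_permute_def)
  ultimately have "PGL3_action Q C \<in> right_module_hom (qring R) Q Q"
    unfolding right_module_hom_def
    by (auto simp: carrier_Q act add_Q smult_Q permute_in MM.rsmult_closed)
  moreover have "form Q (PGL3_action Q C D) (PGL3_action Q C E) = form Q D E"
    if "D \<in> carrier Q" "E \<in> carrier Q" for D E
    using that
    by (auto simp: carrier_Q act form_Q permute_in form_GL3_permute[OF A(2)] simp flip: form_eq)
  ultimately show ?thesis
    using bij_PGL3_action[OF C] by (simp add: isometry_def)
qed

lemma PGL3_action_root:
  assumes "C \<in> carrier PGL3" "A \<in> C" "r \<in> points \<union> lines"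
  shows "PGL3_action Q C (Lq_root R p q r) = Lq_root R p q ((\<lambda>x. A *v x) ` r)"
proof -
  have A: "invertible A"
    using assms(1,2) by (rule PGL3_elem(1))
  \<comment> \<open>\<open>GL3_permute\<close> evaluates at preimages, so the value 1 at
    \<open>r\<close> reappears exactly at the image of \<open>r\<close>.\<close>
  have "GL3_permute A (unit_vec r 1) = unit_vec ((*v) A ` r) 1"
  proof
    fix s :: "('f ^ 3) set"
    obtain t where s: "s = (*v) A ` t"
      using bij_image_matrix[OF A] by (meson bij_pointE)
    show "GL3_permute A (unit_vec r 1) s = unit_vec ((*v) A ` r) 1 s"
      using bij_invertible_matrix[OF A]
      by (simp add: s GL3_permute_image[OF A] unit_vec_def inj_image_eq_iff bij_def)
  qed
  then show ?thesis
    using PGL3_action_cls[OF assms(1,2) unit_vec_in_Lq_free[OF assms(3) one_in]]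
    by (simp add: Lq_root_def cls_def)
qed

lemma form_Q_divisible:
  assumes "C \<in> carrier Q" "D \<in> carrier Q"
  shows "\<exists>w\<in>R. form Q C D = w * p"
proof -
  obtain x y where "x \<in> carrier L0" "y \<in> carrier L0" "C = cls x" "D = cls y"
    using assms by (auto simp: carrier_Q)
  then show ?thesis
    using form_Lq_free_divisible[of x y] by (simp add: form_Q form_eq)
qed

lemma card_lorentz_index:
  "card {j \<in> (lorentz_index :: ('f ^ 3) set option set). lorentz_sign j = 1} = 1"
  "card {j \<in> (lorentz_index :: ('f ^ 3) set option set). lorentz_sign j = -1} = q\<^sup>2 + q + 1"
proof -
  have "{j \<in> (lorentz_index :: ('f ^ 3) set option set). lorentz_sign j = 1} = {None}"
    by (auto simp: lorentz_index_def lorentz_sign_def split: if_splits)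
  then show "card {j \<in> (lorentz_index :: ('f ^ 3) set option set). lorentz_sign j = 1} = 1"
    by simp
  have "{j \<in> (lorentz_index :: ('f ^ 3) set option set). lorentz_sign j = -1} = Some ` points"
    by (auto simp: lorentz_index_def lorentz_sign_def split: if_splits)
  then show "card {j \<in> (lorentz_index :: ('f ^ 3) set option set). lorentz_sign j = -1} = q\<^sup>2 + q + 1"
    using card_points[where 'f = 'f] card_field by (simp add: card_image)
qed

end

theorem mainTheorem2:
  fixes R :: "quat set" and p :: quat and q n :: nat
    and L :: "(('f::{field,finite} ^ 3) set \<Rightarrow> quat) set herm_module"
  assumes admissible: "admissible_triple R p q"
    and field_card: "CARD('f) = q"
    and n_def: "n = q\<^sup>2 + q + 1"
    and L_def: "L = Lq R p q"
  shows "hermitian_lattice R L \<and>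
    has_signature R L 1 n \<and>
    group_action (PGL3 :: ('f ^ 3 ^ 3) set monoid) (carrier L) (PGL3_action L) \<and>
    (\<forall>g \<in> carrier (PGL3 :: ('f ^ 3 ^ 3) set monoid). isometry R L (PGL3_action L g)) \<and>
    (\<forall>g \<in> carrier (PGL3 :: ('f ^ 3 ^ 3) set monoid). \<forall>A \<in> g. \<forall>r \<in> points \<union> lines.
       PGL3_action L g (Lq_root R p q r) = Lq_root R p q ((\<lambda>x. A *v x) ` r)) \<and>
    to_extension R L ` carrier L \<subseteq> (\<lambda>t. p \<odot>\<^bsub>extend_scalars R L\<^esub> t) ` dual_lattice R L"
proof -
  interpret admissible_ring R p q
    by (rule admissible_ring_if_admissible_triple[OF admissible])
  interpret plane_lattice R p q "TYPE('f)"
    by unfold_locales (rule field_card)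
  interpret Q: diagonal_sublattice R p q Q coord lorentz_index lorentz_sign
    by (rule diagonal_sublattice_Q)
  have "has_signature R Q 1 n"
    using Q.has_signature_L by (simp only: card_lorentz_index n_def)
  then show ?thesis
    unfolding L_def Lq_eq
    using Q.hermitian_lattice_L group_action_PGL3 isometry_PGL3_action PGL3_action_root
      Q.subset_p_dual[OF form_Q_divisible]
    by (intro conjI ballI) simp_all
qed

end
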